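(* Let $(X_\bullet,c_{X_\bullet})$ and $(Y_\bullet,c_{Y_\bullet})$ be $\mathbb{R}$-filtrations of closure spaces. Let $S\in\{\mathrm{VR},\check{C},\check{C}^{T}\}$, let $H$ denote simplicial homology, and let $j\ge0$. Then $$d_I\big(H_j(X_\bullet,S(c_{X_\bullet})),H_j(Y_\bullet,S(c_{Y_\bullet}))\big)=d_I\big(H_j(X_\bullet,S(A(c_{X_\bullet}))),H_j(Y_\bullet,S(A(c_{Y_\bullet})))\big)$$ $$\le 2\,d_{GH}\big((X_\bullet,A(c_{X_\bullet})),(Y_\bullet,A(c_{Y_\bullet}))\big)\le 2\,d_{GH}\big((X_\bullet,c_{X_\bullet}),(Y_\bullet,c_{Y_\bullet})\big).$$ If coefficients are in a field and the persistence modules are q-tame, then $$d_B\big(D(H_j(X_\bullet,S(c_{X_\bullet}))),D(H_j(Y_\bullet,S(c_{Y_\bullet})))\big)\le 2\,d_{GH}\big((X_\bullet,A(c_{X_\bullet})),(Y_\bullet,A(c_{Y_\bullet}))\big).$$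
   Context: A (Čech) closure space $(X,c)$ is a set $X$ with a function $c:2^X\to 2^X$ such that $c(\varnothing)=\varnothing$, $A\subset c(A)$, and $c(A\cup B)=c(A)\cup c(B)$. Write $c(x)$ for $c(\{x\})$. Continuous maps $f$ satisfy $f(c_X(A))\subset c_Y(f(A))$; $\mathbf{Cl}$ is the resulting category (cocomplete; monomorphisms are the injective continuous maps). The Alexandroff modification $A(c)$ of $c$ is the closure $A(c)(B)=\bigcup_{b\in B}c(b)$. An $\mathbb{R}$-filtration of closure spaces is a functor $(\mathbb{R},\le)\to\mathbf{Cl}$ sending each $s\le t$ to a monomorphism. It is an $\mathbb{R}$-filtered closure space if these maps are subset inclusions; then $X:=\bigcup_tX_t$. Every $\mathbb{R}$-filtration $X_\bullet$ is isomorphic to an $\mathbb{R}$-filtered closure space $X'_\bullet$ given by the images of the $X_t$ in a chosen colimit. A simplicial complex $(X,E)$ is a set $X$ with a collection $E$ of nonempty finite subsets containing all singletons and closed under nonempty subsets. For a closure space $(X,c)$, define simplicial complexes with vertex set $X$: $\mathrm{VR}(c)$ is the set of nonempty finite $\sigma\subset X$ with $\sigma\subset c(x)$ for all $x\in\sigma$; $\check{C}(c)$ is the set of nonempty finite $\sigma\subset X$ with $\sigma\subset c(x)$ for some $x\in X$; $\check{C}^T(c)$ is the set of nonempty finite $\sigma\subset X$ for which there is $x\in X$ with $x\in c(y)$ for all $y\in\sigma$. These are functors from $\mathbf{Cl}$ to simplicial complexes (identity on underlying maps). Applying $S$ and then $j$th simplicial homology (with fixed coefficients) elementwise to an $\mathbb{R}$-filtration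 yields a persistence module $H_j(X_\bullet,S(c_{X_\bullet}))$, i.e. a functor on $(\mathbb{R},\le)$. A multivalued map $C:X\rightrightarrows Y$ is a subset $C\subset X\times Y$ projecting onto $X$; write $xCy$ for $(x,y)\in C$, $C(A)=\{y\mid\exists a\in A,\ aCy\}$. It is a correspondence if it also projects onto $Y$; $C^T=\{(y,x)\mid xCy\}$. A function $f:X\to Y$ is subordinate to $C$ if $xCf(x)$ for all $x$. For $\mathbb{R}$-filtered closure spaces, $C:X\rightrightarrows Y$ is an $\varepsilon$-multivalued map if for all $t$: (1) $x\in X_t$, $xCy$ imply $y\in Y_{t+\varepsilon}$; (2) for all $A\subset X_t$ and $f$ subordinate to $C$, $C(c_{X_t}(A))\subset c_{Y_{t+\varepsilon}}(f(A))$. A correspondence $C$ is an $\varepsilon$-correspondence if $C$ and $C^T$ are $\varepsilon$-multivalued maps; $\mathrm{dist}(C)$ is the infimum of such $\varepsilon\ge0$ ($\infty$ if none). $d_{GH}(X_\bullet,Y_\bullet)=\frac12\inf_C\mathrm{dist}(C)$ over all correspondences; for $\mathbb{R}$-filtrations $d_{GH}(X_\bullet,Y_\bullet):=d_{GH}(X'_\bullet,Y'_\bullet)$. Functors $M,N$ on $(\mathbb{R},\le)$ are $\varepsilon$-interleaved if there are natural maps $\varphi_p:M_p\to N_{p+\varepsilon}$, $\psi_p:N_p\to M_{p+\varepsilon}$ with $\psi_{p+\varepsilon}\varphi_p=M_{p\le p+2\varepsilon}$, $\varphi_{p+\varepsilon}\psi_p=N_{p\le p+2\varepsilon}$; $d_I(M,N)$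 is the infimum of such $\varepsilon\ge0$. A persistence module $M$ of vector spaces is q-tame if $M_s\to M_t$ has finite rank for all $s<t$; such $M$ has a well-defined persistence diagram $D(M)$. An $\varepsilon$-matching of persistence diagrams is a partial bijection such that matched pairs are within $\varepsilon$ of each other and unmatched elements within $\varepsilon$ of the diagonal; the bottleneck distance $d_B$ is the infimum of $\varepsilon\ge 0$ for which an $\varepsilon$-matching exists. *)

theory Defs
  imports
    "Jordan_Normal_Form.Missing_VectorSpace"
    "HOL-Algebra.AbelCoset"
    "HOL-Library.Extended_Real"
    "HOL-Combinatorics.Permutations"
begin

section \<open>Closure spaces\<close>

definition closure_space :: "'a set \<Rightarrow> ('a set \<Rightarrow> 'a set) \<Rightarrow> bool" where
  "closure_space X c \<longleftrightarrow>
     (\<forall>A\<subseteq>X. c A \<subseteq> X) \<and>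
     c {} = {} \<and>
     (\<forall>A\<subseteq>X. A \<subseteq> c A) \<and>
     (\<forall>A\<subseteq>X. \<forall>B\<subseteq>X. c (A \<union> B) = c A \<union> c B)"

definition closure_continuous ::
    "'a set \<Rightarrow> ('a set \<Rightarrow> 'a set) \<Rightarrow> 'b set \<Rightarrow> ('b set \<Rightarrow> 'b set) \<Rightarrow> ('a \<Rightarrow> 'b) \<Rightarrow> bool" where
  "closure_continuous X c Y d f \<longleftrightarrow> f \<in> X \<rightarrow> Y \<and> (\<forall>A\<subseteq>X. f ` c A \<subseteq> d (f ` A))"

definition alexandroff :: "('a set \<Rightarrow> 'a set) \<Rightarrow> 'a set \<Rightarrow> 'a set" where
  "alexandroff c B = (\<Union>b\<in>B. c {b})"

lemma closure_space_alexandroff: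
  assumes "closure_space X c"
  shows "closure_space X (alexandroff c)"
proof -
  have c: "c {x} \<subseteq> X" "x \<in> c {x}" if "x \<in> X" for x
    using assms that unfolding closure_space_def
    by (metis empty_subsetI insert_subset)+
  show ?thesis
    unfolding closure_space_def alexandroff_def using c by blast
qed

lemma closure_continuous_alexandroff:
  assumes "closure_continuous X c Y d f"
  shows "closure_continuous X (alexandroff c) Y (alexandroff d) f"
proof -
  have f: "f \<in> X \<rightarrow> Y"
    using assms unfolding closure_continuous_def by simp
  have *: "f ` c {x} \<subseteq> d {f x}" if "x \<in> X" for x
    using assms that unfolding closure_continuous_def
    by (metis empty_subsetI image_empty image_insert insert_subset)
  have "f ` (\<Union>b\<in>A. c {b}) \<subseteq> (\<Union>b\<in>f ` A. d {b})" if "A \<subseteq> X" for A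
    using * that by fastforce
  with f show ?thesis
    unfolding closure_continuous_def alexandroff_def by simp
qed


section \<open>Filtrations of closure spaces\<close>

text \<open>
  The spaces of a filtration are subsets of one ambient type; this is no restriction, since a
  family of sets embeds into its disjoint union.  Only the values of the closures on subsets
  of the spaces, and of the structure maps on points of the spaces, are meaningful.
\<close>

record 'a cl_filtration =
  fspace :: "real \<Rightarrow> 'a set"
  fclos :: "real \<Rightarrow> 'a set \<Rightarrow> 'a set"
  fmap :: "real \<Rightarrow> real \<Rightarrow> 'a \<Rightarrow> 'a"

definition filtration :: "'a cl_filtration \<Rightarrow> bool" where
  "filtration X \<longleftrightarrow>
     (\<forall>t. closure_space (fspace X t) (fclos X t)) \<and>
     (\<forall>s t. s \<le> t \<longrightarrow>
        closure_continuous (fspace X s) (fclos X s) (fspace X t) (fclos X t) (fmap X s t) \<and>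
        inj_on (fmap X s t) (fspace X s)) \<and>
     (\<forall>t. \<forall>x\<in>fspace X t. fmap X t t x = x) \<and>
     (\<forall>s t u. s \<le> t \<longrightarrow> t \<le> u \<longrightarrow>
        (\<forall>x\<in>fspace X s. fmap X t u (fmap X s t x) = fmap X s u x))"

definition filtered_closure_space :: "'a cl_filtration \<Rightarrow> bool" where
  "filtered_closure_space X \<longleftrightarrow>
     filtration X \<and> (\<forall>s t. s \<le> t \<longrightarrow> (\<forall>x\<in>fspace X s. fmap X s t x = x))"

definition total_space :: "'a cl_filtration \<Rightarrow> 'a set" where
  "total_space X = (\<Union>t. fspace X t)"

definition alexandroff_filtration :: "'a cl_filtration \<Rightarrow> 'a cl_filtration" where
  "alexandroff_filtration X = X\<lparr>fclos := \<lambda>t. alexandroff (fclos X t)\<rparr>"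

lemma filtration_alexandroff:
  assumes "filtration X"
  shows "filtration (alexandroff_filtration X)"
  using assms
  by (auto simp: filtration_def alexandroff_filtration_def
      intro: closure_space_alexandroff closure_continuous_alexandroff)

text \<open>
  The colimit is taken to be the usual quotient of the disjoint union, whose points are the
  classes of pairs \<open>(t, x)\<close> with \<open>x\<close> in the space at \<open>t\<close>.  The images of the spaces
  in the colimit carry the closures transported along the bijections \<open>colim_inj X t\<close>, so that
  the resulting filtered closure space is isomorphic to the given filtration.
\<close>

definition colim_rel :: "'a cl_filtration \<Rightarrow> ((real \<times> 'a) \<times> (real \<times> 'a)) set" where
  "colim_rel X = {((s, x), (t, y)). x \<in> fspace X s \<and> y \<in> fspace X t \<and>
     (\<exists>u\<ge>max s t. fmap X s u x = fmap X t u y)}"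

definition colim_inj :: "'a cl_filtration \<Rightarrow> real \<Rightarrow> 'a \<Rightarrow> (real \<times> 'a) set" where
  "colim_inj X t x = colim_rel X `` {(t, x)}"

definition filtered_image :: "'a cl_filtration \<Rightarrow> (real \<times> 'a) set cl_filtration" where
  "filtered_image X =
     \<lparr>fspace = \<lambda>t. colim_inj X t ` fspace X t,
      fclos = \<lambda>t B. colim_inj X t ` fclos X t {x \<in> fspace X t. colim_inj X t x \<in> B},
      fmap = \<lambda>s t x. x\<rparr>"

lemma colim_inj_eq_iff:
  assumes X: "filtration X" and x: "x \<in> fspace X s" and y: "y \<in> fspace X t"
  shows "colim_inj X s x = colim_inj X t y \<longleftrightarrow> ((s, x), (t, y)) \<in> colim_rel X"
proof -
  have comp: "fmap X t u (fmap X s t x) = fmap X s u x"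
    if "s \<le> t" "t \<le> u" "x \<in> fspace X s" for s t u x
    using X that unfolding filtration_def by blast
  have rel: "((s, x), (t, y)) \<in> colim_rel X \<longleftrightarrow> x \<in> fspace X s \<and> y \<in> fspace X t \<and>
      (\<exists>u. s \<le> u \<and> t \<le> u \<and> fmap X s u x = fmap X t u y)" for s x t y
    unfolding colim_rel_def by auto
  have trans: "((s, x), (r, z)) \<in> colim_rel X"
    if "((s, x), (t, y)) \<in> colim_rel X" "((t, y), (r, z)) \<in> colim_rel X" for s x t y r z
  proof -
    from that obtain u v where uv: "s \<le> u" "t \<le> u" "fmap X s u x = fmap X t u y"
        "t \<le> v" "r \<le> v" "fmap X t v y = fmap X r v z"
      and mem: "x \<in> fspace X s" "y \<in> fspace X t" "z \<in> fspace X r"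
      unfolding rel by blast
    let ?w = "max u v"
    have "fmap X s ?w x = fmap X u ?w (fmap X s u x)"
      using comp[of s u ?w x] uv mem by simp
    also have "\<dots> = fmap X t ?w y"
      using comp[of t u ?w y] uv mem by simp
    also have "\<dots> = fmap X v ?w (fmap X t v y)"
      using comp[of t v ?w y] uv mem by simp
    also have "\<dots> = fmap X r ?w z"
      using comp[of r v ?w z] uv mem by simp
    finally show ?thesis
      unfolding rel using uv mem by (intro conjI exI[of _ ?w]) auto
  qed
  have sym: "((t, y), (s, x)) \<in> colim_rel X" if "((s, x), (t, y)) \<in> colim_rel X" for s x t y
    using that unfolding rel by metis
  have refl: "((t, y), (t, y)) \<in> colim_rel X"
    using y unfolding rel by blast
  have "z \<in> colim_inj X s x \<longleftrightarrow> z \<in> colim_inj X t y" if "((s, x), (t, y)) \<in> colim_rel X" for z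
    using trans[OF that] trans[OF sym[OF that]] unfolding colim_inj_def by (cases z) auto
  moreover have "(t, y) \<in> colim_inj X t y"
    using refl unfolding colim_inj_def by blast
  ultimately show ?thesis
    unfolding colim_inj_def by blast
qed

lemma inj_on_colim_inj:
  assumes X: "filtration X"
  shows "inj_on (colim_inj X t) (fspace X t)"
proof (rule inj_onI)
  fix x y assume xy: "x \<in> fspace X t" "y \<in> fspace X t" "colim_inj X t x = colim_inj X t y"
  then obtain u where "t \<le> u" "fmap X t u x = fmap X t u y"
    using colim_inj_eq_iff[OF X] unfolding colim_rel_def by auto
  then show "x = y"
    using X xy unfolding filtration_def inj_on_def by blast
qed

lemma colim_inj_fmap:
  assumes X: "filtration X" and "s \<le> t" "x \<in> fspace X s"
  shows "colim_inj X t (fmap X s t x) = colim_inj X s x"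
proof -
  have "fmap X s t x \<in> fspace X t" "fmap X t t (fmap X s t x) = fmap X s t x"
    using assms unfolding filtration_def closure_continuous_def by blast+
  then show ?thesis
    using assms colim_inj_eq_iff[OF X] by (auto simp: colim_rel_def)
qed

lemma fclos_filtered_image:
  assumes X: "filtration X" and "A \<subseteq> fspace X t"
  shows "fclos (filtered_image X) t (colim_inj X t ` A) = colim_inj X t ` fclos X t A"
proof -
  have "{x \<in> fspace X t. colim_inj X t x \<in> colim_inj X t ` A} = A"
    using assms(2) inj_on_colim_inj[OF X, of t] by (auto dest: inj_onD)
  then show ?thesis
    by (simp add: filtered_image_def)
qed

lemma filtered_closure_space_filtered_image:
  assumes X: "filtration X"
  shows "filtered_closure_space (filtered_image X)"
proof -
  let ?i = "colim_inj X" and ?Z = "filtered_image X"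
  have sp: "fspace ?Z t = ?i t ` fspace X t" and mp: "fmap ?Z s t z = z" for s t z
    by (simp_all add: filtered_image_def)
  have sub: "\<exists>A\<subseteq>fspace X t. B = ?i t ` A" if "B \<subseteq> fspace ?Z t" for B t
    using that sp by (metis subset_image_iff)
  have cs: "closure_space (fspace X t) (fclos X t)" for t
    using X unfolding filtration_def by simp
  have "closure_space (fspace ?Z t) (fclos ?Z t)" for t
    unfolding closure_space_def
  proof (intro conjI allI impI)
    fix B assume "B \<subseteq> fspace ?Z t"
    from sub[OF this] obtain A where A: "A \<subseteq> fspace X t" "B = ?i t ` A" by auto
    then have "A \<subseteq> fclos X t A" "fclos X t A \<subseteq> fspace X t"
      using cs[of t] unfolding closure_space_def by simp_all
    then show "fclos ?Z t B \<subseteq> fspace ?Z t" "B \<subseteq> fclos ?Z t B"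
      unfolding A(2) fclos_filtered_image[OF X A(1)] sp by (simp_all add: image_mono)
    fix B' assume "B' \<subseteq> fspace ?Z t"
    from sub[OF this] obtain A' where A': "A' \<subseteq> fspace X t" "B' = ?i t ` A'" by auto
    have "fclos X t (A \<union> A') = fclos X t A \<union> fclos X t A'"
      using cs[of t] A(1) A'(1) unfolding closure_space_def by simp
    then show "fclos ?Z t (B \<union> B') = fclos ?Z t B \<union> fclos ?Z t B'"
      using A A' fclos_filtered_image[OF X, of _ t] by (simp flip: image_Un)
  next
    show "fclos ?Z t {} = {}"
      using cs[of t] fclos_filtered_image[OF X, of "{}" t] unfolding closure_space_def by simp
  qed
  moreover have "closure_continuous (fspace ?Z s) (fclos ?Z s) (fspace ?Z t) (fclos ?Z t) (fmap ?Z s t)"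
    if st: "s \<le> t" for s t
    unfolding closure_continuous_def
  proof (intro conjI allI impI)
    have cont: "fmap X s t \<in> fspace X s \<rightarrow> fspace X t"
      "\<And>A. A \<subseteq> fspace X s \<Longrightarrow> fmap X s t ` fclos X s A \<subseteq> fclos X t (fmap X s t ` A)"
      using X st unfolding filtration_def closure_continuous_def by simp_all
    have img: "?i s ` A = ?i t ` fmap X s t ` A" if "A \<subseteq> fspace X s" for A
      using colim_inj_fmap[OF X st] that by (auto simp: image_image intro!: image_cong)
    show "fmap ?Z s t \<in> fspace ?Z s \<rightarrow> fspace ?Z t"
      using cont(1) img[of "fspace X s"] by (auto simp: sp mp)
    fix B assume "B \<subseteq> fspace ?Z s"
    from sub[OF this] obtain A where A: "A \<subseteq> fspace X s" "B = ?i s ` A" by auto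
    have cA: "fclos X s A \<subseteq> fspace X s"
      using cs[of s] A(1) unfolding closure_space_def by simp
    have "fmap X s t ` A \<subseteq> fspace X t" using A cont(1) by blast
    then have "fclos ?Z t B = ?i t ` fclos X t (fmap X s t ` A)"
      using fclos_filtered_image[OF X] A img by simp
    moreover have "fclos ?Z s B = ?i t ` fmap X s t ` fclos X s A"
      using fclos_filtered_image[OF X A(1)] A(2) img[OF cA] by simp
    ultimately show "fmap ?Z s t ` fclos ?Z s B \<subseteq> fclos ?Z t (fmap ?Z s t ` B)"
      using cont(2)[OF A(1)] by (auto simp: mp)
  qed
  ultimately show ?thesis
    unfolding filtered_closure_space_def filtration_def by (simp add: mp inj_on_def)
qed


section \<open>Correspondences and the Gromov--Hausdorff distance\<close>

definition multivalued_map :: "'a set \<Rightarrow> 'b set \<Rightarrow> ('a \<times> 'b) set \<Rightarrow> bool" where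
  "multivalued_map X Y C \<longleftrightarrow> C \<subseteq> X \<times> Y \<and> Domain C = X"

definition correspondence :: "'a set \<Rightarrow> 'b set \<Rightarrow> ('a \<times> 'b) set \<Rightarrow> bool" where
  "correspondence X Y C \<longleftrightarrow> multivalued_map X Y C \<and> Range C = Y"

definition subordinate :: "'a set \<Rightarrow> ('a \<times> 'b) set \<Rightarrow> ('a \<Rightarrow> 'b) \<Rightarrow> bool" where
  "subordinate X C f \<longleftrightarrow> (\<forall>x\<in>X. (x, f x) \<in> C)"

definition eps_multivalued_map ::
    "real \<Rightarrow> 'a cl_filtration \<Rightarrow> 'b cl_filtration \<Rightarrow> ('a \<times> 'b) set \<Rightarrow> bool" where
  "eps_multivalued_map \<epsilon> X Y C \<longleftrightarrow>
     multivalued_map (total_space X) (total_space Y) C \<and>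
     (\<forall>t.
        (\<forall>x y. x \<in> fspace X t \<longrightarrow> (x, y) \<in> C \<longrightarrow> y \<in> fspace Y (t + \<epsilon>)) \<and>
        (\<forall>A f. A \<subseteq> fspace X t \<longrightarrow> subordinate (total_space X) C f \<longrightarrow>
           C `` fclos X t A \<subseteq> fclos Y (t + \<epsilon>) (f ` A)))"

definition eps_correspondence ::
    "real \<Rightarrow> 'a cl_filtration \<Rightarrow> 'b cl_filtration \<Rightarrow> ('a \<times> 'b) set \<Rightarrow> bool" where
  "eps_correspondence \<epsilon> X Y C \<longleftrightarrow>
     correspondence (total_space X) (total_space Y) C \<and>
     eps_multivalued_map \<epsilon> X Y C \<and> eps_multivalued_map \<epsilon> Y X (C\<inverse>)"

definition distortion :: "'a cl_filtration \<Rightarrow> 'b cl_filtration \<Rightarrow> ('a \<times> 'b) set \<Rightarrow> ereal" where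
  "distortion X Y C = Inf {ereal \<epsilon> | \<epsilon>. \<epsilon> \<ge> 0 \<and> eps_correspondence \<epsilon> X Y C}"

definition d_GH_filtered :: "'a cl_filtration \<Rightarrow> 'b cl_filtration \<Rightarrow> ereal" where
  "d_GH_filtered X Y =
     (INF C\<in>{C. correspondence (total_space X) (total_space Y) C}. distortion X Y C) / 2"

definition d_GH :: "'a cl_filtration \<Rightarrow> 'b cl_filtration \<Rightarrow> ereal" where
  "d_GH X Y = d_GH_filtered (filtered_image X) (filtered_image Y)"


section \<open>Simplicial complexes of a closure space\<close>

definition simplicial_complex :: "'a set \<Rightarrow> 'a set set \<Rightarrow> bool" where
  "simplicial_complex X E \<longleftrightarrow>
     (\<forall>\<sigma>\<in>E. \<sigma> \<subseteq> X \<and> finite \<sigma> \<and> \<sigma> \<noteq> {}) \<and>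
     (\<forall>x\<in>X. {x} \<in> E) \<and>
     (\<forall>\<sigma>\<in>E. \<forall>\<tau>. \<tau> \<noteq> {} \<longrightarrow> \<tau> \<subseteq> \<sigma> \<longrightarrow> \<tau> \<in> E)"

definition VR_complex :: "'a set \<Rightarrow> ('a set \<Rightarrow> 'a set) \<Rightarrow> 'a set set" where
  "VR_complex X c = {\<sigma>. \<sigma> \<noteq> {} \<and> finite \<sigma> \<and> \<sigma> \<subseteq> X \<and> (\<forall>x\<in>\<sigma>. \<sigma> \<subseteq> c {x})}"

definition Cech_complex :: "'a set \<Rightarrow> ('a set \<Rightarrow> 'a set) \<Rightarrow> 'a set set" where
  "Cech_complex X c = {\<sigma>. \<sigma> \<noteq> {} \<and> finite \<sigma> \<and> \<sigma> \<subseteq> X \<and> (\<exists>x\<in>X. \<sigma> \<subseteq> c {x})}"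

definition CechT_complex :: "'a set \<Rightarrow> ('a set \<Rightarrow> 'a set) \<Rightarrow> 'a set set" where
  "CechT_complex X c = {\<sigma>. \<sigma> \<noteq> {} \<and> finite \<sigma> \<and> \<sigma> \<subseteq> X \<and> (\<exists>x\<in>X. \<forall>y\<in>\<sigma>. x \<in> c {y})}"

datatype complex_functor = VR | Cech | CechT

fun complex_of :: "complex_functor \<Rightarrow> 'a set \<Rightarrow> ('a set \<Rightarrow> 'a set) \<Rightarrow> 'a set set" where
  "complex_of VR = VR_complex"
| "complex_of Cech = Cech_complex"
| "complex_of CechT = CechT_complex"

lemma simplicial_complex_complex_of:
  assumes "closure_space X c"
  shows "simplicial_complex X (complex_of S X c)"
proof -
  have "x \<in> c {x}" if "x \<in> X" for x
    using assms that unfolding closure_space_def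
    by (metis empty_subsetI insert_subset)
  then show ?thesis
    by (cases S; simp add: simplicial_complex_def VR_complex_def Cech_complex_def
        CechT_complex_def; meson finite_subset subset_trans subsetD)
qed


section \<open>Simplicial homology\<close>

text \<open>
  Oriented simplicial chains with coefficients in a module \<open>G\<close>: a \<open>j\<close>-chain is a finitely
  supported function \<open>c\<close> on orderings of \<open>j\<close>-simplices whose value changes by the sign of a
  permutation of the ordering.  Thus \<open>c\<close> is the formal sum, over the \<open>j\<close>-simplices with one
  chosen ordering \<open>vs\<close> each, of \<open>c vs\<close> times the oriented simplex \<open>[vs]\<close>.  Coefficients in an
  abelian group are modules over the integers; coefficients in a field or commutative ring are
  given by its regular module.  The ring components \<open>mult\<close> and \<open>one\<close> of a module record are
  irrelevant.
\<close>

definition chains :: "nat \<Rightarrow> 'a set set \<Rightarrow> ('r, 'g) module \<Rightarrow> ('r, 'a list \<Rightarrow> 'g) module" where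
  "chains j E G =
     \<lparr>carrier = {c. range c \<subseteq> carrier G \<and> finite {vs. c vs \<noteq> \<zero>\<^bsub>G\<^esub>} \<and>
        (\<forall>vs. c vs \<noteq> \<zero>\<^bsub>G\<^esub> \<longrightarrow> length vs = Suc j \<and> distinct vs \<and> set vs \<in> E) \<and>
        (\<forall>vs p. p permutes {..<length vs} \<longrightarrow>
           c (permute_list p vs) = (if evenperm p then c vs else \<ominus>\<^bsub>G\<^esub> c vs))},
      mult = (\<lambda>_ _ _. \<zero>\<^bsub>G\<^esub>), one = (\<lambda>_. \<zero>\<^bsub>G\<^esub>),
      zero = (\<lambda>_. \<zero>\<^bsub>G\<^esub>), add = (\<lambda>c d vs. c vs \<oplus>\<^bsub>G\<^esub> d vs),
      smult = (\<lambda>r c vs. r \<odot>\<^bsub>G\<^esub> c vs)\<rparr>"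

text \<open>
  The formula \<open>\<partial>[v0, \<dots>, vj] = (\<Sum>i. (-1)^i [v0, \<dots>, omit vi, \<dots>, vj])\<close> in terms of
  coefficients: a \<open>j\<close>-simplex having the set of \<open>ws\<close> as a facet, with remaining vertex \<open>v\<close>,
  may be ordered as \<open>v # ws\<close>, and then \<open>[ws]\<close> is its face for \<open>i = 0\<close>, with sign \<open>+1\<close>.
\<close>

definition boundary :: "nat \<Rightarrow> ('r, 'g) module \<Rightarrow> ('a list \<Rightarrow> 'g) \<Rightarrow> 'a list \<Rightarrow> 'g" where
  "boundary j G c ws =
     (if j = 0 then \<zero>\<^bsub>G\<^esub> else \<Oplus>\<^bsub>G\<^esub>v\<in>{v. c (v # ws) \<noteq> \<zero>\<^bsub>G\<^esub>}. c (v # ws))"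

definition cycles :: "nat \<Rightarrow> 'a set set \<Rightarrow> ('r, 'g) module \<Rightarrow> ('a list \<Rightarrow> 'g) set" where
  "cycles j E G = {c \<in> carrier (chains j E G). boundary j G c = (\<lambda>_. \<zero>\<^bsub>G\<^esub>)}"

definition boundaries :: "nat \<Rightarrow> 'a set set \<Rightarrow> ('r, 'g) module \<Rightarrow> ('a list \<Rightarrow> 'g) set" where
  "boundaries j E G = boundary (Suc j) G ` carrier (chains (Suc j) E G)"

definition quotient_module :: "('r, 'm) module \<Rightarrow> 'm set \<Rightarrow> ('r, 'm set) module" where
  "quotient_module M N =
     \<lparr>carrier = a_rcosets\<^bsub>M\<^esub> N, mult = (\<lambda>_ _. N), one = N,
      zero = N, add = (\<lambda>A B. A <+>\<^bsub>M\<^esub> B),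
      smult = (\<lambda>r A. \<Union>x\<in>A. N +>\<^bsub>M\<^esub> (r \<odot>\<^bsub>M\<^esub> x))\<rparr>"

definition homology ::
    "nat \<Rightarrow> 'a set set \<Rightarrow> ('r, 'g) module \<Rightarrow> ('r, ('a list \<Rightarrow> 'g) set) module" where
  "homology j E G =
     quotient_module ((chains j E G)\<lparr>carrier := cycles j E G\<rparr>) (boundaries j E G)"

text \<open>
  The chain map of a vertex map \<open>f\<close> sends \<open>[v0, \<dots>, vj]\<close> to \<open>[f v0, \<dots>, f vj]\<close> if these
  vertices are distinct, and to \<open>0\<close> otherwise.
\<close>

definition chain_push ::
    "('r, 'g) module \<Rightarrow> ('a \<Rightarrow> 'b) \<Rightarrow> ('a list \<Rightarrow> 'g) \<Rightarrow> 'b list \<Rightarrow> 'g" where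
  "chain_push G f c ws =
     (if distinct ws then \<Oplus>\<^bsub>G\<^esub>vs\<in>{vs. c vs \<noteq> \<zero>\<^bsub>G\<^esub> \<and> map f vs = ws}. c vs else \<zero>\<^bsub>G\<^esub>)"

definition homology_map ::
    "nat \<Rightarrow> 'b set set \<Rightarrow> ('r, 'g) module \<Rightarrow> ('a \<Rightarrow> 'b) \<Rightarrow>
      ('a list \<Rightarrow> 'g) set \<Rightarrow> ('b list \<Rightarrow> 'g) set" where
  "homology_map j E' G f A =
     (\<Union>c\<in>A. boundaries j E' G +>\<^bsub>chains j E' G\<^esub> chain_push G f c)"


section \<open>Persistence modules and the interleaving distance\<close>

text \<open>The data of a functor from the ordered set of reals to modules.\<close>

record ('r, 'm) pers_module =
  pobj :: "real \<Rightarrow> ('r, 'm) module"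
  pmap :: "real \<Rightarrow> real \<Rightarrow> 'm \<Rightarrow> 'm"

definition persistent_homology ::
    "nat \<Rightarrow> complex_functor \<Rightarrow> ('r, 'g) module \<Rightarrow> 'a cl_filtration \<Rightarrow>
      ('r, ('a list \<Rightarrow> 'g) set) pers_module" where
  "persistent_homology j S G X =
     \<lparr>pobj = \<lambda>t. homology j (complex_of S (fspace X t) (fclos X t)) G,
      pmap = \<lambda>s t. homology_map j (complex_of S (fspace X t) (fclos X t)) G (fmap X s t)\<rparr>"

definition shifted_morphism ::
    "'r ring \<Rightarrow> real \<Rightarrow> ('r, 'm) pers_module \<Rightarrow> ('r, 'n) pers_module \<Rightarrow>
      (real \<Rightarrow> 'm \<Rightarrow> 'n) \<Rightarrow> bool" where
  "shifted_morphism R \<epsilon> M N \<phi> \<longleftrightarrow>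
     (\<forall>p. \<phi> p \<in> LinearCombinations.module_hom R (pobj M p) (pobj N (p + \<epsilon>))) \<and>
     (\<forall>p q. p \<le> q \<longrightarrow> (\<forall>x\<in>carrier (pobj M p).
        \<phi> q (pmap M p q x) = pmap N (p + \<epsilon>) (q + \<epsilon>) (\<phi> p x)))"

definition interleaved ::
    "'r ring \<Rightarrow> real \<Rightarrow> ('r, 'm) pers_module \<Rightarrow> ('r, 'n) pers_module \<Rightarrow> bool" where
  "interleaved R \<epsilon> M N \<longleftrightarrow> (\<exists>\<phi> \<psi>.
     shifted_morphism R \<epsilon> M N \<phi> \<and> shifted_morphism R \<epsilon> N M \<psi> \<and>
     (\<forall>p. \<forall>x\<in>carrier (pobj M p). \<psi> (p + \<epsilon>) (\<phi> p x) = pmap M p (p + 2 * \<epsilon>) x) \<and>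
     (\<forall>p. \<forall>y\<in>carrier (pobj N p). \<phi> (p + \<epsilon>) (\<psi> p y) = pmap N p (p + 2 * \<epsilon>) y))"

definition d_I :: "'r ring \<Rightarrow> ('r, 'm) pers_module \<Rightarrow> ('r, 'n) pers_module \<Rightarrow> ereal" where
  "d_I R M N = Inf {ereal \<epsilon> | \<epsilon>. \<epsilon> \<ge> 0 \<and> interleaved R \<epsilon> M N}"


section \<open>Persistence diagrams and the bottleneck distance\<close>

definition regular_module :: "'k ring \<Rightarrow> ('k, 'k) module" where
  "regular_module K =
     \<lparr>carrier = carrier K, mult = mult K, one = one K, zero = zero K, add = add K,
      smult = mult K\<rparr>"

definition pmap_image :: "('k, 'm) pers_module \<Rightarrow> real \<Rightarrow> real \<Rightarrow> ('k, 'm) module" where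
  "pmap_image M s t = (pobj M t)\<lparr>carrier := pmap M s t ` carrier (pobj M s)\<rparr>"

definition q_tame :: "'k ring \<Rightarrow> ('k, 'm) pers_module \<Rightarrow> bool" where
  "q_tame K M \<longleftrightarrow> (\<forall>s t. s < t \<longrightarrow> vectorspace.fin_dim K (pmap_image M s t))"

text \<open>
  The diagram of a q-tame module is the one defined by its rectangle measure (Chazal, de Silva,
  Glisse and Oudot, \<open>The Structure and Stability of Persistence Modules\<close>).  A module is extended
  by zero to \<open>\<plusminus>\<infinity>\<close>, and the measure of \<open>[a, b] \<times> [c, d]\<close> counts the features
  that are born in \<open>[a, b]\<close> and die in \<open>[c, d]\<close>.  The multiplicity of a point is the least measure
  of a rectangle having the point in its interior, relative to the extended half-plane.
\<close>

definition ext_rank :: "'k ring \<Rightarrow> ('k, 'm) pers_module \<Rightarrow> ereal \<Rightarrow> ereal \<Rightarrow> nat" where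
  "ext_rank K M s t =
     (if s = -\<infinity> \<or> t = \<infinity> then 0
      else vectorspace.dim K (pmap_image M (real_of_ereal s) (real_of_ereal t)))"

definition rect_measure ::
    "'k ring \<Rightarrow> ('k, 'm) pers_module \<Rightarrow> ereal \<Rightarrow> ereal \<Rightarrow> ereal \<Rightarrow> ereal \<Rightarrow> int" where
  "rect_measure K M a b c d =
     int (ext_rank K M b c) - int (ext_rank K M a c)
     - int (ext_rank K M b d) + int (ext_rank K M a d)"

type_synonym diagram = "ereal \<times> ereal \<Rightarrow> nat"

definition pers_diagram :: "'k ring \<Rightarrow> ('k, 'm) pers_module \<Rightarrow> diagram" where
  "pers_diagram K M = (\<lambda>(p, q).
     if p < q then
       Inf {nat (rect_measure K M a b c d) | a b c d.
         (a < p \<or> a = -\<infinity> \<and> p = -\<infinity>) \<and> p < b \<and> b < c \<and> c < q \<and>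
         (q < d \<or> q = \<infinity> \<and> d = \<infinity>)}
     else 0)"

definition diagram_elements :: "diagram \<Rightarrow> ((ereal \<times> ereal) \<times> nat) set" where
  "diagram_elements D = {(z, i). i < D z}"

text \<open>In \<^typ>\<open>ereal\<close> the difference \<open>\<infinity> - \<infinity>\<close> is \<open>\<infinity>\<close>.\<close>

definition coord_dist :: "ereal \<Rightarrow> ereal \<Rightarrow> ereal" where
  "coord_dist a b = (if a = b then 0 else \<bar>a - b\<bar>)"

definition plane_dist :: "ereal \<times> ereal \<Rightarrow> ereal \<times> ereal \<Rightarrow> ereal" where
  "plane_dist z w = max (coord_dist (fst z) (fst w)) (coord_dist (snd z) (snd w))"

definition near_diagonal :: "real \<Rightarrow> ereal \<times> ereal \<Rightarrow> bool" where
  "near_diagonal \<epsilon> z \<longleftrightarrow> (\<exists>d. plane_dist z (d, d) \<le> ereal \<epsilon>)"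

definition eps_matching ::
    "real \<Rightarrow> diagram \<Rightarrow> diagram \<Rightarrow> (((ereal \<times> ereal) \<times> nat) \<times> ((ereal \<times> ereal) \<times> nat)) set \<Rightarrow> bool"
  where
  "eps_matching \<epsilon> D D' P \<longleftrightarrow>
     P \<subseteq> diagram_elements D \<times> diagram_elements D' \<and>
     single_valued P \<and> single_valued (P\<inverse>) \<and>
     (\<forall>(x, y)\<in>P. plane_dist (fst x) (fst y) \<le> ereal \<epsilon>) \<and>
     (\<forall>x\<in>diagram_elements D - Domain P. near_diagonal \<epsilon> (fst x)) \<and>
     (\<forall>y\<in>diagram_elements D' - Range P. near_diagonal \<epsilon> (fst y))"

definition d_B :: "diagram \<Rightarrow> diagram \<Rightarrow> ereal" where
  "d_B D D' = Inf {ereal \<epsilon> | \<epsilon>. \<epsilon> \<ge> 0 \<and> (\<exists>P. eps_matching \<epsilon> D D' P)}"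

end

theory Submission
  imports Defs
begin

text \<open>
  The complexes depend only on the closures of points, which are the same for a closure and its
  Alexandroff modification.  Selections of an \<open>\<epsilon>\<close>-correspondence are simplicial maps, natural in
  the filtration parameter, and the composites of two of them are contiguous to the structure
  maps; hence they induce an \<open>\<epsilon>\<close>-interleaving in homology.

  For the bottleneck distance, no interpolation between the interleaved modules \<open>M\<close> and \<open>N\<close> is
  used.  Let \<open>I\<close> be the image of \<open>\<phi>\<close>.  Since \<open>M \<rightarrow> I\<close> is onto, the diagram of \<open>I\<close> has at most
  as many points as that of \<open>M\<close> with a given birth and death beyond a given value, and the
  interleaving bounds the loss by \<open>2\<epsilon>\<close>.  So listing the points with a given birth by decreasing
  death matches the two diagrams.  Dually \<open>I\<close> is matched with \<open>N\<close>, preserving deaths, and the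
  composite is an \<open>\<epsilon>\<close>-matching.  All inequalities between ranks needed here are instances of
  \<open>dim T W' - dim T W \<le> dim W' - dim W\<close> for \<open>W \<subseteq> W'\<close>.
\<close>

section \<open>Matching the diagrams of rank functions\<close>

text \<open>q-tame modules need not split into intervals, and their diagrams may accumulate at the
  diagonal. What stays finite is the number of points with birth exactly \<open>p\<close> and death
  at or beyond some \<open>t > p\<close>. It is a limit of differences of ranks, and the diagrams
  are compared through these numbers alone.

  Each of the two matchings is lopsided: it moves a death, or a birth, by an amount between 0 and
  \<open>2\<epsilon>\<close> in one direction only. But \<open>I\<close> at time \<open>t\<close>
  lies in \<open>N\<close> at time \<open>t + \<epsilon>\<close>, and this translation centres both
  errors, which leaves \<open>\<epsilon>\<close>.

  A prism operator for contiguous maps would depend on an ordering of the vertices. Instead the two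
  maps are exchanged at one vertex at a time, where the connecting chain is an explicit join with
  the link of that vertex.

  Contiguity itself rests on a quantifier: the closure condition for multivalued maps is imposed for
  every selection, so the value of the selection at one point may be prescribed to be any related
  point.\<close>

definition extended_rank :: "(real \<Rightarrow> real \<Rightarrow> nat) \<Rightarrow> ereal \<Rightarrow> ereal \<Rightarrow> nat" where
  "extended_rank r s t = (if s = -\<infinity> \<or> t = \<infinity> then 0 else r (real_of_ereal s) (real_of_ereal t))"

definition rank_measure :: "(real \<Rightarrow> real \<Rightarrow> nat) \<Rightarrow> ereal \<Rightarrow> ereal \<Rightarrow> ereal \<Rightarrow> ereal \<Rightarrow> int" where
  "rank_measure r a b c d = int (extended_rank r b c) - int (extended_rank r a c) - int (extended_rank r b d) + int (extended_rank r a d)"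

definition around :: "ereal \<Rightarrow> ereal \<Rightarrow> ereal \<Rightarrow> ereal \<Rightarrow> ereal \<Rightarrow> ereal \<Rightarrow> bool" where
  "around p q a b c d \<longleftrightarrow> (a < p \<or> a = -\<infinity> \<and> p = -\<infinity>) \<and> p < b \<and> b < c \<and> c < q \<and>
         (q < d \<or> q = \<infinity> \<and> d = \<infinity>)"

definition rank_diagram :: "(real \<Rightarrow> real \<Rightarrow> nat) \<Rightarrow> diagram" where
  "rank_diagram r = (\<lambda>(p, q). if p < q then
     Inf {nat (rank_measure r a b c d) | a b c d. around p q a b c d} else 0)"

text \<open>Says that \<open>rank_measure\<close> is nonnegative on every rectangle, written with
  sums because ranks are natural numbers. Infinite corners contribute zero ranks, so monotonicity in
  each argument is included. The inequality \<open>b < c\<close> is strict because q-tameness bounds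
  ranks only off the diagonal.\<close>

definition rank_function :: "(real \<Rightarrow> real \<Rightarrow> nat) \<Rightarrow> bool" where
  "rank_function r \<longleftrightarrow> (\<forall>a b c d. a \<le> b \<longrightarrow> b < c \<longrightarrow> c \<le> d \<longrightarrow>
     extended_rank r a c + extended_rank r b d \<le> extended_rank r b c + extended_rank r a d)"

lemma ext_rank_eq: "ext_rank K M = extended_rank (\<lambda>s t. vectorspace.dim K (pmap_image M s t))"
  by (simp add: fun_eq_iff ext_rank_def extended_rank_def)

lemma pers_diagram_eq:
  "pers_diagram K M = rank_diagram (\<lambda>s t. vectorspace.dim K (pmap_image M s t))"
  unfolding pers_diagram_def rank_diagram_def rect_measure_def rank_measure_def ext_rank_eq around_def
  by (rule refl)

lemma extended_rank_MInf[simp]: "extended_rank r (-\<infinity>) t = 0" and extended_rank_PInf[simp]: "extended_rank r s \<infinity> = 0"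
  by (simp_all add: extended_rank_def)

text \<open>The hypotheses are the finite case and the cases \<open>d = \<infinity>\<close> and
  \<open>a = -\<infinity>\<close>.\<close>

lemma rank_functionI:
  assumes "\<And>a b c d. a \<le> b \<Longrightarrow> b < c \<Longrightarrow> c \<le> d \<Longrightarrow> r a c + r b d \<le> r b c + r a d"
    and "\<And>a b c. a \<le> b \<Longrightarrow> b < c \<Longrightarrow> r a c \<le> r b c"
    and "\<And>b c d. b < c \<Longrightarrow> c \<le> d \<Longrightarrow> r b d \<le> r b c"
  shows "rank_function r"
  unfolding rank_function_def
proof (intro allI impI)
  fix a b c d :: ereal
  assume *: "a \<le> b" "b < c" "c \<le> d"
  then show "extended_rank r a c + extended_rank r b d \<le> extended_rank r b c + extended_rank r a d"
    using assms by (cases a; cases b; cases c; cases d) (auto simp: extended_rank_def)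
qed

section \<open>Features with a given birth, counted by their death\<close>

definition birth_diff :: "(real \<Rightarrow> real \<Rightarrow> nat) \<Rightarrow> ereal \<Rightarrow> ereal \<Rightarrow> ereal \<Rightarrow> nat" where
  "birth_diff r a b c = extended_rank r b c - extended_rank r a c"

text \<open>The only value available to the left of \<open>-\<infinity>\<close> is
  \<open>-\<infinity>\<close> itself, so it counts as lying below itself.\<close>

definition below :: "ereal \<Rightarrow> ereal \<Rightarrow> bool" where
  "below a p \<longleftrightarrow> a < p \<or> a = -\<infinity> \<and> p = -\<infinity>"

text \<open>\<open>birth_diff r a b c\<close> counts the features born between \<open>a\<close> and
  \<open>b\<close> that are still alive at \<open>c\<close>. Closing in on \<open>p\<close> from
  both sides and on \<open>t\<close> from below leaves those born at \<open>p\<close> that die at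
  \<open>t\<close> or later. By \<open>birth_diff_mono\<close> the infimum is the eventual
  value.\<close>

definition birth_count :: "(real \<Rightarrow> real \<Rightarrow> nat) \<Rightarrow> ereal \<Rightarrow> ereal \<Rightarrow> nat" where
  "birth_count r p t = Inf {birth_diff r a b c | a b c. below a p \<and> p < b \<and> b < c \<and> c < t}"

text \<open>The features born at \<open>p\<close> that die strictly after \<open>q\<close>, so that
  \<open>birth_count r p q - birth_count_above r p q\<close> of them die exactly at
  \<open>q\<close>. For \<open>q = \<infinity>\<close> this is the supremum of the empty set of
  naturals, that is 0.\<close>

definition birth_count_above :: "(real \<Rightarrow> real \<Rightarrow> nat) \<Rightarrow> ereal \<Rightarrow> ereal \<Rightarrow> nat" where
  "birth_count_above r p q = Sup {birth_count r p t | t. q < t}"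

lemma below_imp_le: "below a p \<Longrightarrow> a \<le> p"
  by (auto simp: below_def)

lemma below_max: "below a p \<Longrightarrow> below a' p \<Longrightarrow> below (max a a') p"
  by (auto simp: below_def max_def)

lemma below_MInf: "below (-\<infinity>) p"
  by (cases p) (auto simp: below_def)

lemma extended_rank_mono_birth:
  assumes "rank_function r" "a \<le> b" "b < c"
  shows "extended_rank r a c \<le> extended_rank r b c"
  using assms unfolding rank_function_def by (metis add_0_right ereal_less_eq(1) extended_rank_PInf)

lemma birth_diff_int:
  assumes "rank_function r" "a \<le> b" "b < c"
  shows "int (birth_diff r a b c) = int (extended_rank r b c) - int (extended_rank r a c)"
  using extended_rank_mono_birth[OF assms] by (simp add: birth_diff_def)

text \<open>The loss between \<open>c\<close> and \<open>d\<close> is the measure of the rectangle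
  with births in \<open>[a, b]\<close> and deaths in \<open>[c, d]\<close>, hence
  nonnegative.\<close>

lemma birth_diff_antimono_death:
  assumes "rank_function r" "a \<le> b" "b < c" "c \<le> d"
  shows "birth_diff r a b d \<le> birth_diff r a b c"
proof -
  have "extended_rank r a c + extended_rank r b d \<le> extended_rank r b c + extended_rank r a d"
    using assms unfolding rank_function_def by blast
  then show ?thesis
    using birth_diff_int[OF assms(1-3)] birth_diff_int[of r a b d] assms by fastforce
qed

lemma birth_diff_mono:
  assumes "rank_function r" "a \<le> a'" "a' \<le> b'" "b' \<le> b" "b < c" "c \<le> c'"
  shows "birth_diff r a' b' c' \<le> birth_diff r a b c"
proof -
  have "extended_rank r a c' \<le> extended_rank r a' c'" "extended_rank r b' c' \<le> extended_rank r b c'" 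
    using assms by (auto intro!: extended_rank_mono_birth)
  then have "birth_diff r a' b' c' \<le> birth_diff r a b c'"
    by (simp add: birth_diff_def)
  also have "\<dots> \<le> birth_diff r a b c"
    using assms by (intro birth_diff_antimono_death) auto
  finally show ?thesis .
qed

lemma birth_count_le:
  assumes "below a p" "p < b" "b < c" "c < t"
  shows "birth_count r p t \<le> birth_diff r a b c"
  unfolding birth_count_def using assms by (intro cInf_lower) auto

lemma birth_count_attained:
  assumes "p < t"
  obtains a b c where "below a p" "p < b" "b < c" "c < t"
    "birth_count r p t = birth_diff r a b c"
proof -
  obtain c where "p < c" "c < t" using dense[OF assms] by auto
  moreover obtain b where "p < b" "b < c" using dense[OF \<open>p < c\<close>] by auto
  ultimately have "{birth_diff r a b c | a b c. below a p \<and> p < b \<and> b < c \<and> c < t} \<noteq> {}"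
    using below_MInf by blast
  then have "birth_count r p t \<in> {birth_diff r a b c | a b c. below a p \<and> p < b \<and> b < c \<and> c < t}"
    unfolding birth_count_def by (rule Inf_nat_def1)
  with that show ?thesis by blast
qed

lemma birth_count_antimono:
  assumes "p < s" "s \<le> t"
  shows "birth_count r p t \<le> birth_count r p s"
proof -
  obtain a b c where "below a p" "p < b" "b < c" "c < s" "birth_count r p s = birth_diff r a b c"
    using birth_count_attained[OF assms(1)] .
  then show ?thesis using birth_count_le[of a p b c t r] assms by simp
qed

lemma bdd_above_birth_counts:
  assumes "p < q"
  shows "bdd_above {birth_count r p t | t. q < t}"
proof (rule bdd_aboveI[of _ "birth_count r p q"])
  show "n \<le> birth_count r p q" if "n \<in> {birth_count r p t | t. q < t}" for n
    using that birth_count_antimono[OF assms] by force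
qed

lemma le_birth_count_above:
  assumes "p < q" "q < t"
  shows "birth_count r p t \<le> birth_count_above r p q"
  unfolding birth_count_above_def using assms bdd_above_birth_counts by (intro cSup_upper) auto

text \<open>A bounded set of naturals is finite, so its supremum is a maximum;
  \<open>q < \<infinity>\<close> makes the set nonempty.\<close>

lemma birth_count_above_attained:
  assumes "p < q" "q < \<infinity>"
  obtains t where "q < t" "birth_count r p t = birth_count_above r p q"
proof -
  let ?S = "{birth_count r p t | t. q < t}"
  have ne: "?S \<noteq> {}" using assms(2) by blast
  have "finite ?S"
    using bdd_above_birth_counts[OF assms(1)] by (meson bdd_above_nat)
  with ne have "Sup ?S \<in> ?S" unfolding Sup_nat_def by (subst if_not_P) (auto simp only: Max_in simp_thms)
  with that show ?thesis unfolding birth_count_above_def by auto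
qed

lemma birth_count_above_PInf: "birth_count_above r p \<infinity> = 0"
  by (simp add: birth_count_above_def)

text \<open>The measure of a rectangle is \<open>birth_diff\<close> at \<open>c\<close> minus
  \<open>birth_diff\<close> at \<open>d\<close>. The infimum cannot be taken term by term, because
  shrinking the birth window decreases both terms. The lower bound shrinks the window until the
  second term is at most its limit. The upper bound takes a window attaining the first limit, and
  there the second term is at least its limit.\<close>

lemma rank_diagram_eq:
  assumes r: "rank_function r" and pq: "p < q"
  shows "rank_diagram r (p, q) = birth_count r p q - birth_count_above r p q"
proof -
  let ?n = "birth_count r p q - birth_count_above r p q"
  let ?S = "{nat (rank_measure r a b c d) | a b c d. around p q a b c d}"
  have rm: "rank_measure r a b c d = int (birth_diff r a b c) - int (birth_diff r a b d)"
    if "a \<le> b" "b < c" "c \<le> d" for a b c d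
    using that birth_diff_int[OF r] by (simp add: rank_measure_def)
  have lower: "?n \<le> nat (rank_measure r a b c d)" if ar: "around p q a b c d" for a b c d
  proof -
    have o: "below a p" "p < b" "b < c" "c < q" "q \<le> d"
      using ar by (auto simp: around_def below_def)
    \<comment> \<open>To bring the second term below its limit, the window is intersected with one
      that attains \<open>birth_count r p d\<close>.\<close>
    obtain a' b' where ab: "a \<le> a'" "below a' p" "p < b'" "b' \<le> b"
      "birth_diff r a' b' d \<le> birth_count_above r p q"
    proof (cases "d = \<infinity>")
      case True
      then show ?thesis using that[of a b] o by (simp add: birth_diff_def)
    next
      case False
      then have qd: "q < d" using ar by (auto simp: around_def)
      then obtain a2 b2 c2 where 2: "below a2 p" "p < b2" "b2 < c2" "c2 < d"
        "birth_count r p d = birth_diff r a2 b2 c2"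
        using birth_count_attained[of p d r] pq by (metis order.strict_trans)
      have mb: "below (max a a2) p" using below_max o 2 by blast
      have "birth_diff r (max a a2) (min b b2) d \<le> birth_diff r a2 b2 c2"
        using 2 below_imp_le[OF mb] o by (intro birth_diff_mono[OF r]) auto
      also have "\<dots> \<le> birth_count_above r p q"
        using le_birth_count_above[OF pq qd, of r] 2 by simp
      finally show ?thesis
        using that[of "max a a2" "min b b2"] mb o 2 by auto
    qed
    have le: "a' \<le> b'" using below_imp_le[OF ab(2)] ab(3) by simp
    \<comment> \<open>The parts cut off, with births in \<open>[a, a']\<close> and in
      \<open>[b', b]\<close>, are rectangles of nonnegative measure.\<close>
    have "rank_measure r a' b' c d \<le> rank_measure r a b c d"
    proof -
      have "extended_rank r a c + extended_rank r a' d \<le> extended_rank r a' c + extended_rank r a d"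
        "extended_rank r b' c + extended_rank r b d \<le> extended_rank r b c + extended_rank r b' d"
        using r ab o le unfolding rank_function_def by (auto simp: order.strict_trans1)
      then show ?thesis unfolding rank_measure_def by linarith
    qed
    moreover have "rank_measure r a' b' c d = int (birth_diff r a' b' c) - int (birth_diff r a' b' d)"
      using ab o le by (intro rm) auto
    moreover have "birth_count r p q \<le> birth_diff r a' b' c"
      using ab o by (intro birth_count_le) auto
    ultimately show ?thesis using ab(5) by linarith
  qed
  have upper: "\<exists>a b c d. around p q a b c d \<and> nat (rank_measure r a b c d) \<le> ?n"
  proof -
    obtain a b c where 1: "below a p" "p < b" "b < c" "c < q" "birth_count r p q = birth_diff r a b c"
      using birth_count_attained[OF pq] .
    show ?thesis
    proof (cases "q = \<infinity>")
      case True
      have "around p q a b c \<infinity>" using 1 True by (auto simp: around_def below_def)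
      moreover have "rank_measure r a b c \<infinity> = int (birth_diff r a b c)"
        using rm[of a b c \<infinity>] 1 below_imp_le[OF 1(1)] by (simp add: birth_diff_def)
      ultimately show ?thesis using 1 True birth_count_above_PInf by fastforce
    next
      case False
      then have "q < \<infinity>" by simp
      then obtain t where t: "q < t" "birth_count r p t = birth_count_above r p q"
        using birth_count_above_attained[OF pq] by metis
      \<comment> \<open>\<open>birth_count r p t\<close> is a lower bound for
        \<open>birth_diff\<close> at values strictly before \<open>t\<close>, so \<open>d\<close>
        has to stay below \<open>t\<close>.\<close>
      obtain d where d: "q < d" "d < t" using dense[OF t(1)] by auto
      have "birth_count r p t \<le> birth_diff r a b d"
        using 1 d by (intro birth_count_le) auto
      moreover have "around p q a b c d" using 1 d by (auto simp: around_def below_def)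
      moreover have "rank_measure r a b c d = int (birth_diff r a b c) - int (birth_diff r a b d)"
        using rm[of a b c d] 1 d below_imp_le[OF 1(1)] by simp
      ultimately show ?thesis using 1 t
        by (intro exI[of _ a] exI[of _ b] exI[of _ c] exI[of _ d]) auto
    qed
  qed
  have "Inf ?S = ?n"
  proof (rule antisym)
    obtain a b c d where "around p q a b c d" "nat (rank_measure r a b c d) \<le> ?n"
      using upper by blast
    moreover have "Inf ?S \<le> nat (rank_measure r a b c d)"
      using calculation by (intro cInf_lower) auto
    ultimately show "Inf ?S \<le> ?n" by simp
  next
    show "?n \<le> Inf ?S"
      using lower upper by (intro cInf_greatest) auto
  qed
  then show ?thesis using pq by (simp add: rank_diagram_def)
qed

text \<open>In the list by decreasing death, the copies of \<open>(p, q)\<close> fill the positions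
  from \<open>birth_count_above r p q\<close> up to, but excluding,
  \<open>birth_count r p q\<close>. Features that reach some \<open>t > q\<close> stand before
  them.\<close>

lemma rank_diagram_elementD:
  assumes r: "rank_function r" and k: "k < rank_diagram r (p, q)"
  shows "p < q" "birth_count_above r p q + k < birth_count r p q"
    "q < t \<Longrightarrow> birth_count r p t \<le> birth_count_above r p q + k"
proof -
  show pq: "p < q" using k by (auto simp: rank_diagram_def split: if_splits)
  show "birth_count_above r p q + k < birth_count r p q"
    using k rank_diagram_eq[OF r pq] by simp
  show "q < t \<Longrightarrow> birth_count r p t \<le> birth_count_above r p q + k"
    using le_birth_count_above[OF pq, of t r] by simp
qed

text \<open>The feature at position \<open>i\<close> dies at the largest \<open>s\<close> that more
  than \<open>i\<close> features born at \<open>p\<close> reach.\<close>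

lemma rank_diagram_element_exists:
  assumes r: "rank_function r" and pt: "p < t" and i: "i < birth_count r p t"
  obtains q k where "t \<le> q" "k < rank_diagram r (p, q)" "birth_count_above r p q + k = i"
proof -
  let ?S = "{s. p < s \<and> i < birth_count r p s}"
  define q where "q = Sup ?S"
  have tq: "t \<le> q" unfolding q_def using pt i by (intro Sup_upper) auto
  have pq: "p < q" using pt tq by simp
  \<comment> \<open>Left continuity of \<open>birth_count\<close>: the value at \<open>q\<close> is
    attained with some \<open>c < q\<close>, and \<open>?S\<close> has an element beyond
    \<open>c\<close>.\<close>
  have up: "i < birth_count r p q"
  proof -
    obtain a b c where 1: "below a p" "p < b" "b < c" "c < q" "birth_count r p q = birth_diff r a b c"
      using birth_count_attained[OF pq] .
    obtain s where "s \<in> ?S" "c < s" using 1(4) unfolding q_def less_Sup_iff by auto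
    then show ?thesis using 1 birth_count_le[of a p b c s r] by auto
  qed
  \<comment> \<open>If more than \<open>i\<close> features died after \<open>q\<close>, some
    \<open>s > q\<close> would belong to \<open>?S\<close>.\<close>
  have lo: "birth_count_above r p q \<le> i"
  proof (cases "q = \<infinity>")
    case True
    then show ?thesis by (simp add: birth_count_above_PInf)
  next
    case False
    then obtain s where s: "q < s" "birth_count r p s = birth_count_above r p q"
      using birth_count_above_attained[OF pq] by (metis ereal_infty_less(1))
    have "s \<notin> ?S" using s(1) unfolding q_def by (meson Sup_upper leD)
    then show ?thesis using s pq by auto
  qed
  show ?thesis
    using that[of q "i - birth_count_above r p q"] tq up lo rank_diagram_eq[OF r pq] by simp
qed

text \<open>For fixed \<open>p\<close>, the ranges of positions held by different deaths are
  disjoint.\<close>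

lemma rank_diagram_index_inj:
  assumes r: "rank_function r" and k: "k < rank_diagram r (p, q)" "k' < rank_diagram r (p, q')"
    and eq: "birth_count_above r p q + k = birth_count_above r p q' + k'"
  shows "q = q' \<and> k = k'"
proof -
  have "\<not> q < q'" "\<not> q' < q"
    using rank_diagram_elementD[OF r k(1)] rank_diagram_elementD[OF r k(2)] eq by force+
  then have "q = q'" by simp
  with eq show ?thesis by simp
qed

text \<open>One-sided: the smaller diagram \<open>D'\<close> is matched completely, and only
  \<open>D\<close> may keep points, of persistence at most \<open>\<delta>\<close>. The relation
  \<open>Q\<close> records how matched points may differ, so that one definition serves matchings
  that preserve births and matchings that preserve deaths.\<close>

definition diagram_matching where
  "diagram_matching Q \<delta> D D' P \<longleftrightarrow>
     P \<subseteq> diagram_elements D \<times> diagram_elements D' \<and>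
     single_valued P \<and> single_valued (P\<inverse>) \<and> Range P = diagram_elements D' \<and>
     (\<forall>p q k p' q' k'. (((p, q), k), ((p', q'), k')) \<in> P \<longrightarrow> Q p q p' q') \<and>
     (\<forall>p q k. ((p, q), k) \<in> diagram_elements D - Domain P \<longrightarrow> q \<le> p + ereal \<delta>)"

lemma diagram_matchingD:
  assumes "diagram_matching Q \<delta> D D' P"
  shows "P \<subseteq> diagram_elements D \<times> diagram_elements D'"
    and "single_valued P" and "single_valued (P\<inverse>)" and "Range P = diagram_elements D'"
    and "(((p, q), k), ((p', q'), k')) \<in> P \<Longrightarrow> Q p q p' q'"
    and "((p, q), k) \<in> diagram_elements D \<Longrightarrow> ((p, q), k) \<notin> Domain P \<Longrightarrow> q \<le> p + ereal \<delta>"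
proof -
  note * = assms[unfolded diagram_matching_def]
  note c = conjunct1[OF *] conjunct2[OF *]
  note c2 = conjunct1[OF c(2)] conjunct2[OF c(2)]
  note c3 = conjunct1[OF c2(2)] conjunct2[OF c2(2)]
  note c4 = conjunct1[OF c3(2)] conjunct2[OF c3(2)]
  note c5 = conjunct1[OF c4(2)] conjunct2[OF c4(2)]
  show "P \<subseteq> diagram_elements D \<times> diagram_elements D'"
    "single_valued P" "single_valued (P\<inverse>)" "Range P = diagram_elements D'"
    by (fact c(1) c2(1) c3(1) c4(1))+
  show "(((p, q), k), ((p', q'), k')) \<in> P \<Longrightarrow> Q p q p' q'"
    using c5(1) by blast
  show "((p, q), k) \<in> diagram_elements D \<Longrightarrow> ((p, q), k) \<notin> Domain P \<Longrightarrow> q \<le> p + ereal \<delta>"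
    using c5(2) by blast
qed

text \<open>The points with a given birth \<open>p\<close> are listed by decreasing death, and points with equal
  position in the two lists are matched; the position of the copy \<open>k\<close> of \<open>(p, q)\<close> is
  \<open>birth_count_above r p q + k\<close>.\<close>

lemma birth_matching:
  assumes r: "rank_function r" and r': "rank_function r'" and \<delta>: "0 \<le> \<delta>"
    and H1: "\<And>a b c. a \<le> b \<Longrightarrow> b < c \<Longrightarrow> birth_diff r' a b c \<le> birth_diff r a b c"
    and H2: "\<And>a b c. a \<le> b \<Longrightarrow> b < c \<Longrightarrow> birth_diff r a b (c + ereal \<delta>) \<le> birth_diff r' a b c"
  shows "\<exists>P. diagram_matching (\<lambda>p q p' q'. p' = p \<and> q' \<le> q \<and> q \<le> q' + ereal \<delta>) \<delta>
           (rank_diagram r) (rank_diagram r') P"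
proof -
  \<comment> \<open>Both hypotheses pass to the limit: a window attaining the right-hand count
    bounds the left-hand one.\<close>
  have h1: "birth_count r' p t \<le> birth_count r p t" if pt: "p < t" for p t
  proof -
    obtain a b c where 1: "below a p" "p < b" "b < c" "c < t" "birth_count r p t = birth_diff r a b c"
      using birth_count_attained[OF pt] .
    have "birth_count r' p t \<le> birth_diff r' a b c" by (rule birth_count_le) fact+
    also have "\<dots> \<le> birth_diff r a b c" using below_imp_le[OF 1(1)] 1 by (intro H1) auto
    finally show ?thesis using 1 by simp
  qed
  have h2: "birth_count r p (t + ereal \<delta>) \<le> birth_count r' p t" if pt: "p < t" for p t
  proof -
    obtain a b c where 1: "below a p" "p < b" "b < c" "c < t" "birth_count r' p t = birth_diff r' a b c"
      using birth_count_attained[OF pt] .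
    have 2: "c + ereal \<delta> < t + ereal \<delta>" using 1(4) by (cases c; cases t; simp)
    have 3: "b < c + ereal \<delta>" using 1(3) \<delta> by (cases b; cases c; simp)
    have "birth_count r p (t + ereal \<delta>) \<le> birth_diff r a b (c + ereal \<delta>)"
      by (rule birth_count_le) fact+
    also have "\<dots> \<le> birth_diff r' a b c" using below_imp_le[OF 1(1)] 1 by (intro H2) auto
    finally show ?thesis using 1 by simp
  qed
  define idx where "idx = birth_count_above"
  define P where "P = {(((p, q), k), ((p, q'), k')) | p q q' k k'.
    k < rank_diagram r (p, q) \<and> k' < rank_diagram r' (p, q') \<and> idx r p q + k = idx r' p q' + k'}"
  note inj = rank_diagram_index_inj[OF r, folded idx_def] rank_diagram_index_inj[OF r', folded idx_def]
  note el = rank_diagram_elementD[OF r, folded idx_def]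
  note el' = rank_diagram_elementD[OF r', folded idx_def]
  note ex = rank_diagram_element_exists[OF r, folded idx_def]
  note ex' = rank_diagram_element_exists[OF r', folded idx_def]
  have "diagram_matching (\<lambda>p q p' q'. p' = p \<and> q' \<le> q \<and> q \<le> q' + ereal \<delta>) \<delta>
           (rank_diagram r) (rank_diagram r') P"
    unfolding diagram_matching_def
  proof (intro conjI allI impI)
    show "P \<subseteq> diagram_elements (rank_diagram r) \<times> diagram_elements (rank_diagram r')"
      by (auto simp: P_def diagram_elements_def)
    show "single_valued P"
    proof (rule single_valuedI)
      fix x y z assume xy: "(x, y) \<in> P" and xz: "(x, z) \<in> P"
      from xy obtain p q k q1 k1 where 1: "x = ((p, q), k)" "y = ((p, q1), k1)"
        "k1 < rank_diagram r' (p, q1)" "idx r p q + k = idx r' p q1 + k1" unfolding P_def by blast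
      from xz 1(1) obtain q2 k2 where 2: "z = ((p, q2), k2)"
        "k2 < rank_diagram r' (p, q2)" "idx r p q + k = idx r' p q2 + k2" unfolding P_def by blast
      show "y = z" using inj(2)[OF 1(3) 2(2)] 1 2 by simp
    qed
    show "single_valued (P\<inverse>)"
    proof (rule single_valuedI)
      fix x y z assume "(x, y) \<in> P\<inverse>" "(x, z) \<in> P\<inverse>"
      then have xy: "(y, x) \<in> P" and xz: "(z, x) \<in> P" by auto
      from xy obtain p q k q1 k1 where 1: "x = ((p, q), k)" "y = ((p, q1), k1)"
        "k1 < rank_diagram r (p, q1)" "idx r p q1 + k1 = idx r' p q + k" unfolding P_def by blast
      from xz 1(1) obtain q2 k2 where 2: "z = ((p, q2), k2)"
        "k2 < rank_diagram r (p, q2)" "idx r p q2 + k2 = idx r' p q + k" unfolding P_def by blast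
      show "y = z" using inj(1)[OF 1(3) 2(2)] 1 2 by simp
    qed
    show "Range P = diagram_elements (rank_diagram r')"
    proof
      show "Range P \<subseteq> diagram_elements (rank_diagram r')"
        by (auto simp: P_def diagram_elements_def)
      show "diagram_elements (rank_diagram r') \<subseteq> Range P"
      proof
        fix x assume "x \<in> diagram_elements (rank_diagram r')"
        then obtain p q' k' where x: "x = ((p, q'), k')" "k' < rank_diagram r' (p, q')"
          by (auto simp: diagram_elements_def)
        \<comment> \<open>By \<open>h1\<close> the list of \<open>r\<close> is at least as long, so
          this position is taken there too.\<close>
        have "idx r' p q' + k' < birth_count r p q'"
          using el'[OF x(2)] h1 by (meson less_le_trans)
        then obtain q k where "k < rank_diagram r (p, q)" "idx r p q + k = idx r' p q' + k'"
          using ex[of p q'] el'(1)[OF x(2)] by metis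
        then show "x \<in> Range P" using x unfolding P_def by blast
      qed
    qed
    fix p q :: ereal and k :: nat
    {
      fix p' q' k'
      assume "(((p, q), k), ((p', q'), k')) \<in> P"
      then have *: "p' = p" "k < rank_diagram r (p, q)" "k' < rank_diagram r' (p, q')"
        "idx r p q + k = idx r' p q' + k'" by (auto simp: P_def)
      show "p' = p" by fact
      \<comment> \<open>If \<open>q' > q\<close>, the first point would stand behind all features of
        \<open>r\<close> that reach \<open>q'\<close>; by \<open>h1\<close> these are at least as
        many as those of \<open>r'\<close>, and the second point is one of the latter.\<close>
      show "q' \<le> q"
      proof (rule ccontr)
        assume "\<not> q' \<le> q"
        then have "birth_count r p q' \<le> idx r p q + k" using el[OF *(2)] by auto
        moreover have "idx r' p q' + k' < birth_count r' p q'" "p < q'" using el'[OF *(3)] by auto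
        ultimately show False using h1[of p q'] * by auto
      qed
      show "q \<le> q' + ereal \<delta>"
      proof (rule ccontr)
        assume n: "\<not> q \<le> q' + ereal \<delta>"
        \<comment> \<open>By \<open>h2\<close>, at least as many features of \<open>r'\<close> reach
          \<open>q - \<delta>\<close> as features of \<open>r\<close> reach \<open>q\<close>. For
          \<open>q = \<infinity>\<close> this gives \<open>t = \<infinity>\<close>.\<close>
        define t where "t = q - ereal \<delta>"
        have t: "q' < t" "q = t + ereal \<delta>"
          using n unfolding t_def by (cases q; cases q'; simp)+
        have "p < t" using el'(1)[OF *(3)] t by simp
        have "idx r p q + k < birth_count r p q" using el[OF *(2)] by auto
        also have "\<dots> \<le> birth_count r' p t" using h2[OF \<open>p < t\<close>] t by simp
        also have "\<dots> \<le> idx r' p q' + k'" using el'(3)[OF *(3) t(1)] .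
        finally show False using * by simp
      qed
    }
    assume "((p, q), k) \<in> diagram_elements (rank_diagram r) - Domain P"
    then have k: "k < rank_diagram r (p, q)" and nd: "((p, q), k) \<notin> Domain P"
      by (auto simp: diagram_elements_def)
    show "q \<le> p + ereal \<delta>"
    proof (rule ccontr)
      assume n: "\<not> q \<le> p + ereal \<delta>"
      \<comment> \<open>A death more than \<open>\<delta>\<close> after \<open>p\<close> leaves
        \<open>p < t\<close>, and then \<open>h2\<close> provides a feature of \<open>r'\<close> at
        the same position.\<close>
      define t where "t = q - ereal \<delta>"
      have t: "p < t" "q = t + ereal \<delta>"
        using n unfolding t_def by (cases q; cases p; simp)+
      have "idx r p q + k < birth_count r' p t"
        using el(2)[OF k] h2[OF t(1)] t(2) by simp
      then obtain q' k' where "k' < rank_diagram r' (p, q')" "idx r' p q' + k' = idx r p q + k"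
        using ex'[OF t(1)] by metis
      then have "(((p, q), k), ((p, q'), k')) \<in> P" unfolding P_def using k by auto
      then show False using nd by blast
    qed
  qed
  then show ?thesis by blast
qed

section \<open>Reflection of the parameter, which exchanges births and deaths\<close>

definition dual_rank :: "(real \<Rightarrow> real \<Rightarrow> nat) \<Rightarrow> real \<Rightarrow> real \<Rightarrow> nat" where
  "dual_rank r s t = r (- t) (- s)"

lemma extended_rank_dual_rank: "extended_rank (dual_rank r) s t = extended_rank r (- t) (- s)"
  by (cases s; cases t) (auto simp: extended_rank_def dual_rank_def)

lemma rank_function_dual:
  assumes "rank_function r"
  shows "rank_function (dual_rank r)"
  unfolding rank_function_def extended_rank_dual_rank
proof (intro allI impI)
  fix a b c d :: ereal
  assume "a \<le> b" "b < c" "c \<le> d"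
  then have "extended_rank r (-d) (-b) + extended_rank r (-c) (-a) \<le> extended_rank r (-c) (-b) + extended_rank r (-d) (-a)"
    using assms[unfolded rank_function_def, rule_format, of "-d" "-c" "-b" "-a"] by simp
  then show "extended_rank r (- c) (- a) + extended_rank r (- d) (- b) \<le> extended_rank r (- c) (- b) + extended_rank r (- d) (- a)"
    by simp
qed

text \<open>\<open>dual_rank r\<close> gives the ranks of the pointwise dual module with reversed
  parameter. A feature \<open>(p, q)\<close> becomes \<open>(-q, -p)\<close>, and rectangles are
  reflected accordingly.\<close>

lemma rank_diagram_dual: "rank_diagram (dual_rank r) (p, q) = rank_diagram r (- q, - p)"
proof -
  have rm: "rank_measure (dual_rank r) a b c d = rank_measure r (-d) (-c) (-b) (-a)" for a b c d
    by (simp add: rank_measure_def extended_rank_dual_rank)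
  have ar: "around p q a b c d \<longleftrightarrow> around (-q) (-p) (-d) (-c) (-b) (-a)" for a b c d
  proof -
    have "- x = -\<infinity> \<longleftrightarrow> x = \<infinity>" "- x = \<infinity> \<longleftrightarrow> x = -\<infinity>" for x :: ereal by (cases x; simp)+
    then show ?thesis unfolding around_def ereal_minus_less_minus by metis
  qed
  have "{nat (rank_measure (dual_rank r) a b c d) | a b c d. around p q a b c d} =
    {nat (rank_measure r a b c d) | a b c d. around (-q) (-p) a b c d}" (is "?A = ?B")
  proof
    show "?A \<subseteq> ?B" unfolding rm ar by blast
    show "?B \<subseteq> ?A"
    proof
      fix x assume "x \<in> ?B"
      then obtain a b c d where *: "x = nat (rank_measure r a b c d)" "around (-q) (-p) a b c d" by blast
      have "around p q (-d) (-c) (-b) (-a)"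
        using ar[of "-d" "-c" "-b" "-a"] *(2) by (simp only: ereal_uminus_uminus)
      moreover have "x = nat (rank_measure (dual_rank r) (-d) (-c) (-b) (-a))"
        using rm[of "-d" "-c" "-b" "-a"] *(1) by (simp only: ereal_uminus_uminus)
      ultimately show "x \<in> ?A" by blast
    qed
  qed
  then show ?thesis by (simp add: rank_diagram_def)
qed

definition death_diff :: "(real \<Rightarrow> real \<Rightarrow> nat) \<Rightarrow> ereal \<Rightarrow> ereal \<Rightarrow> ereal \<Rightarrow> nat" where
  "death_diff r b c d = extended_rank r b c - extended_rank r b d"

lemma birth_diff_dual: "birth_diff (dual_rank r) a b c = death_diff r (- c) (- b) (- a)"
  by (simp add: birth_diff_def death_diff_def extended_rank_dual_rank)

text \<open>The reflection of \<open>birth_matching\<close>: \<open>birth_diff\<close> of the dual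
  ranks is \<open>death_diff\<close>, and the involution \<open>n\<close> carries the matching
  back.\<close>

lemma death_matching:
  assumes r: "rank_function r" and r': "rank_function r'" and \<delta>: "0 \<le> \<delta>"
    and H1: "\<And>b c d. b < c \<Longrightarrow> c \<le> d \<Longrightarrow> death_diff r' b c d \<le> death_diff r b c d"
    and H2: "\<And>b c d. b < c \<Longrightarrow> c \<le> d \<Longrightarrow> death_diff r (b - ereal \<delta>) c d \<le> death_diff r' b c d"
  shows "\<exists>P. diagram_matching (\<lambda>p q p' q'. q' = q \<and> p \<le> p' \<and> p' \<le> p + ereal \<delta>) \<delta>
           (rank_diagram r) (rank_diagram r') P"
proof -
  have neg: "- (c + ereal \<delta>) = - c - ereal \<delta>" for c by (cases c) auto
  have dual: "birth_diff (dual_rank r') a b c \<le> birth_diff (dual_rank r) a b c"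
    "birth_diff (dual_rank r) a b (c + ereal \<delta>) \<le> birth_diff (dual_rank r') a b c"
    if "a \<le> b" "b < c" for a b c
    using H1[of "-c" "-b" "-a"] H2[of "-c" "-b" "-a"] that
    unfolding birth_diff_dual neg by (simp_all only: ereal_minus_less_minus ereal_minus_le_minus)
  obtain P where "diagram_matching (\<lambda>p q p' q'. p' = p \<and> q' \<le> q \<and> q \<le> q' + ereal \<delta>) \<delta>
       (rank_diagram (dual_rank r)) (rank_diagram (dual_rank r')) P"
    using birth_matching[OF rank_function_dual[OF r] rank_function_dual[OF r'] \<delta> dual] by auto
  note P = diagram_matchingD[OF this]
  define n :: "(ereal \<times> ereal) \<times> nat \<Rightarrow> (ereal \<times> ereal) \<times> nat"
    where "n = (\<lambda>((p, q), k). ((- q, - p), k))"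
  have nn: "n (n x) = x" for x by (cases x) (auto simp: n_def split: prod.splits)
  have el: "n x \<in> diagram_elements (rank_diagram (dual_rank s)) \<longleftrightarrow> x \<in> diagram_elements (rank_diagram s)"
    for x s
    by (cases x) (auto simp: n_def diagram_elements_def rank_diagram_dual split: prod.splits)
  have inj_n: "inj n" by (rule inj_on_inverseI[of _ n]) (rule nn)
  define P' where "P' = {(x, y). (n x, n y) \<in> P}"
  have dom: "x \<in> Domain P' \<longleftrightarrow> n x \<in> Domain P" and ran: "x \<in> Range P' \<longleftrightarrow> n x \<in> Range P" for x
    unfolding P'_def Domain_iff Range_iff mem_Collect_eq prod.case using nn by metis+
  have "diagram_matching (\<lambda>p q p' q'. q' = q \<and> p \<le> p' \<and> p' \<le> p + ereal \<delta>) \<delta>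
           (rank_diagram r) (rank_diagram r') P'"
    unfolding diagram_matching_def
  proof (intro conjI allI impI)
    show "P' \<subseteq> diagram_elements (rank_diagram r) \<times> diagram_elements (rank_diagram r')"
    proof
      fix z assume "z \<in> P'"
      then have "(n (fst z), n (snd z)) \<in> P" by (auto simp: P'_def)
      then have "n (fst z) \<in> diagram_elements (rank_diagram (dual_rank r))"
        "n (snd z) \<in> diagram_elements (rank_diagram (dual_rank r'))"
        using P(1) by auto
      then show "z \<in> diagram_elements (rank_diagram r) \<times> diagram_elements (rank_diagram r')"
        unfolding el by (simp add: mem_Times_iff)
    qed
    show "single_valued P'"
      by (rule single_valuedI, rule injD[OF inj_n], rule single_valuedD[OF P(2)])
        (auto simp: P'_def)
    show "single_valued (P'\<inverse>)"
      by (rule single_valuedI, rule injD[OF inj_n], rule single_valuedD[OF P(3)])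
        (auto simp: P'_def)
    show "Range P' = diagram_elements (rank_diagram r')"
      by (rule Set.set_eqI) (simp only: ran P(4) el)
    fix p q :: ereal and k :: nat
    {
      fix p' q' k'
      assume "(((p, q), k), ((p', q'), k')) \<in> P'"
      then have "(((-q, -p), k), ((-q', -p'), k')) \<in> P" by (simp add: P'_def n_def)
      from P(5)[OF this] have *: "- q' = - q" "- p' \<le> - p" "- p \<le> - p' + ereal \<delta>" by auto
      show "q' = q" "p \<le> p'" using * by auto
      show "p' \<le> p + ereal \<delta>" using *(3) by (cases p; cases p') auto
    }
    assume "((p, q), k) \<in> diagram_elements (rank_diagram r) - Domain P'"
    then have "n ((p, q), k) \<in> diagram_elements (rank_diagram (dual_rank r)) - Domain P"
      unfolding el Diff_iff dom .
    then have "- p \<le> - q + ereal \<delta>" using P(6)[of "- q" "- p" k] by (simp add: n_def)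
    then show "q \<le> p + ereal \<delta>" by (cases p; cases q) auto
  qed
  then show ?thesis by blast
qed

section \<open>Translation of the parameter\<close>

definition shift_rank :: "real \<Rightarrow> (real \<Rightarrow> real \<Rightarrow> nat) \<Rightarrow> real \<Rightarrow> real \<Rightarrow> nat" where
  "shift_rank e r s t = r (s + e) (t + e)"

text \<open>\<open>s < t\<close> excludes the default value 0 of \<open>real_of_ereal\<close> at an
  infinity, which a translation would not respect.\<close>

lemma extended_rank_shift_rank:
  "s < t \<Longrightarrow> extended_rank (shift_rank e r) s t = extended_rank r (s + ereal e) (t + ereal e)"
  by (cases s; cases t) (auto simp: extended_rank_def shift_rank_def)

lemma rank_function_shift:
  assumes "rank_function r"
  shows "rank_function (shift_rank e r)"
  unfolding rank_function_def
proof (intro allI impI)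
  fix a b c d :: ereal
  assume *: "a \<le> b" "b < c" "c \<le> d"
  then have "a + ereal e \<le> b + ereal e" "b + ereal e < c + ereal e" "c + ereal e \<le> d + ereal e"
    by (auto intro: add_right_mono) (cases b; cases c; simp)
  then have "extended_rank r (a + ereal e) (c + ereal e) + extended_rank r (b + ereal e) (d + ereal e)
    \<le> extended_rank r (b + ereal e) (c + ereal e) + extended_rank r (a + ereal e) (d + ereal e)"
    using assms unfolding rank_function_def by blast
  moreover have "a < c" "b < d" "a < d" using * by auto
  ultimately show "extended_rank (shift_rank e r) a c + extended_rank (shift_rank e r) b d
    \<le> extended_rank (shift_rank e r) b c + extended_rank (shift_rank e r) a d"
    using * by (simp add: extended_rank_shift_rank)
qed

lemma rank_diagram_shift:
  "rank_diagram (shift_rank e r) (p, q) = rank_diagram r (p + ereal e, q + ereal e)"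
proof -
  have rm: "rank_measure (shift_rank e r) a b c d =
      rank_measure r (a + ereal e) (b + ereal e) (c + ereal e) (d + ereal e)"
    if "around p q a b c d" for a b c d
  proof -
    have "a < b" "b < c" "c < d" using that by (auto simp: around_def)
    then show ?thesis by (simp add: rank_measure_def extended_rank_shift_rank)
  qed
  have lt: "a + ereal e < b + ereal e \<longleftrightarrow> a < b" for a b by (cases a; cases b) auto
  have inf: "a + ereal e = -\<infinity> \<longleftrightarrow> a = -\<infinity>" "a + ereal e = \<infinity> \<longleftrightarrow> a = \<infinity>" for a by (cases a; simp)+
  have ar: "around p q a b c d \<longleftrightarrow> around (p + ereal e) (q + ereal e)
      (a + ereal e) (b + ereal e) (c + ereal e) (d + ereal e)" for a b c d
    unfolding around_def lt inf ..
  have sur: "\<exists>a'. a = a' + ereal e" for a by (rule exI[of _ "a - ereal e"]) (cases a; simp)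
  have "{nat (rank_measure (shift_rank e r) a b c d) | a b c d. around p q a b c d} =
    {nat (rank_measure r a b c d) | a b c d. around (p + ereal e) (q + ereal e) a b c d}" (is "?A = ?B")
  proof
    show "?A \<subseteq> ?B"
    proof
      fix x assume "x \<in> ?A"
      then obtain a b c d where *: "x = nat (rank_measure (shift_rank e r) a b c d)"
        "around p q a b c d" by blast
      then show "x \<in> ?B" using rm[OF *(2)] ar[of a b c d] by auto
    qed
    show "?B \<subseteq> ?A"
    proof
      fix x assume "x \<in> ?B"
      then obtain a b c d where *: "x = nat (rank_measure r a b c d)"
        "around (p + ereal e) (q + ereal e) a b c d" by blast
      obtain a' b' c' d' where "a = a' + ereal e" "b = b' + ereal e" "c = c' + ereal e" "d = d' + ereal e"
        using sur by metis
      then have "around p q a' b' c' d'" using *(2) ar[of a' b' c' d'] by (simp only:)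
      moreover have "x = nat (rank_measure (shift_rank e r) a' b' c' d')"
        unfolding rm[OF calculation] *(1) \<open>a = _\<close> \<open>b = _\<close> \<open>c = _\<close> \<open>d = _\<close> ..
      ultimately show "x \<in> ?A" by blast
    qed
  qed
  then show ?thesis by (simp add: rank_diagram_def lt)
qed

text \<open>Reduces a comparison over the extended reals to finite parameters; the second hypothesis
  is the case \<open>a = -\<infinity>\<close>.\<close>

lemma birth_diff_leI:
  assumes "\<And>a b c. a \<le> b \<Longrightarrow> b < c \<Longrightarrow> r b (c + e) + r' a c \<le> r a (c + e) + r' b c"
    and "\<And>b c. b < c \<Longrightarrow> r b (c + e) \<le> r' b c"
    and "a \<le> b" "b < c"
  shows "birth_diff r a b (c + ereal e) \<le> birth_diff r' a b c"
proof (cases "b = -\<infinity> \<or> c = \<infinity>")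
  case True
  then show ?thesis using assms(3) by (auto simp: birth_diff_def)
next
  case False
  then obtain b' c' where bc: "b = ereal b'" "c = ereal c'"
    using assms(4) by (cases b; cases c) auto
  show ?thesis
  proof (cases a)
    case (real a')
    then have "r b' (c' + e) + r' a' c' \<le> r a' (c' + e) + r' b' c'"
      using assms bc by simp
    then show ?thesis using real bc by (simp add: birth_diff_def extended_rank_def)
  next
    case PInf
    then show ?thesis using assms(3) bc by simp
  next
    case MInf
    then show ?thesis using assms(2)[of b' c'] assms(4) bc by (simp add: birth_diff_def extended_rank_def)
  qed
qed

lemma death_diff_leI:
  assumes "\<And>b c d. b < c \<Longrightarrow> c \<le> d \<Longrightarrow> r (b - e) c + r' b d \<le> r (b - e) d + r' b c"
    and "\<And>b c. b < c \<Longrightarrow> r (b - e) c \<le> r' b c"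
    and "b < c" "c \<le> d"
  shows "death_diff r (b - ereal e) c d \<le> death_diff r' b c d"
proof (cases "b = -\<infinity> \<or> c = \<infinity>")
  case True
  then show ?thesis using assms(4) by (auto simp: death_diff_def)
next
  case False
  then obtain b' c' where bc: "b = ereal b'" "c = ereal c'"
    using assms(3) by (cases b; cases c) auto
  show ?thesis
  proof (cases d)
    case (real d')
    then have "r (b' - e) c' + r' b' d' \<le> r (b' - e) d' + r' b' c'"
      using assms bc by simp
    then show ?thesis using real bc by (simp add: death_diff_def extended_rank_def)
  next
    case MInf
    then show ?thesis using assms(4) bc by simp
  next
    case PInf
    then show ?thesis using assms(2)[of b' c'] assms(3) bc by (simp add: death_diff_def extended_rank_def)
  qed
qed

section \<open>From inequalities between ranks to a matching\<close>

lemma coord_dist_le: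
  assumes "0 \<le> e" "a \<le> b + ereal e" "b \<le> a + ereal e"
  shows "coord_dist a b \<le> ereal e"
  using assms by (cases a; cases b) (auto simp: coord_dist_def)

text \<open>The nearest diagonal point is the midpoint; the two inequalities force \<open>p\<close>
  and \<open>q\<close> to be finite.\<close>

lemma near_diagonalI:
  assumes "p < q" "q \<le> p + ereal (2 * e)"
  shows "near_diagonal e (p, q)"
proof -
  obtain x y where xy: "p = ereal x" "q = ereal y"
    using assms by (cases p; cases q) auto
  have "coord_dist p (ereal ((x + y) / 2)) \<le> ereal e" "coord_dist q (ereal ((x + y) / 2)) \<le> ereal e"
    using assms unfolding xy by (intro coord_dist_le; simp add: field_simps)+
  then show ?thesis
    unfolding near_diagonal_def plane_dist_def by (auto intro!: exI[of _ "ereal ((x + y) / 2)"])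
qed

text \<open>\<open>i\<close> stands for the ranks of the image \<open>I\<close>. The hypotheses
  \<open>A1\<close> and \<open>A2\<close> hold because \<open>I\<close> is a quotient of
  \<open>M\<close> that costs at most \<open>2 * e\<close> in the deaths. The hypotheses
  \<open>B1\<close> and \<open>B2\<close> hold because \<open>I\<close> is a submodule of
  \<open>N\<close> translated by \<open>e\<close>, at a cost of at most \<open>2 * e\<close> in the
  births. The second inequality of each pair is the limiting case of an infinite parameter.\<close>

lemma eps_matching_of_ranks:
  assumes rf: "rank_function m" "rank_function i" "rank_function n" and e: "0 \<le> e"
    and A1: "\<And>a b c. a \<le> b \<Longrightarrow> b < c \<Longrightarrow> i b c + m a c \<le> i a c + m b c"
      "\<And>b c. b < c \<Longrightarrow> i b c \<le> m b c"
    and A2: "\<And>a b c. a \<le> b \<Longrightarrow> b < c \<Longrightarrow> m b (c + 2 * e) + i a c \<le> m a (c + 2 * e) + i b c"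
      "\<And>b c. b < c \<Longrightarrow> m b (c + 2 * e) \<le> i b c"
    and B1: "\<And>b c d. b < c \<Longrightarrow> c \<le> d \<Longrightarrow>
        i b c + n (b + e) (d + e) \<le> i b d + n (b + e) (c + e)"
      "\<And>b c. b < c \<Longrightarrow> i b c \<le> n (b + e) (c + e)"
    and B2: "\<And>b c d. b < c \<Longrightarrow> c \<le> d \<Longrightarrow>
        n (b - e) (c + e) + i b d \<le> n (b - e) (d + e) + i b c"
      "\<And>b c. b < c \<Longrightarrow> n (b - e) (c + e) \<le> i b c"
  shows "\<exists>P. eps_matching e (rank_diagram m) (rank_diagram n) P"
proof -
  let ?M = "rank_diagram m" and ?I = "rank_diagram i" and ?N = "rank_diagram n"
    and ?N' = "rank_diagram (shift_rank e n)"
  have e2: "0 \<le> 2 * e" using e by simp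
  have "birth_diff i a b c \<le> birth_diff m a b c" if "a \<le> b" "b < c" for a b c
    using birth_diff_leI[of i 0 m a b c] A1 that by (simp add: zero_ereal_def[symmetric])
  moreover have "birth_diff m a b (c + ereal (2 * e)) \<le> birth_diff i a b c" if "a \<le> b" "b < c" for a b c
    using birth_diff_leI[of m "2 * e" i a b c] A2 that by simp
  ultimately obtain P1 where P1: "diagram_matching (\<lambda>p q p' q'. p' = p \<and> q' \<le> q \<and> q \<le> q' + ereal (2 * e))
      (2 * e) ?M ?I P1"
    using birth_matching[OF rf(1,2) e2] by auto
  note P1 = diagram_matchingD[OF P1]
  have "death_diff i b c d \<le> death_diff (shift_rank e n) b c d" if "b < c" "c \<le> d" for b c d
    using death_diff_leI[of i 0 "shift_rank e n" b c d] B1 that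
    by (simp add: zero_ereal_def[symmetric] shift_rank_def)
  moreover have "death_diff (shift_rank e n) (b - ereal (2 * e)) c d \<le> death_diff i b c d"
    if "b < c" "c \<le> d" for b c d
    using death_diff_leI[of "shift_rank e n" "2 * e" i b c d] B2 that
    by (simp add: shift_rank_def)
  ultimately obtain P2 where P2: "diagram_matching (\<lambda>p q p' q'. q' = q \<and> p \<le> p' \<and> p' \<le> p + ereal (2 * e))
      (2 * e) ?N' ?I P2"
    using death_matching[OF rank_function_shift[OF rf(3), of e] rf(2) e2] by auto
  note P2 = diagram_matchingD[OF P2]
  \<comment> \<open>Takes points of the diagram of the translated ranks back to the diagram of
    \<open>n\<close>.\<close>
  define sh :: "(ereal \<times> ereal) \<times> nat \<Rightarrow> (ereal \<times> ereal) \<times> nat"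
    where "sh = (\<lambda>((p, q), k). ((p + ereal e, q + ereal e), k))"
  have cancel: "a + ereal e = b + ereal e \<longleftrightarrow> a = b" for a b by (cases a; cases b) auto
  have inj: "inj sh" by (auto simp: inj_def sh_def cancel)
  have surj: "\<exists>x'. x = sh x'" for x
  proof -
    have "a = (a - ereal e) + ereal e" for a by (cases a) auto
    then show ?thesis
      by (cases x) (auto simp: sh_def intro!: exI[of _ "((fst (fst x) - ereal e, snd (fst x) - ereal e), snd x)"])
  qed
  have el: "sh x \<in> diagram_elements ?N \<longleftrightarrow> x \<in> diagram_elements ?N'" for x
    by (cases x) (auto simp: sh_def diagram_elements_def rank_diagram_shift)
  define P where "P = {(x, sh z) | x z y. (x, y) \<in> P1 \<and> (z, y) \<in> P2}"
  have "eps_matching e ?M ?N P"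
    unfolding eps_matching_def
  proof (intro conjI ballI)
    show "P \<subseteq> diagram_elements ?M \<times> diagram_elements ?N"
      unfolding P_def using P1(1) P2(1) el by auto
    show "single_valued P"
    proof (rule single_valuedI)
      fix x v w assume "(x, v) \<in> P" "(x, w) \<in> P"
      then obtain z y z' y' where *: "v = sh z" "(x, y) \<in> P1" "(z, y) \<in> P2"
        "w = sh z'" "(x, y') \<in> P1" "(z', y') \<in> P2" unfolding P_def by blast
      have "y = y'" using single_valuedD[OF P1(2)] * by metis
      then have "z = z'" using single_valuedD[OF P2(3)] * by (metis converseI)
      with * show "v = w" by simp
    qed
    show "single_valued (P\<inverse>)"
    proof (rule single_valuedI)
      fix v x x' assume "(v, x) \<in> P\<inverse>" "(v, x') \<in> P\<inverse>"
      then obtain z y z' y' where *: "v = sh z" "(x, y) \<in> P1" "(z, y) \<in> P2"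
        "v = sh z'" "(x', y') \<in> P1" "(z', y') \<in> P2" unfolding P_def by blast
      have "z = z'" using injD[OF inj] * by metis
      then have "y = y'" using single_valuedD[OF P2(2)] * by metis
      then show "x = x'" using single_valuedD[OF P1(3)] * by (metis converseI)
    qed
    fix xv assume "xv \<in> P"
    then obtain p q k p2 q2 k2 p1 q1 k1 where *: "xv = (((p, q), k), sh ((p2, q2), k2))"
      "(((p, q), k), ((p1, q1), k1)) \<in> P1" "(((p2, q2), k2), ((p1, q1), k1)) \<in> P2"
      unfolding P_def by auto
    have 1: "p1 = p" "q1 \<le> q" "q \<le> q1 + ereal (2 * e)" using P1(5)[OF *(2)] by auto
    have 2: "q1 = q2" "p2 \<le> p1" "p1 \<le> p2 + ereal (2 * e)" using P2(5)[OF *(3)] by auto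
    \<comment> \<open>Each coordinate of \<open>(p2, q2)\<close> is smaller than that of
      \<open>(p, q)\<close> by an amount between 0 and \<open>2 * e\<close>, so the translation by
      \<open>e\<close> centres the error.\<close>
    have "coord_dist p (p2 + ereal e) \<le> ereal e"
      using 1 2 e by (intro coord_dist_le) (cases p; cases p2; simp)+
    moreover have "coord_dist q (q2 + ereal e) \<le> ereal e"
      using 1 2 e by (intro coord_dist_le) (cases q; cases q2; simp)+
    ultimately show "case xv of (x, y) \<Rightarrow> plane_dist (fst x) (fst y) \<le> ereal e"
      by (simp add: * sh_def plane_dist_def)
  next
    fix x assume x: "x \<in> diagram_elements ?M - Domain P"
    obtain p q k where pqk: "x = ((p, q), k)" by (cases x) auto
    \<comment> \<open>Since \<open>P2\<close> covers the diagram of \<open>i\<close>, every pair of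
      \<open>P1\<close> extends to a pair of \<open>P\<close>.\<close>
    have "x \<notin> Domain P1"
    proof
      assume "x \<in> Domain P1"
      then obtain y where "(x, y) \<in> P1" by blast
      moreover from this P1(1) P2(4) obtain z where "(z, y) \<in> P2" by blast
      ultimately have "(x, sh z) \<in> P" unfolding P_def by blast
      with x show False by blast
    qed
    then have "q \<le> p + ereal (2 * e)" using P1(6) x pqk by blast
    moreover have "p < q"
      using x pqk by (auto simp: diagram_elements_def rank_diagram_def split: if_splits)
    ultimately show "near_diagonal e (fst x)" using near_diagonalI pqk by simp
  next
    fix x assume x: "x \<in> diagram_elements ?N - Range P"
    obtain z where z: "x = sh z" using surj by blast
    obtain p q k where pqk: "z = ((p, q), k)" by (cases z) auto
    have "z \<notin> Domain P2"
    proof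
      assume "z \<in> Domain P2"
      then obtain y where "(z, y) \<in> P2" by blast
      moreover from this P2(1) P1(4) obtain v where "(v, y) \<in> P1" by blast
      ultimately have "(v, sh z) \<in> P" unfolding P_def by blast
      with x z show False by blast
    qed
    moreover have zN: "z \<in> diagram_elements ?N'" using x z el by blast
    ultimately have "q \<le> p + ereal (2 * e)" using P2(6) pqk by blast
    moreover have "p < q"
      using zN pqk by (auto simp: diagram_elements_def rank_diagram_def split: if_splits)
    ultimately have "near_diagonal e (p + ereal e, q + ereal e)"
      by (intro near_diagonalI) (cases p; cases q; simp)+
    then show "near_diagonal e (fst x)" by (simp add: z pqk sh_def)
  qed
  then show ?thesis by blast
qed

section \<open>Ranks of interleaved persistence modules\<close>

lemma (in vectorspace) subspace_fin_dim_le: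
  assumes W: "VectorSpace.subspace K W V" and fd: fin_dim
  shows "vectorspace.fin_dim K (vs W)" "vectorspace.dim K (vs W) \<le> dim"
proof -
  interpret W: vectorspace K "vs W" using W by (rule subspace_is_vs)
  have sub: "LinearCombinations.submodule K W V" using W by simp
  have WV: "W \<subseteq> carrier V" using sub by (simp add: LinearCombinations.submodule_def)
  \<comment> \<open>Independence in \<open>W\<close> is independence in \<open>V\<close>. This
    bounds the size of independent sets and so yields a maximal one, a basis of
    \<open>W\<close>.\<close>
  have li: "finite A \<and> card A \<le> dim" if "A \<subseteq> carrier (vs W) \<and> W.lin_indpt A" for A
    using that span_li_not_depend(2)[OF _ sub, of A] li_le_dim[OF fd, of A] WV by auto
  have "{} \<subseteq> carrier (vs W) \<and> W.lin_indpt {}" by (auto simp: W.lin_dep_def)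
  then obtain A where A: "finite A" "maximal A (\<lambda>S. S \<subseteq> carrier (vs W) \<and> W.lin_indpt S)"
    using maximal_exists[of "\<lambda>S. S \<subseteq> carrier (vs W) \<and> W.lin_indpt S", OF li] by blast
  have basis: "W.basis A" using A(2) by (rule W.max_li_is_basis)
  then show "W.fin_dim" unfolding W.fin_dim_def W.basis_def using A(1) by auto
  show "W.dim \<le> dim"
    using W.dim_basis[OF A(1) basis] li[of A] basis unfolding W.basis_def by auto
qed

lemma subspaceI:
  assumes "vectorspace K V" "W \<subseteq> carrier V" "\<zero>\<^bsub>V\<^esub> \<in> W"
    "\<And>v w. v \<in> W \<Longrightarrow> w \<in> W \<Longrightarrow> v \<oplus>\<^bsub>V\<^esub> w \<in> W"
    "\<And>k v. k \<in> carrier K \<Longrightarrow> v \<in> W \<Longrightarrow> k \<odot>\<^bsub>V\<^esub> v \<in> W"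
  shows "VectorSpace.subspace K W V"
  using assms by (simp add: VectorSpace.subspace_def LinearCombinations.submodule_def vectorspace_def)

lemma subspaceD:
  assumes "VectorSpace.subspace K W V"
  shows "W \<subseteq> carrier V" "\<zero>\<^bsub>V\<^esub> \<in> W"
    "\<And>v w. v \<in> W \<Longrightarrow> w \<in> W \<Longrightarrow> v \<oplus>\<^bsub>V\<^esub> w \<in> W"
    "\<And>k v. k \<in> carrier K \<Longrightarrow> v \<in> W \<Longrightarrow> k \<odot>\<^bsub>V\<^esub> v \<in> W"
  using assms by (simp_all add: VectorSpace.subspace_def LinearCombinations.submodule_def)

lemma subspace_subspace:
  assumes "VectorSpace.subspace K W V" "VectorSpace.subspace K W' V" "W \<subseteq> W'"
  shows "VectorSpace.subspace K W (V\<lparr>carrier := W'\<rparr>)"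
  using subspaceD[OF assms(1)] assms(3)
  by (intro subspaceI vectorspace.subspace_is_vs[OF _ assms(2)])
    (use assms(1) in \<open>auto simp: VectorSpace.subspace_def\<close>)

lemma module_hom_0:
  assumes "Module.module R M" "Module.module R N" "f \<in> LinearCombinations.module_hom R M N"
  shows "f \<zero>\<^bsub>M\<^esub> = \<zero>\<^bsub>N\<^esub>"
  using mod_hom.f0_is_0[of R M N f] assms by (simp add: mod_hom_def mod_hom_axioms_def)

lemma subspace_carrier: "vectorspace K V \<Longrightarrow> VectorSpace.subspace K (carrier V) V"
  by (intro subspaceI) (auto simp: vectorspace_def Module.module_def Module.module_axioms_def
      abelian_group_def abelian_monoid.zero_closed abelian_monoid.a_closed)

lemma subspace_image:
  assumes V: "vectorspace K V" and U: "vectorspace K U"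
    and T: "T \<in> LinearCombinations.module_hom K V U" and W: "VectorSpace.subspace K W V"
  shows "VectorSpace.subspace K (T ` W) U"
proof (rule subspaceI[OF U])
  note W = subspaceD[OF W]
  note hom = LinearCombinations.module_hom_add[OF T, symmetric] LinearCombinations.module_hom_smult[OF T, symmetric]
  show "T ` W \<subseteq> carrier U" using LinearCombinations.module_hom_closed[OF T] W(1) by blast
  have "T \<zero>\<^bsub>V\<^esub> = \<zero>\<^bsub>U\<^esub>"
    using module_hom_0[of K V U T] V U T by (simp add: vectorspace_def)
  then show "\<zero>\<^bsub>U\<^esub> \<in> T ` W" using W(2) by (metis imageI)
  show "v \<oplus>\<^bsub>U\<^esub> w \<in> T ` W" if "v \<in> T ` W" "w \<in> T ` W" for v w
    using that W(1,3) hom(1) by (auto simp: subset_iff)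
  show "k \<odot>\<^bsub>U\<^esub> v \<in> T ` W" if "k \<in> carrier K" "v \<in> T ` W" for k v
    using that W(1,4) hom(2) by (auto simp: subset_iff)
qed

abbreviation "dim_on K V W \<equiv> vectorspace.dim K (V\<lparr>carrier := W\<rparr>)"
abbreviation "fin_dim_on K V W \<equiv> vectorspace.fin_dim K (V\<lparr>carrier := W\<rparr>)"

lemma image_rank_nullity:
  assumes V: "vectorspace K V" and U: "vectorspace K U"
    and T: "T \<in> LinearCombinations.module_hom K V U" and W: "VectorSpace.subspace K W V"
    and fd: "fin_dim_on K V W"
  shows "dim_on K U (T ` W) +
      dim_on K V ({w \<in> W. T w = \<zero>\<^bsub>U\<^esub>}) =
      dim_on K V W"
    and "VectorSpace.subspace K {w \<in> W. T w = \<zero>\<^bsub>U\<^esub>} V"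
    and "fin_dim_on K U (T ` W)"
proof -
  note WD = subspaceD[OF W]
  have hom: "T \<in> LinearCombinations.module_hom K (V\<lparr>carrier := W\<rparr>) U"
    using T WD(1) unfolding LinearCombinations.module_hom_def by (auto simp: subset_iff)
  interpret T: linear_map K "V\<lparr>carrier := W\<rparr>" U T
    using vectorspace.subspace_is_vs[OF V W] U hom
    by (simp add: linear_map_def mod_hom_def mod_hom_axioms_def vectorspace_def)
  have "T.im = T ` W" "T.ker = {w \<in> W. T w = \<zero>\<^bsub>U\<^esub>}"
    by (auto simp: T.im_def T.ker_def)
  then show "dim_on K U (T ` W) +
      dim_on K V ({w \<in> W. T w = \<zero>\<^bsub>U\<^esub>}) =
      dim_on K V W"
    using T.rank_nullity[OF fd] by simp
  have T0: "T \<zero>\<^bsub>V\<^esub> = \<zero>\<^bsub>U\<^esub>"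
    using module_hom_0[of K V U T] V U T by (simp add: vectorspace_def)
  show "VectorSpace.subspace K {w \<in> W. T w = \<zero>\<^bsub>U\<^esub>} V"
  proof (rule subspaceI[OF V])
    interpret U: vectorspace K U by fact
    show "{w \<in> W. T w = \<zero>\<^bsub>U\<^esub>} \<subseteq> carrier V" using WD by auto
    show "\<zero>\<^bsub>V\<^esub> \<in> {w \<in> W. T w = \<zero>\<^bsub>U\<^esub>}" using WD T0 by auto
    show "v \<oplus>\<^bsub>V\<^esub> w \<in> {w \<in> W. T w = \<zero>\<^bsub>U\<^esub>}"
      if "v \<in> {w \<in> W. T w = \<zero>\<^bsub>U\<^esub>}" "w \<in> {w \<in> W. T w = \<zero>\<^bsub>U\<^esub>}" for v w
      using that WD LinearCombinations.module_hom_add[OF T, of v w] by auto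
    show "k \<odot>\<^bsub>V\<^esub> v \<in> {w \<in> W. T w = \<zero>\<^bsub>U\<^esub>}"
      if "k \<in> carrier K" "v \<in> {w \<in> W. T w = \<zero>\<^bsub>U\<^esub>}" for k v
      using that WD LinearCombinations.module_hom_smult[OF T, of k v] by auto
  qed
  \<comment> \<open>Finite dimension is inherited along surjections, so the codomain is cut down to
    the image.\<close>
  let ?I = "U\<lparr>carrier := T ` W\<rparr>"
  have I: "vectorspace K ?I"
    using vectorspace.subspace_is_vs[OF U subspace_image[OF V U T W]] .
  have "T \<in> LinearCombinations.module_hom K (V\<lparr>carrier := W\<rparr>) ?I"
    using hom unfolding LinearCombinations.module_hom_def by auto
  then interpret T': linear_map K "V\<lparr>carrier := W\<rparr>" ?I T
    using vectorspace.subspace_is_vs[OF V W] I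
    by (simp add: linear_map_def mod_hom_def mod_hom_axioms_def vectorspace_def)
  show "vectorspace.fin_dim K ?I"
    by (rule T'.rank_nullity_main(2)[OF fd]) simp
qed

lemma subspace_mono_fin_dim:
  assumes V: "vectorspace K V" and W: "VectorSpace.subspace K W V" "VectorSpace.subspace K W' V" "W \<subseteq> W'"
    and fd: "fin_dim_on K V W'"
  shows "fin_dim_on K V W"
    and "dim_on K V W \<le> dim_on K V W'"
  using vectorspace.subspace_fin_dim_le[OF vectorspace.subspace_is_vs[OF V W(2)]
      subspace_subspace[OF W] fd]
  by simp_all

text \<open>By rank and nullity, the drop in dimension under \<open>T\<close> is the dimension of
  its kernel on the subspace, and this kernel grows with the subspace.\<close>

lemma dim_image_submodular:
  assumes V: "vectorspace K V" and U: "vectorspace K U"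
    and T: "T \<in> LinearCombinations.module_hom K V U"
    and W: "VectorSpace.subspace K W V" "VectorSpace.subspace K W' V" "W \<subseteq> W'"
    and fd: "fin_dim_on K V W'"
  shows "dim_on K U (T ` W') + dim_on K V W
    \<le> dim_on K U (T ` W) + dim_on K V W'"
proof -
  let ?k = "\<lambda>W. {w \<in> W. T w = \<zero>\<^bsub>U\<^esub>}"
  note fd1 = subspace_mono_fin_dim(1)[OF V W fd]
  note rn = image_rank_nullity[OF V U T W(1) fd1]
  note rn' = image_rank_nullity[OF V U T W(2) fd]
  have "fin_dim_on K V (?k W')"
    using subspace_mono_fin_dim(1)[OF V rn'(2) W(2) _ fd] by auto
  then have "dim_on K V (?k W) \<le> dim_on K V (?k W')"
    using W(3) by (intro subspace_mono_fin_dim(2)[OF V rn(2) rn'(2)]) auto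
  then show ?thesis using rn(1) rn'(1) by linarith
qed

section \<open>Persistence modules and the image of an interleaving morphism\<close>

definition persistence_module :: "'r ring \<Rightarrow> ('r, 'm) pers_module \<Rightarrow> bool" where
  "persistence_module R M \<longleftrightarrow>
     (\<forall>t. Module.module R (pobj M t)) \<and>
     (\<forall>s t. s \<le> t \<longrightarrow> pmap M s t \<in> LinearCombinations.module_hom R (pobj M s) (pobj M t)) \<and>
     (\<forall>s t u. s \<le> t \<longrightarrow> t \<le> u \<longrightarrow>
        (\<forall>x\<in>carrier (pobj M s). pmap M t u (pmap M s t x) = pmap M s u x))"

lemma persistence_moduleD:
  assumes "persistence_module R M"
  shows "Module.module R (pobj M t)"
    and "s \<le> t \<Longrightarrow> pmap M s t \<in> LinearCombinations.module_hom R (pobj M s) (pobj M t)"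
    and "s \<le> t \<Longrightarrow> t \<le> u \<Longrightarrow> x \<in> carrier (pobj M s) \<Longrightarrow> pmap M t u (pmap M s t x) = pmap M s u x"
  using assms by (simp_all add: persistence_module_def)

lemma pmap_images:
  assumes M: "persistence_module R M" and ab: "a \<le> b" and bc: "b \<le> c"
  shows "pmap M b c ` pmap M a b ` carrier (pobj M a) = pmap M a c ` carrier (pobj M a)"
    and "pmap M a c ` carrier (pobj M a) \<subseteq> pmap M b c ` carrier (pobj M b)"
proof -
  note MD = persistence_moduleD[OF M]
  show "pmap M b c ` pmap M a b ` carrier (pobj M a) = pmap M a c ` carrier (pobj M a)"
    unfolding image_image using MD(3)[OF ab bc] by (intro image_cong) auto
  then show "pmap M a c ` carrier (pobj M a) \<subseteq> pmap M b c ` carrier (pobj M b)"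
    using LinearCombinations.module_hom_closed[OF MD(2)[OF ab]] by blast
qed

lemma subspace_pmap_image:
  assumes "field K" "persistence_module K M" "s \<le> t"
  shows "VectorSpace.subspace K (pmap M s t ` carrier (pobj M s)) (pobj M t)"
proof -
  have "vectorspace K (pobj M t)" for t
    using assms(1) persistence_moduleD(1)[OF assms(2)] by (simp add: vectorspace_def)
  then show ?thesis
    by (intro subspace_image[OF _ _ persistence_moduleD(2)[OF assms(2,3)]] subspace_carrier)
qed

text \<open>For the four-term inequality, the nested subspaces are the images of times
  \<open>a\<close> and \<open>b\<close> at time \<open>c\<close>, and the map leads from
  \<open>c\<close> to \<open>d\<close>.\<close>

lemma rank_function_q_tame:
  assumes K: "field K" and M: "persistence_module K M" and q: "q_tame K M"
  shows "rank_function (\<lambda>s t. vectorspace.dim K (pmap_image M s t))"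
proof -
  note MD = persistence_moduleD[OF M] and im = pmap_images[OF M] and sub = subspace_pmap_image[OF K M]
  have v: "vectorspace K (pobj M t)" for t using MD(1) K by (simp add: vectorspace_def)
  have fin: "fin_dim_on K (pobj M t) (pmap M s t ` carrier (pobj M s))" if "s < t" for s t
    using q that by (simp add: q_tame_def pmap_image_def)
  show ?thesis
    unfolding pmap_image_def
  proof (rule rank_functionI, goal_cases)
    case (1 a b c d)
    then show ?case
      using dim_image_submodular[OF v v MD(2)[of c d] sub sub im(2) fin, of a b] im(1) by simp
  next
    case (2 a b c)
    then show ?case by (intro subspace_mono_fin_dim(2)[OF v sub sub im(2) fin]) auto
  next
    case (3 b c d)
    then show ?case
      using image_rank_nullity(1)[OF v v MD(2)[of c d] sub fin, of b] im(1)[of b c d] by simp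
  qed
qed

text \<open>The image module \<open>I\<close> consists of the images of \<open>\<phi> t\<close>
  inside \<open>pobj N (t + e)\<close>. It is not formed as a persistence module: only the images of
  its structure maps and their dimensions \<open>r\<close> enter.\<close>

theorem bottleneck_stability:
  assumes K: "field K" and M: "persistence_module K M" and N: "persistence_module K N"
    and qM: "q_tame K M" and qN: "q_tame K N"
    and e: "0 \<le> e" and inter: "interleaved K e M N"
  shows "\<exists>P. eps_matching e (pers_diagram K M) (pers_diagram K N) P"
proof -
  note MD = persistence_moduleD[OF M]
  note ND = persistence_moduleD[OF N]
  have vM: "vectorspace K (pobj M t)" and vN: "vectorspace K (pobj N t)" for t
    using MD(1) ND(1) K by (simp_all add: vectorspace_def)
  obtain \<phi> \<psi> where \<phi>: "shifted_morphism K e M N \<phi>" and \<psi>: "shifted_morphism K e N M \<psi>"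
    and \<psi>\<phi>: "\<And>p x. x \<in> carrier (pobj M p) \<Longrightarrow> \<psi> (p + e) (\<phi> p x) = pmap M p (p + 2 * e) x"
    and \<phi>\<psi>: "\<And>p y. y \<in> carrier (pobj N p) \<Longrightarrow> \<phi> (p + e) (\<psi> p y) = pmap N p (p + 2 * e) y"
    using inter unfolding interleaved_def by blast
  have h\<phi>: "\<phi> p \<in> LinearCombinations.module_hom K (pobj M p) (pobj N (p + e))"
    and h\<psi>: "\<psi> p \<in> LinearCombinations.module_hom K (pobj N p) (pobj M (p + e))" for p
    using \<phi> \<psi> by (simp_all add: shifted_morphism_def)
  have nat\<phi>: "\<phi> q (pmap M p q x) = pmap N (p + e) (q + e) (\<phi> p x)"
    if "p \<le> q" "x \<in> carrier (pobj M p)" for p q x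
    using \<phi> that by (simp add: shifted_morphism_def)
  define iM where "iM s t = pmap M s t ` carrier (pobj M s)" for s t
  define iN where "iN s t = pmap N s t ` carrier (pobj N s)" for s t
  \<comment> \<open>The image of time \<open>s\<close> at time \<open>t\<close> in \<open>I\<close>:
    by naturality the map of \<open>N\<close> after \<open>\<phi> s\<close> is
    \<open>\<phi> t\<close> after the map of \<open>M\<close>.\<close>
  define J where "J s t = \<phi> t ` iM s t" for s t
  define m where "m s t = dim_on K (pobj M t) (iM s t)" for s t
  define n where "n s t = dim_on K (pobj N t) (iN s t)" for s t
  define r where "r s t = dim_on K (pobj N (t + e)) (J s t)" for s t
  note sM = subspace_pmap_image[OF K M, folded iM_def] and sN = subspace_pmap_image[OF K N, folded iN_def]
  have sJ: "VectorSpace.subspace K (J s t) (pobj N (t + e))" if "s \<le> t" for s t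
    unfolding J_def using that by (intro subspace_image[OF vM vN h\<phi>] sM)
  have fM: "fin_dim_on K (pobj M t) (iM s t)"
    and fN: "fin_dim_on K (pobj N t) (iN s t)" if "s < t" for s t
    using qM qN that by (simp_all add: q_tame_def pmap_image_def iM_def iN_def)
  have fJ: "fin_dim_on K (pobj N (t + e)) (J s t)" if "s < t" for s t
    unfolding J_def using that by (intro image_rank_nullity(3)[OF vM vN h\<phi>] sM fM) auto
  have cM: "iM s t \<subseteq> carrier (pobj M t)" and cN: "iN s t \<subseteq> carrier (pobj N t)" if "s \<le> t" for s t
    using subspaceD(1) sM sN that by blast+
  have memM: "pmap M s t x \<in> carrier (pobj M t)" if "s \<le> t" "x \<in> carrier (pobj M s)" for s t x
    using cM that by (auto simp: iM_def)
  have memN: "pmap N s t x \<in> carrier (pobj N t)" if "s \<le> t" "x \<in> carrier (pobj N s)" for s t x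
    using cN that by (auto simp: iN_def)
  have mem\<phi>: "\<phi> p x \<in> carrier (pobj N (p + e))" if "x \<in> carrier (pobj M p)" for p x
    using LinearCombinations.module_hom_closed[OF h\<phi>] that by blast
  have mem\<psi>: "\<psi> p x \<in> carrier (pobj M (p + e))" if "x \<in> carrier (pobj N p)" for p x
    using LinearCombinations.module_hom_closed[OF h\<psi>] that by blast
  note monoM = pmap_images(2)[OF M, folded iM_def] and monoN = pmap_images(2)[OF N, folded iN_def]
  have monoJ: "J a c \<subseteq> J b c" if "a \<le> b" "b \<le> c" for a b c
    using monoM[OF that] by (auto simp: J_def)
  note imM = pmap_images(1)[OF M, folded iM_def] and imN = pmap_images(1)[OF N, folded iN_def]
  have imJ: "pmap N (c + e) (d + e) ` J b c = J b d" if "b \<le> c" "c \<le> d" for b c d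
  proof -
    have "pmap N (c + e) (d + e) ` J b c = \<phi> d ` pmap M c d ` iM b c"
      unfolding J_def image_image using nat\<phi>[OF that(2)] cM[OF that(1)]
      by (intro image_cong) auto
    then show ?thesis using imM[OF that] by (simp add: J_def)
  qed
  \<comment> \<open>\<open>\<psi>\<close> after \<open>\<phi>\<close> is the map of \<open>M\<close>
    over a step of \<open>2 * e\<close>. So what survives in \<open>M\<close> for a further
    \<open>2 * e\<close> survives in \<open>I\<close>, which limits the loss in the deaths.\<close>
  have im\<psi>: "\<psi> (c + e) ` J b c = iM b (c + 2 * e)" if "b \<le> c" for b c
  proof -
    have "\<psi> (c + e) ` J b c = pmap M c (c + 2 * e) ` iM b c"
      unfolding J_def image_image using \<psi>\<phi> cM[OF that] by (intro image_cong) auto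
    then show ?thesis using imM that e by simp
  qed
  have JN: "J b c \<subseteq> iN (b + e) (c + e)" if "b \<le> c" for b c
    using nat\<phi>[OF that] mem\<phi> by (auto simp: J_def iM_def iN_def)
  \<comment> \<open>The map of \<open>N\<close> from \<open>b - e\<close> to \<open>b + e\<close>
    factors through \<open>pobj M b\<close>, so its image already lies in the image of
    \<open>\<phi> b\<close>.\<close>
  have NJ: "iN (b - e) (c + e) \<subseteq> J b c" if bc: "b \<le> c" for b c
  proof
    fix z assume "z \<in> iN (b - e) (c + e)"
    then obtain y where y: "y \<in> carrier (pobj N (b - e))" "z = pmap N (b - e) (c + e) y"
      by (auto simp: iN_def)
    have \<psi>y: "\<psi> (b - e) y \<in> carrier (pobj M b)" using mem\<psi>[OF y(1)] by simp
    have "z = pmap N (b + e) (c + e) (pmap N (b - e) (b + e) y)"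
      using ND(3)[of "b - e" "b + e" "c + e" y] y bc e by simp
    also have "pmap N (b - e) (b + e) y = \<phi> b (\<psi> (b - e) y)"
      using \<phi>\<psi>[OF y(1)] by (simp add: algebra_simps)
    also have "pmap N (b + e) (c + e) (\<phi> b (\<psi> (b - e) y)) = \<phi> c (pmap M b c (\<psi> (b - e) y))"
      using nat\<phi>[OF bc \<psi>y] by simp
    finally show "z \<in> J b c" using \<psi>y by (auto simp: J_def iM_def)
  qed
  have h\<psi>': "\<psi> (c + e) \<in> LinearCombinations.module_hom K (pobj N (c + e)) (pobj M (c + 2 * e))" for c
    using h\<psi>[of "c + e"] by (simp add: add.assoc)
  have mn: "m = (\<lambda>s t. vectorspace.dim K (pmap_image M s t))"
    "n = (\<lambda>s t. vectorspace.dim K (pmap_image N s t))"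
    by (auto simp: fun_eq_iff m_def n_def iM_def iN_def pmap_image_def)
  have rM: "rank_function m" and rN: "rank_function n"
    unfolding mn by (rule rank_function_q_tame[OF K M qM], rule rank_function_q_tame[OF K N qN])
  have rJ: "rank_function r"
  proof (rule rank_functionI)
    fix a b c d :: real
    show "r a c + r b d \<le> r b c + r a d" if "a \<le> b" "b < c" "c \<le> d"
      using dim_image_submodular[OF vN vN ND(2)[of "c + e" "d + e"] sJ sJ monoJ fJ, of a b] imJ that
      by (simp add: r_def)
    show "r a c \<le> r b c" if "a \<le> b" "b < c"
      unfolding r_def using that by (intro subspace_mono_fin_dim(2)[OF vN sJ sJ monoJ fJ]) auto
    show "r b d \<le> r b c" if "b < c" "c \<le> d"
      using image_rank_nullity(1)[OF vN vN ND(2)[of "c + e" "d + e"] sJ fJ, of b] imJ[of b c d] that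
      by (simp add: r_def)
  qed
  have "\<exists>P. eps_matching e (rank_diagram m) (rank_diagram n) P"
  proof (rule eps_matching_of_ranks[OF rM rJ rN e])
    fix a b c d :: real
    \<comment> \<open>Each four-term inequality is \<open>dim_image_submodular\<close> for two
      nested images: once under \<open>\<phi>\<close>, once under \<open>\<psi>\<close>, and twice
      under the map of \<open>N\<close> from \<open>c + e\<close> to \<open>d + e\<close>.\<close>
    show "r b c + m a c \<le> r a c + m b c" if "a \<le> b" "b < c"
      using dim_image_submodular[OF vM vN h\<phi> sM sM monoM fM, of a c b] that
      by (simp add: m_def r_def J_def)
    show "r b c \<le> m b c" if "b < c"
      using image_rank_nullity(1)[OF vM vN h\<phi> sM fM, of b c] that by (simp add: m_def r_def J_def)
    show "m b (c + 2 * e) + r a c \<le> m a (c + 2 * e) + r b c" if "a \<le> b" "b < c"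
      using dim_image_submodular[OF vN vM h\<psi>' sJ sJ monoJ fJ, of a c b] im\<psi> that
      by (simp add: m_def r_def)
    show "m b (c + 2 * e) \<le> r b c" if "b < c"
      using image_rank_nullity(1)[OF vN vM h\<psi>' sJ fJ, of b c] im\<psi>[of b c] that
      by (simp add: m_def r_def)
    show "r b c + n (b + e) (d + e) \<le> r b d + n (b + e) (c + e)" if "b < c" "c \<le> d"
      using dim_image_submodular[OF vN vN ND(2)[of "c + e" "d + e"] sJ sN JN fN, of b]
        imJ[of b c d] imN[of "b + e" "c + e" "d + e"] that
      by (simp add: n_def r_def)
    show "r b c \<le> n (b + e) (c + e)" if "b < c"
      unfolding n_def r_def using that by (intro subspace_mono_fin_dim(2)[OF vN sJ sN JN fN]) auto
    show "n (b - e) (c + e) + r b d \<le> n (b - e) (d + e) + r b c" if "b < c" "c \<le> d"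
      using dim_image_submodular[OF vN vN ND(2)[of "c + e" "d + e"] sN sJ NJ fJ, of b]
        imJ[of b c d] imN[of "b - e" "c + e" "d + e"] that e
      by (simp add: n_def r_def)
    show "n (b - e) (c + e) \<le> r b c" if "b < c"
      unfolding n_def r_def using that e by (intro subspace_mono_fin_dim(2)[OF vN sN sJ NJ fJ]) auto
  qed
  then show ?thesis unfolding pers_diagram_eq mn .
qed

section \<open>Alternating chains\<close>

context abelian_group
begin

section \<open>Finitely supported functions and their pushforwards\<close>

lemma a_inv_zero: "\<ominus> \<zero> = \<zero>"
  using r_neg[of \<zero>] l_zero[of "\<ominus> \<zero>"] by simp

definition finsupp :: "('x \<Rightarrow> 'a) \<Rightarrow> bool" where
  "finsupp c \<longleftrightarrow> range c \<subseteq> carrier G \<and> finite {x. c x \<noteq> \<zero>}"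

lemma finsuppD:
  assumes "finsupp c"
  shows "c x \<in> carrier G" "finite {x. c x \<noteq> \<zero>}" "finite {x. c x \<noteq> \<zero> \<and> Q x}"
  using assms by (auto simp: finsupp_def intro: rev_finite_subset)

lemma finsuppI:
  assumes "\<And>x. c x \<in> carrier G" "\<And>x. c x \<noteq> \<zero> \<Longrightarrow> x \<in> A" "finite A"
  shows "finsupp c"
  using assms by (auto simp: finsupp_def intro: rev_finite_subset)

lemma finsum_superset:
  assumes "finite A" "\<And>x. x \<in> A \<Longrightarrow> h x \<in> carrier G" "S \<subseteq> A" "\<And>x. x \<in> A \<Longrightarrow> x \<notin> S \<Longrightarrow> h x = \<zero>"
  shows "finsum G h S = finsum G h A"
  using assms by (intro add.finprod_mono_neutral_cong_left) auto

lemma finsum_minus: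
  assumes "finite A" "\<And>x. x \<in> A \<Longrightarrow> h x \<in> carrier G"
  shows "(\<Oplus>x\<in>A. \<ominus> h x) = \<ominus> finsum G h A"
  using assms
proof (induction A rule: finite_induct)
  case (insert x A)
  then show ?case
    by (subst (1 2) finsum_insert) (auto simp: minus_add Pi_def)
qed (simp add: a_inv_zero)

lemma finsum_fiberwise:
  assumes "finite I" "\<And>i. i \<in> I \<Longrightarrow> finite (A i)"
    "\<And>i j x. i \<in> I \<Longrightarrow> j \<in> I \<Longrightarrow> x \<in> A i \<Longrightarrow> x \<in> A j \<Longrightarrow> i = j"
    "\<And>x. g x \<in> carrier G"
  shows "finsum G g (\<Union>i\<in>I. A i) = (\<Oplus>i\<in>I. finsum G g (A i))"
  using assms by (intro add.finprod_UN_disjoint) (auto simp: pairwise_def disjnt_iff)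

text \<open>A fixed-point free involution is needed: \<open>s = \<ominus> s\<close> does not force \<open>s = \<zero>\<close> in
  characteristic two.\<close>

lemma finsum_involution_zero:
  assumes "finite A" "\<And>x. h x \<in> carrier G"
    and "\<And>x. x \<in> A \<Longrightarrow> \<sigma> x \<in> A \<and> \<sigma> (\<sigma> x) = x \<and> \<sigma> x \<noteq> x \<and> h (\<sigma> x) = \<ominus> h x"
  shows "finsum G h A = \<zero>"
  using assms(1,3)
proof (induction "card A" arbitrary: A rule: less_induct)
  case less
  show ?case
  proof (cases "A = {}")
    case False
    then obtain x where x: "x \<in> A" by blast
    note sx = less.prems(2)[OF x]
    define B where "B = A - {x, \<sigma> x}"
    have B: "finite B" "card B < card A" "A = insert x (insert (\<sigma> x) B)" "x \<notin> insert (\<sigma> x) B" "\<sigma> x \<notin> B"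
      using less.prems(1) x sx unfolding B_def by (auto intro: psubset_card_mono)
    have "\<sigma> y \<in> B \<and> \<sigma> (\<sigma> y) = y \<and> \<sigma> y \<noteq> y \<and> h (\<sigma> y) = \<ominus> h y" if "y \<in> B" for y
      using less.prems(2)[of y] that sx unfolding B_def by auto
    then have "finsum G h B = \<zero>"
      using less.hyps[OF B(2) B(1)] by blast
    moreover have "finsum G h A = h x \<oplus> (h (\<sigma> x) \<oplus> finsum G h B)"
      using B assms(2) by (subst B(3)) (simp add: Pi_def)
    ultimately show ?thesis using sx assms(2)[of x] by (simp add: r_neg)
  qed simp
qed

text \<open>The linear extension of a map of basis elements. Chain maps are
  \<open>push (map f)\<close> and the boundary is \<open>push tl\<close>, so
  \<open>push_push\<close> handles all their composites.\<close>

definition push :: "('x \<Rightarrow> 'y) \<Rightarrow> ('x \<Rightarrow> 'a) \<Rightarrow> 'y \<Rightarrow> 'a" where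
  "push \<phi> c y = finsum G c {x. c x \<noteq> \<zero> \<and> \<phi> x = y}"

lemma push_eq:
  assumes "finsupp c" "finite A" "{x. c x \<noteq> \<zero>} \<subseteq> A"
  shows "push \<phi> c y = finsum G c {x \<in> A. \<phi> x = y}"
  unfolding push_def using assms by (intro finsum_superset) (auto simp: finsuppD)

lemma push_nonzero:
  assumes "push \<phi> c y \<noteq> \<zero>"
  obtains x where "c x \<noteq> \<zero>" "\<phi> x = y"
proof -
  have "{x. c x \<noteq> \<zero> \<and> \<phi> x = y} \<noteq> {}"
    using assms unfolding push_def by (metis finsum_empty)
  then show ?thesis using that by blast
qed

lemma finsupp_push:
  assumes c: "finsupp c"
  shows "finsupp (push \<phi> c)"
proof (rule finsuppI)
  show "push \<phi> c x \<in> carrier G" for x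
    unfolding push_def by (rule finsum_closed) (simp add: finsuppD[OF c])
  show "finite (\<phi> ` {x. c x \<noteq> \<zero>})" using finsuppD[OF c] by simp
  show "push \<phi> c y \<noteq> \<zero> \<Longrightarrow> y \<in> \<phi> ` {x. c x \<noteq> \<zero>}" for y
    by (elim push_nonzero) auto
qed

lemma push_push:
  assumes c: "finsupp c"
  shows "push \<psi> (push \<phi> c) = push (\<lambda>x. \<psi> (\<phi> x)) c"
proof
  fix z
  let ?A = "{x. c x \<noteq> \<zero>}"
  have fin: "finite ?A" using finsuppD[OF c] by simp
  have "push \<psi> (push \<phi> c) z = (\<Oplus>y\<in>{y \<in> \<phi> ` ?A. \<psi> y = z}. push \<phi> c y)"
    using fin by (intro push_eq finsupp_push c) (auto elim!: push_nonzero)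
  also have "\<dots> = (\<Oplus>y\<in>{y \<in> \<phi> ` ?A. \<psi> y = z}. finsum G c {x \<in> ?A. \<phi> x = y})"
    unfolding push_def by simp
  also have "\<dots> = finsum G c (\<Union>y\<in>{y \<in> \<phi> ` ?A. \<psi> y = z}. {x \<in> ?A. \<phi> x = y})"
    using fin finsuppD[OF c] by (intro finsum_fiberwise[symmetric]) auto
  also have "(\<Union>y\<in>{y \<in> \<phi> ` ?A. \<psi> y = z}. {x \<in> ?A. \<phi> x = y}) = {x. c x \<noteq> \<zero> \<and> \<psi> (\<phi> x) = z}"
    by auto
  also have "finsum G c \<dots> = push (\<lambda>x. \<psi> (\<phi> x)) c z" by (simp only: push_def)
  finally show "push \<psi> (push \<phi> c) z = push (\<lambda>x. \<psi> (\<phi> x)) c z" .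
qed

lemma push_cong:
  assumes "\<And>x. c x \<noteq> \<zero> \<Longrightarrow> \<phi> x = \<psi> x"
  shows "push \<phi> c = push \<psi> c"
proof -
  have "{x. c x \<noteq> \<zero> \<and> \<phi> x = y} = {x. c x \<noteq> \<zero> \<and> \<psi> x = y}" for y
    using assms by auto
  then show ?thesis by (simp add: fun_eq_iff push_def)
qed

lemma finsupp_add:
  assumes "finsupp c" "finsupp d"
  shows "finsupp (\<lambda>x. c x \<oplus> d x)"
  using assms
  by (intro finsuppI[of _ "{x. c x \<noteq> \<zero>} \<union> {x. d x \<noteq> \<zero>}"]) (auto simp: finsuppD)

lemma finsupp_uminus: "finsupp c \<Longrightarrow> finsupp (\<lambda>x. \<ominus> c x)"
  by (intro finsuppI[of _ "{x. c x \<noteq> \<zero>}"]) (auto simp: finsuppD)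

lemma push_add:
  assumes c: "finsupp c" and d: "finsupp d"
  shows "push \<phi> (\<lambda>x. c x \<oplus> d x) = (\<lambda>y. push \<phi> c y \<oplus> push \<phi> d y)"
proof
  fix y
  let ?A = "{x. c x \<noteq> \<zero>} \<union> {x. d x \<noteq> \<zero>}"
  have "finite ?A" using finsuppD(2)[OF c] finsuppD(2)[OF d] by simp
  then show "push \<phi> (\<lambda>x. c x \<oplus> d x) y = push \<phi> c y \<oplus> push \<phi> d y"
    using c d finsuppD(1)
    by (subst (1 2 3) push_eq[where A = ?A]) (auto simp: finsupp_add intro!: finsum_addf)
qed

lemma push_uminus:
  assumes c: "finsupp c"
  shows "push \<phi> (\<lambda>x. \<ominus> c x) = (\<lambda>y. \<ominus> push \<phi> c y)"
proof
  fix y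
  let ?A = "{x. c x \<noteq> \<zero>}"
  have "finite ?A" using finsuppD(2)[OF c] .
  then show "push \<phi> (\<lambda>x. \<ominus> c x) y = \<ominus> push \<phi> c y"
    using c finsuppD(1)
    by (subst (1 2) push_eq[where A = ?A]) (auto simp: finsupp_uminus intro!: finsum_minus)
qed

text \<open>Only exchanges of neighbours are mentioned, which suits inductions over lists;
  \<open>alternating_permute_iff\<close> recovers the sign rule for all permutations.\<close>

definition alternating :: "('v list \<Rightarrow> 'a) \<Rightarrow> bool" where
  "alternating c \<longleftrightarrow> (\<forall>xs x y ys. c (xs @ x # y # ys) = \<ominus> c (xs @ y # x # ys))"

text \<open>\<open>n\<close> is the number of vertices, so \<open>j\<close>-chains are the case
  \<open>n = Suc j\<close>. The case \<open>n = 0\<close>, functions on the empty list, occurs as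
  the link of a vertex in a 0-chain.\<close>

definition chain :: "nat \<Rightarrow> 'v set set \<Rightarrow> ('v list \<Rightarrow> 'a) \<Rightarrow> bool" where
  "chain n E c \<longleftrightarrow> finsupp c \<and> alternating c \<and>
     (\<forall>vs. c vs \<noteq> \<zero> \<longrightarrow> length vs = n \<and> distinct vs \<and> set vs \<in> E)"

lemma chainD:
  assumes "chain n E c"
  shows "finsupp c" "alternating c" "c vs \<in> carrier G"
    "c vs \<noteq> \<zero> \<Longrightarrow> length vs = n" "c vs \<noteq> \<zero> \<Longrightarrow> distinct vs" "c vs \<noteq> \<zero> \<Longrightarrow> set vs \<in> E"
    "c (xs @ x # y # ys) = \<ominus> c (xs @ y # x # ys)"
proof -
  note * = assms[unfolded chain_def]
  show "finsupp c" and alt: "alternating c" using * by blast+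
  then show "c vs \<in> carrier G" by (simp add: finsuppD)
  show "c vs \<noteq> \<zero> \<Longrightarrow> length vs = n" "c vs \<noteq> \<zero> \<Longrightarrow> distinct vs" "c vs \<noteq> \<zero> \<Longrightarrow> set vs \<in> E"
    using * by blast+
  show "c (xs @ x # y # ys) = \<ominus> c (xs @ y # x # ys)"
    using alt unfolding alternating_def by blast
qed

text \<open>The exchange takes an odd number of swaps of neighbours: two for each entry of
  \<open>zs\<close>, and one more.\<close>

lemma alternating_swap:
  assumes alt: "alternating c" and car: "\<And>vs. c vs \<in> carrier G"
  shows "c (xs @ x # zs @ y # ys) = \<ominus> c (xs @ y # zs @ x # ys)"
proof (induction zs arbitrary: xs)
  case Nil
  have "c (xs @ x # y # ys) = \<ominus> c (xs @ y # x # ys)"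
    using alt unfolding alternating_def by blast
  then show ?case by simp
next
  case (Cons z zs)
  have s: "c (xs @ x # y # ys) = \<ominus> c (xs @ y # x # ys)" for xs x y ys
    using alt unfolding alternating_def by blast
  have "c (xs @ x # (z # zs) @ y # ys) = \<ominus> c ((xs @ [z]) @ x # zs @ y # ys)"
    using s[of xs x z] by simp
  also have "\<dots> = c ((xs @ [z]) @ y # zs @ x # ys)"
    unfolding Cons.IH by (simp add: car minus_minus)
  also have "\<dots> = \<ominus> c (xs @ y # (z # zs) @ x # ys)"
    using s[of xs z y] by simp
  finally show ?case .
qed

lemma alternating_transpose:
  assumes alt: "alternating c" and car: "\<And>vs. c vs \<in> carrier G"
    and ij: "i < length vs" "j < length vs" "i \<noteq> j"
  shows "c (permute_list (Transposition.transpose i j) vs) = \<ominus> c vs"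
  using ij
proof (induction i j rule: linorder_wlog)
  case (le i j)
  then have ij: "i < j" by simp
  define xs zs ys where "xs = take i vs" "zs = take (j - Suc i) (drop (Suc i) vs)" "ys = drop (Suc j) vs"
  have vs: "vs = xs @ vs ! i # zs @ vs ! j # ys"
  proof -
    have "drop (Suc i) vs = zs @ vs ! j # ys"
      using ij le(3) id_take_nth_drop[of "j - Suc i" "drop (Suc i) vs"]
      by (simp add: xs_zs_ys_def)
    then show ?thesis using id_take_nth_drop[of i vs] le by (simp add: xs_zs_ys_def)
  qed
  have len: "length xs = i" "length zs = j - Suc i" using le ij by (auto simp: xs_zs_ys_def)
  have "permute_list (Transposition.transpose i j) vs = vs[i := vs ! j, j := vs ! i]"
    by (rule nth_equalityI) (auto simp: permute_list_def nth_list_update Transposition.transpose_def)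
  also have "\<dots> = xs @ vs ! j # zs @ vs ! i # ys"
  proof -
    have "(xs @ a # zs @ b # ys)[i := b, j := a] = xs @ b # zs @ a # ys" for a b
      using list_update_length[of xs a "zs @ b # ys" b]
        list_update_length[of "xs @ b # zs" b ys a] len ij by simp
    from this[of "vs ! i" "vs ! j"] show ?thesis unfolding vs[symmetric] .
  qed
  finally have "permute_list (Transposition.transpose i j) vs = xs @ vs ! j # zs @ vs ! i # ys" .
  then show ?case
    using alternating_swap[OF alt car, of xs "vs ! j" zs "vs ! i" ys] vs[symmetric] by simp
next
  case (sym i j)
  then show ?case by (simp add: transpose_commute)
qed

lemma alternating_permute:
  fixes c :: "'v list \<Rightarrow> 'a"
  assumes alt: "alternating c" and car: "\<And>vs. c vs \<in> carrier G" and p: "p permutes {..<length vs}"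
  shows "c (permute_list p vs) = (if evenperm p then c vs else \<ominus> c vs)"
proof -
  \<comment> \<open>A composite applies \<open>p\<close> to a list that is already rearranged, hence
    the claim for all lists of this length.\<close>
  have "\<forall>ws. length ws = length vs \<longrightarrow> c (permute_list p ws) = (if evenperm p then c ws else \<ominus> c ws)"
    using p finite_lessThan[of "length vs"]
  proof (induction p rule: permutes_induct)
    case (swap a b p)
    show ?case
    proof (intro allI impI)
      fix ws :: "'v list" assume ws: "length ws = length vs"
      let ?t = "Transposition.transpose a b"
      have "permute_list (?t \<circ> p) ws = permute_list p (permute_list ?t ws)"
        using swap ws by (intro permute_list_compose) simp
      moreover have "c (permute_list ?t ws) = \<ominus> c ws"
        using swap ws by (intro alternating_transpose alt car) auto
      moreover have "evenperm (?t \<circ> p) \<longleftrightarrow> \<not> evenperm p"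
        using swap by (subst evenperm_comp)
          (auto simp: permutation_swap_id evenperm_swap intro: permutation_permutes[THEN iffD2])
      ultimately show "c (permute_list (?t \<circ> p) ws) = (if evenperm (?t \<circ> p) then c ws else \<ominus> c ws)"
        using swap.IH ws car by (simp add: minus_minus)
    qed
  qed simp
  then show ?thesis by simp
qed

lemma alternating_permute_iff:
  fixes c :: "'v list \<Rightarrow> 'a"
  assumes car: "\<And>vs. c vs \<in> carrier G"
  shows "alternating c \<longleftrightarrow> (\<forall>vs p. p permutes {..<length vs} \<longrightarrow>
           c (permute_list p vs) = (if evenperm p then c vs else \<ominus> c vs))"
proof
  assume *: "\<forall>vs p. p permutes {..<length vs} \<longrightarrow>
           c (permute_list p vs) = (if evenperm p then c vs else \<ominus> c vs)"
  show "alternating c"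
    unfolding alternating_def
  proof (intro allI)
    fix xs ys :: "'v list" and x y
    let ?i = "length xs" and ?vs = "xs @ y # x # ys"
    let ?t = "Transposition.transpose ?i (Suc ?i)"
    have t: "?t permutes {..<length ?vs}" by (intro permutes_swap_id) auto
    have "permute_list ?t ?vs = xs @ x # y # ys"
      by (rule nth_equalityI)
        (auto simp: permute_list_nth[OF t] nth_append nth_Cons' Transposition.transpose_def)
    moreover have "\<not> evenperm ?t" by (simp add: evenperm_swap)
    ultimately show "c (xs @ x # y # ys) = \<ominus> c (xs @ y # x # ys)" using *[rule_format, OF t] by simp
  qed
qed (use alternating_permute car in blast)

text \<open>Exchanging the entries at \<open>i\<close> and \<open>j\<close> preserves the fibre over
  \<open>ws\<close> and negates \<open>c\<close>. The lists in the support are distinct, so no list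
  is fixed and the terms cancel in pairs. This serves both for degenerate images under a vertex map
  and for \<open>bd_bd\<close>.\<close>

lemma push_repeated_zero:
  assumes c: "chain n E c" and ij: "i < n" "j < n" "i \<noteq> j"
    and \<phi>: "\<And>vs. length vs = n \<Longrightarrow> \<phi> (permute_list (Transposition.transpose i j) vs) = \<phi> vs \<or> \<phi> vs \<noteq> ws"
  shows "push \<phi> c ws = \<zero>"
  unfolding push_def
proof (rule finsum_involution_zero)
  note c = chainD[OF c]
  show "finite {x. c x \<noteq> \<zero> \<and> \<phi> x = ws}" using finsuppD[OF c(1)] by simp
  show "c x \<in> carrier G" for x by (rule c)
  let ?\<sigma> = "permute_list (Transposition.transpose i j)"
  fix vs assume vs: "vs \<in> {x. c x \<noteq> \<zero> \<and> \<phi> x = ws}"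
  then have len: "length vs = n" and dist: "distinct vs" using c by auto
  have t: "Transposition.transpose i j permutes {..<length vs}"
    using ij len by (intro permutes_swap_id) auto
  have neg: "c (?\<sigma> vs) = \<ominus> c vs"
    using ij len c by (intro alternating_transpose) auto
  moreover have "c (?\<sigma> vs) \<noteq> \<zero>"
  proof
    assume "c (?\<sigma> vs) = \<zero>"
    then have "\<ominus> (\<ominus> c vs) = \<zero>" unfolding neg by (simp only: a_inv_zero)
    then show False using vs c(3) by (simp add: minus_minus)
  qed
  moreover have "\<phi> (?\<sigma> vs) = ws" using \<phi>[OF len] vs by auto
  moreover have "?\<sigma> (?\<sigma> vs) = vs"
    by (subst permute_list_compose[symmetric, OF t]) simp
  moreover have "?\<sigma> vs \<noteq> vs"
  proof
    assume "?\<sigma> vs = vs"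
    then have "?\<sigma> vs ! i = vs ! i" by simp
    then have "vs ! j = vs ! i" using permute_list_nth[OF t, of i] ij len by simp
    then show False using dist ij len by (simp add: nth_eq_iff_index_eq)
  qed
  ultimately show "?\<sigma> vs \<in> {x. c x \<noteq> \<zero> \<and> \<phi> x = ws} \<and> ?\<sigma> (?\<sigma> vs) = vs \<and> ?\<sigma> vs \<noteq> vs \<and>
      c (?\<sigma> vs) = \<ominus> c vs" by simp
qed

text \<open>On chains of single vertices this is the augmentation, its value sitting at the empty
  list. Hence degree 0, where \<open>boundary\<close> is zero, appears below as the separate
  alternative \<open>j = 0\<close> or \<open>n = 0\<close>.\<close>

definition bd :: "('v list \<Rightarrow> 'a) \<Rightarrow> 'v list \<Rightarrow> 'a" where
  "bd c ws = finsum G (\<lambda>v. c (v # ws)) {v. c (v # ws) \<noteq> \<zero>}"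

lemma bd_superset:
  assumes "chain n E c" "finite V" "\<And>v. c (v # ws) \<noteq> \<zero> \<Longrightarrow> v \<in> V"
  shows "bd c ws = finsum G (\<lambda>v. c (v # ws)) V"
  unfolding bd_def using assms(2,3) chainD(3)[OF assms(1)] by (intro finsum_superset) auto

lemma chain_push_map:
  fixes f :: "'v \<Rightarrow> 'w"
  assumes c: "chain n E c" and E: "\<And>vs. c vs \<noteq> \<zero> \<Longrightarrow> f ` set vs \<in> E'"
  shows "chain n E' (push (map f) c)"
  unfolding chain_def
proof (intro conjI allI impI)
  note c' = chainD[OF c]
  show "finsupp (push (map f) c)" using c' by (intro finsupp_push)
  show "alternating (push (map f) c)"
    unfolding alternating_def
  proof (intro allI)
    fix xs ys :: "'w list" and x y
    let ?i = "length xs" and ?A = "xs @ x # y # ys" and ?A' = "xs @ y # x # ys"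
    define \<sigma> :: "'v list \<Rightarrow> 'v list" where "\<sigma> = permute_list (Transposition.transpose ?i (Suc ?i))"
    have t: "Transposition.transpose ?i (Suc ?i) permutes {..<length vs}" if "length vs = length ?A" for vs :: "'z list"
      using that by (intro permutes_swap_id) auto
    have swap: "permute_list (Transposition.transpose ?i (Suc ?i)) (xs @ a # b # ys) = xs @ b # a # ys" for a b
      using t[of "xs @ a # b # ys"]
      by (intro nth_equalityI)
        (auto simp: permute_list_nth nth_append nth_Cons' Transposition.transpose_def)
    have map\<sigma>: "map f (\<sigma> vs) = permute_list (Transposition.transpose ?i (Suc ?i)) (map f vs)"
      if "length vs = length ?A" for vs
      unfolding \<sigma>_def by (rule permute_list_map[symmetric, OF t[OF that]])
    have \<sigma>\<sigma>: "\<sigma> (\<sigma> vs) = vs" if "length vs = length ?A" for vs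
      unfolding \<sigma>_def by (subst permute_list_compose[symmetric, OF t[OF that]]) simp
    have c\<sigma>: "c (\<sigma> vs) = \<ominus> c vs" if "length vs = length ?A" for vs
      unfolding \<sigma>_def using that c' by (intro alternating_transpose) auto
    have nz: "c (\<sigma> vs) \<noteq> \<zero>" if "length vs = length ?A" "c vs \<noteq> \<zero>" for vs
      using c\<sigma>[OF that(1)] that(2) c'(3)[of vs] a_inv_zero minus_minus by metis
    \<comment> \<open>Exchanging the two positions is a bijection between the fibres over
      \<open>?A'\<close> and \<open>?A\<close> that negates \<open>c\<close>.\<close>
    have eq: "{vs. c vs \<noteq> \<zero> \<and> map f vs = ?A} = \<sigma> ` {vs. c vs \<noteq> \<zero> \<and> map f vs = ?A'}"
    proof (intro Set.set_eqI iffI)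
      fix vs assume "vs \<in> {vs. c vs \<noteq> \<zero> \<and> map f vs = ?A}"
      then have vs: "c vs \<noteq> \<zero>" "map f vs = ?A" by auto
      then have len: "length vs = length ?A" by (metis length_map)
      have "map f (\<sigma> vs) = ?A'" unfolding map\<sigma>[OF len] vs(2) swap ..
      then have "\<sigma> vs \<in> {vs. c vs \<noteq> \<zero> \<and> map f vs = ?A'}" using nz len vs by auto
      then show "vs \<in> \<sigma> ` {vs. c vs \<noteq> \<zero> \<and> map f vs = ?A'}" using \<sigma>\<sigma>[OF len] by force
    next
      fix vs assume "vs \<in> \<sigma> ` {vs. c vs \<noteq> \<zero> \<and> map f vs = ?A'}"
      then obtain us where us: "c us \<noteq> \<zero>" "map f us = ?A'" "vs = \<sigma> us" by auto
      then have len: "length us = length ?A" by (metis length_map length_append length_Cons)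
      have "map f vs = ?A" unfolding us(3) map\<sigma>[OF len] us(2) swap ..
      then show "vs \<in> {vs. c vs \<noteq> \<zero> \<and> map f vs = ?A}" using nz len us by auto
    qed
    have len: "length vs = length ?A" if "map f vs = ?A'" for vs
      using arg_cong[OF that, of length] by simp
    have inj: "inj_on \<sigma> {vs. c vs \<noteq> \<zero> \<and> map f vs = ?A'}"
      by (rule inj_on_inverseI[of _ \<sigma>]) (use \<sigma>\<sigma> len in auto)
    have "push (map f) c ?A = (\<Oplus>vs\<in>{vs. c vs \<noteq> \<zero> \<and> map f vs = ?A'}. c (\<sigma> vs))"
      unfolding push_def eq using c'(3) inj by (intro finsum_reindex) auto
    also have "\<dots> = (\<Oplus>vs\<in>{vs. c vs \<noteq> \<zero> \<and> map f vs = ?A'}. \<ominus> c vs)"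
      using c\<sigma> len c'(3) by (intro finsum_cong') auto
    also have "\<dots> = \<ominus> push (map f) c ?A'"
      unfolding push_def using c'(3) finsuppD(3)[OF c'(1)] by (intro finsum_minus) auto
    finally show "push (map f) c ?A = \<ominus> push (map f) c ?A'" .
  qed
  fix ws assume ws: "push (map f) c ws \<noteq> \<zero>"
  then obtain vs where vs: "c vs \<noteq> \<zero>" "map f vs = ws" by (rule push_nonzero)
  then show len: "length ws = n" using c'(4) by auto
  show "set ws \<in> E'" using vs E by auto
  show "distinct ws"
  proof (rule ccontr)
    assume "\<not> distinct ws"
    \<comment> \<open>If the image has equal entries at \<open>i\<close> and \<open>j\<close>,
      exchanging these positions stays in the fibre.\<close>
    then obtain i j where ij: "i < n" "j < n" "i \<noteq> j" "ws ! i = ws ! j"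
      unfolding distinct_conv_nth len by blast
    have t: "Transposition.transpose i j permutes {..<length us}" if "length us = n" for us :: "'z list"
      using ij that by (intro permutes_swap_id) auto
    have "permute_list (Transposition.transpose i j) ws = ws"
      using ij len by (intro nth_equalityI)
        (auto simp: permute_list_def Transposition.transpose_def)
    then have "push (map f) c ws = \<zero>"
      using permute_list_map[OF t, of _ f] by (intro push_repeated_zero[OF c ij(1-3)]) metis
    with ws show False by simp
  qed
qed

text \<open>The length \<open>Suc n\<close> keeps the empty list out of the support; because of
  \<open>tl [] = []\<close> it would lie in the fibre over itself without having a first
  vertex.\<close>

lemma bd_eq_push:
  assumes c: "chain (Suc n) E c"
  shows "bd c = push tl c"
proof
  fix ws
  note c' = chainD[OF c]
  have ne: "vs \<noteq> []" if "c vs \<noteq> \<zero>" for vs using c'(4)[OF that] by auto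
  have "{vs. c vs \<noteq> \<zero> \<and> tl vs = ws} = (\<lambda>v. v # ws) ` {v. c (v # ws) \<noteq> \<zero>}"
  proof (intro Set.set_eqI iffI)
    fix vs assume vs: "vs \<in> {vs. c vs \<noteq> \<zero> \<and> tl vs = ws}"
    then have "vs = hd vs # ws" using ne by auto
    then show "vs \<in> (\<lambda>v. v # ws) ` {v. c (v # ws) \<noteq> \<zero>}" using vs by (metis (mono_tags) imageI mem_Collect_eq)
  qed auto
  then have "push tl c ws = finsum G c ((\<lambda>v. v # ws) ` {v. c (v # ws) \<noteq> \<zero>})"
    by (simp add: push_def)
  also have "\<dots> = bd c ws"
    unfolding bd_def using c'(3) by (intro finsum_reindex) (auto simp: inj_on_def)
  finally show "bd c ws = push tl c ws" by simp
qed

lemma bd_chain_0: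
  assumes "chain 0 E c"
  shows "bd c = (\<lambda>_. \<zero>)"
proof
  fix ws
  have "{v. c (v # ws) \<noteq> \<zero>} = {}" using chainD(4)[OF assms] by fastforce
  then show "bd c ws = \<zero>" by (simp add: bd_def)
qed

lemma bd_nonzero:
  assumes "bd c ws \<noteq> \<zero>"
  obtains v where "c (v # ws) \<noteq> \<zero>"
  using assms unfolding bd_def by (metis (mono_tags, lifting) empty_Collect_eq finsum_empty)

lemma chain_bd:
  assumes c: "chain (Suc n) E c" and E: "\<And>v ws. c (v # ws) \<noteq> \<zero> \<Longrightarrow> set ws \<in> E'"
  shows "chain n E' (bd c)"
  unfolding chain_def
proof (intro conjI allI impI)
  note c' = chainD[OF c]
  show "finsupp (bd c)" unfolding bd_eq_push[OF c] by (rule finsupp_push) fact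
  show "alternating (bd c)"
    unfolding alternating_def
  proof (intro allI)
    fix xs ys x y
    have sw: "c (v # xs @ x # y # ys) = \<ominus> c (v # xs @ y # x # ys)" for v
      using c'(7)[of "v # xs" x y ys] by simp
    have fin: "finite {v. c (v # xs @ y # x # ys) \<noteq> \<zero>}"
      using finite_vimageI[OF finsuppD(2)[OF c'(1)], of "\<lambda>v. v # xs @ y # x # ys"]
      by (simp add: inj_def vimage_def)
    have iff: "c (v # xs @ x # y # ys) \<noteq> \<zero> \<longleftrightarrow> c (v # xs @ y # x # ys) \<noteq> \<zero>" for v
      using sw[of v] c'(3) a_inv_zero minus_minus by metis
    then have seteq: "{v. c (v # xs @ x # y # ys) \<noteq> \<zero>} = {v. c (v # xs @ y # x # ys) \<noteq> \<zero>}"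
      by blast
    have "bd c (xs @ x # y # ys) = (\<Oplus>v\<in>{v. c (v # xs @ y # x # ys) \<noteq> \<zero>}. \<ominus> c (v # xs @ y # x # ys))"
      unfolding bd_def seteq by (simp only: sw)
    also have "\<dots> = \<ominus> bd c (xs @ y # x # ys)"
      unfolding bd_def using fin c'(3) by (intro finsum_minus) auto
    finally show "bd c (xs @ x # y # ys) = \<ominus> bd c (xs @ y # x # ys)" .
  qed
  fix ws assume "bd c ws \<noteq> \<zero>"
  then obtain v where v: "c (v # ws) \<noteq> \<zero>" by (rule bd_nonzero)
  show "length ws = n" "distinct ws" "set ws \<in> E'"
    using c'(4)[OF v] c'(5)[OF v] E[OF v] by auto
qed

text \<open>\<open>tl\<close> commutes with \<open>map f\<close>; chains on the empty list are
  treated apart because \<open>bd_eq_push\<close> excludes them.\<close>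

lemma bd_push_map:
  fixes f :: "'v \<Rightarrow> 'w"
  assumes c: "chain n E c"
  shows "bd (push (map f) c) = push (map f) (bd c)"
proof -
  have fc: "chain n UNIV (push (map f) c)" by (rule chain_push_map[OF c]) simp
  show ?thesis
  proof (cases n)
    case 0
    have "push (map f) (\<lambda>_::'v list. \<zero>) = (\<lambda>_. \<zero>)" by (simp add: push_def fun_eq_iff)
    then show ?thesis
      using bd_chain_0[of E c] bd_chain_0[of UNIV "push (map f) c"] 0 c fc by simp
  next
    case (Suc m)
    have "bd (push (map f) c) = push tl (push (map f) c)"
      using bd_eq_push fc Suc by blast
    also have "\<dots> = push (\<lambda>x. tl (map f x)) c" by (rule push_push) (rule chainD[OF c])
    also have "\<dots> = push (\<lambda>x. map f (tl x)) c" by (simp add: map_tl)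
    also have "\<dots> = push (map f) (push tl c)" by (rule push_push[symmetric]) (rule chainD[OF c])
    also have "push tl c = bd c" using bd_eq_push c Suc by metis
    finally show ?thesis .
  qed
qed

text \<open>\<open>tl (tl vs)\<close> does not see an exchange of the first two vertices.\<close>

lemma bd_bd:
  fixes c :: "'v list \<Rightarrow> 'a"
  assumes c: "chain (Suc (Suc n)) E c"
  shows "bd (bd c) = (\<lambda>_. \<zero>)"
proof -
  have "chain (Suc n) UNIV (bd c)" by (rule chain_bd[OF c]) simp
  then have "bd (bd c) = push tl (push tl c)" using bd_eq_push c by metis
  also have "\<dots> = push (\<lambda>x. tl (tl x)) c" by (rule push_push) (rule chainD[OF c])
  also have "\<dots> = (\<lambda>_. \<zero>)"
  proof
    fix ws
    have "tl (tl (permute_list (Transposition.transpose 0 (Suc 0)) vs)) = tl (tl vs)" if vs: "length vs = Suc (Suc n)" for vs :: "'v list"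
    proof -
      have t: "Transposition.transpose 0 (Suc 0) permutes {..<length vs}"
        using vs by (intro permutes_swap_id) auto
      show ?thesis
        using vs by (intro nth_equalityI)
          (auto simp: nth_tl permute_list_nth[OF t] Transposition.transpose_def)
    qed
    then show "push (\<lambda>x. tl (tl x)) c ws = \<zero>"
      by (intro push_repeated_zero[OF c, of 0 "Suc 0"]) auto
  qed
  finally show ?thesis .
qed

end

section \<open>Joins and contiguous maps\<close>

context abelian_group
begin

text \<open>The chain \<open>cone a c\<close> is the join of \<open>c\<close> with the vertex \<open>a\<close>, that is \<open>[vs] \<mapsto> [a, vs]\<close>.\<close>

primrec cone_at :: "'v \<Rightarrow> 'v list \<Rightarrow> ('v list \<Rightarrow> 'a) \<Rightarrow> 'a" where
  "cone_at a [] c = \<zero>"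
| "cone_at a (w # ws) c = (if w = a then (if a \<in> set ws then \<zero> else c ws)
     else \<ominus> cone_at a ws (\<lambda>vs. c (w # vs)))"

definition cone :: "'v \<Rightarrow> ('v list \<Rightarrow> 'a) \<Rightarrow> 'v list \<Rightarrow> 'a" where
  "cone a c ws = cone_at a ws c"

section \<open>Links and joins\<close>

lemma alternating_link:
  assumes "alternating c"
  shows "alternating (\<lambda>vs. c (v # vs))"
  unfolding alternating_def
proof (intro allI)
  show "c (v # xs @ x # y # ys) = \<ominus> c (v # xs @ y # x # ys)" for xs x y ys
    using assms[unfolded alternating_def, rule_format, of "v # xs" x y ys] by (simp only: append_Cons)
qed

lemma cone_Nil: "cone a c [] = \<zero>"
  by (simp add: cone_def)

text \<open>The minus sign accounts for moving \<open>a\<close> to the front past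
  \<open>w\<close>.\<close>

lemma cone_Cons: "cone a c (w # ws) = (if w = a then (if a \<in> set ws then \<zero> else c ws)
     else \<ominus> cone_at a ws (\<lambda>vs. c (w # vs)))"
  by (simp add: cone_def)

lemma cone_at_closed: "(\<And>vs. c vs \<in> carrier G) \<Longrightarrow> cone_at a ws c \<in> carrier G"
  by (induction ws arbitrary: c) auto

lemma cone_at_notin: "a \<notin> set ws \<Longrightarrow> cone_at a ws c = \<zero>"
  by (induction ws arbitrary: c) (auto simp: a_inv_zero)

lemma cone_at_nonzero':
  "cone_at a ws c \<noteq> \<zero> \<Longrightarrow>
    \<exists>xs ys. ws = xs @ a # ys \<and> a \<notin> set xs \<and> a \<notin> set ys \<and> c (xs @ ys) \<noteq> \<zero>"
proof (induction ws arbitrary: c)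
  case (Cons w ws)
  show ?case
  proof (cases "w = a")
    case True
    then have "a \<notin> set ws \<and> c ws \<noteq> \<zero>" using Cons.prems by (simp split: if_splits)
    then show ?thesis using True by (intro exI[of _ "[]"] exI[of _ ws]) simp
  next
    case False
    then have "cone_at a ws (\<lambda>vs. c (w # vs)) \<noteq> \<zero>"
      using Cons.prems a_inv_zero by (metis cone_at.simps(2))
    from Cons.IH[OF this] obtain xs ys
      where "ws = xs @ a # ys" "a \<notin> set xs" "a \<notin> set ys" "c (w # xs @ ys) \<noteq> \<zero>" by (elim exE conjE)
    then show ?thesis using False by (intro exI[of _ "w # xs"] exI[of _ ys]) simp
  qed
qed simp

lemma cone_at_nonzero:
  assumes "cone_at a ws c \<noteq> \<zero>"
  obtains xs ys where "ws = xs @ a # ys" "a \<notin> set xs" "a \<notin> set ys" "c (xs @ ys) \<noteq> \<zero>"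
  using cone_at_nonzero'[OF assms] by (elim exE conjE)

lemma cone_at_uminus:
  "(\<And>vs. c vs \<in> carrier G) \<Longrightarrow> cone_at a ws (\<lambda>vs. \<ominus> c vs) = \<ominus> cone_at a ws c"
  by (induction ws arbitrary: c) (auto simp: a_inv_zero)

lemma cone_at_finsum:
  assumes "finite V" "\<And>v vs. h v vs \<in> carrier G"
  shows "cone_at a ws (\<lambda>vs. \<Oplus>v\<in>V. h v vs) = (\<Oplus>v\<in>V. cone_at a ws (h v))"
  using assms(2)
proof (induction ws arbitrary: h)
  case (Cons w ws)
  have "(\<Oplus>v\<in>V. \<ominus> cone_at a ws (\<lambda>vs. h v (w # vs))) = \<ominus> (\<Oplus>v\<in>V. cone_at a ws (\<lambda>vs. h v (w # vs)))"
    using assms(1) Cons.prems by (intro finsum_minus cone_at_closed) auto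
  then show ?case using Cons.IH[of "\<lambda>v vs. h v (w # vs)"] Cons.prems by simp
qed simp

text \<open>Joining \<open>a\<close> with its link recovers \<open>c\<close> on lists through
  \<open>a\<close>: bringing \<open>a\<close> to the front costs the same sign in \<open>c\<close>
  as in \<open>cone_at\<close>.\<close>

lemma cone_at_link:
  assumes "alternating c" "\<And>vs. c vs \<in> carrier G" "distinct ws" "a \<in> set ws"
  shows "cone_at a ws (\<lambda>vs. c (a # vs)) = c ws"
  using assms
proof (induction ws arbitrary: c)
  case (Cons w ws)
  show ?case
  proof (cases "w = a")
    case True
    then show ?thesis using Cons.prems by auto
  next
    case False
    have sw: "c (a # w # vs) = \<ominus> c (w # a # vs)" for vs
      using Cons.prems(1)[unfolded alternating_def, rule_format, of "[]" a w vs] by (simp only: append_Nil)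
    have alt: "alternating (\<lambda>vs. c (w # vs))" by (rule alternating_link) fact
    have "cone_at a (w # ws) (\<lambda>vs. c (a # vs)) = \<ominus> cone_at a ws (\<lambda>vs. \<ominus> c (w # a # vs))"
      using False by (simp add: sw)
    also have "\<dots> = \<ominus> (\<ominus> cone_at a ws (\<lambda>vs. c (w # a # vs)))"
      using Cons.prems(2) by (subst cone_at_uminus) auto
    also have "\<dots> = cone_at a ws (\<lambda>vs. c (w # a # vs))"
      using Cons.prems(2) by (intro minus_minus cone_at_closed) auto
    also have "\<dots> = c (w # ws)"
      using Cons.IH[OF alt] Cons.prems False by simp
    finally show ?thesis .
  qed
qed simp

lemma alternating_cone:
  assumes "alternating c" "\<And>vs. c vs \<in> carrier G"
  shows "alternating (cone a c)"
  unfolding alternating_def cone_def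
proof (intro allI)
  fix xs x y ys
  show "cone_at a (xs @ x # y # ys) c = \<ominus> cone_at a (xs @ y # x # ys) c"
    using assms
  proof (induction xs arbitrary: c)
    case Nil
    have "c (x # y # vs) = \<ominus> c (y # x # vs)" for vs
      using Nil(1)[unfolded alternating_def, rule_format, of "[]" x y vs] by (simp only: append_Nil)
    then have "(\<lambda>vs. c (x # y # vs)) = (\<lambda>vs. \<ominus> c (y # x # vs))" by blast
    then have "cone_at a ys (\<lambda>vs. c (x # y # vs)) = \<ominus> cone_at a ys (\<lambda>vs. c (y # x # vs))"
      using cone_at_uminus[of "\<lambda>vs. c (y # x # vs)"] Nil(2) by simp
    moreover have "cone_at a ys (\<lambda>vs. c (y # x # vs)) \<in> carrier G"
      using Nil(2) by (intro cone_at_closed)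
    \<comment> \<open>When neither entry is \<open>a\<close>, the two signs of
      \<open>cone_at\<close> cancel and the exchange is left to \<open>c\<close>.\<close>
    ultimately have xy: ?case if "x \<noteq> a" "y \<noteq> a" using that by simp
    show ?case
    proof (cases "x = a")
      case True
      then show ?thesis using Nil(2) by (cases "y = a") (auto simp: minus_minus a_inv_zero)
    next
      case False
      show ?thesis
      proof (cases "y = a")
        case True
        then show ?thesis using False Nil(2) by (simp add: minus_minus a_inv_zero)
      qed (rule xy[OF False])
    qed
  next
    case (Cons w xs)
    have alt: "alternating (\<lambda>vs. c (w # vs))" by (rule alternating_link) fact
    have "c (xs @ x # y # ys) = \<ominus> c (xs @ y # x # ys)"
      using Cons.prems(1) unfolding alternating_def by blast
    then show ?case using Cons.IH[OF alt] Cons.prems(2) by (simp add: a_inv_zero)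
  qed
qed

lemma chain_cone:
  assumes c: "chain n E c" and E: "\<And>vs. c vs \<noteq> \<zero> \<Longrightarrow> insert a (set vs) \<in> E'"
  shows "chain (Suc n) E' (cone a c)"
  unfolding chain_def
proof (intro conjI allI impI)
  note c' = chainD[OF c]
  show "finsupp (cone a c)"
  proof (rule finsuppI)
    show "cone a c x \<in> carrier G" for x unfolding cone_def using c' by (intro cone_at_closed)
    \<comment> \<open>All insertions of \<open>a\<close> into lists of the support.\<close>
    let ?A = "(\<lambda>(vs, i). take i vs @ a # drop i vs) ` ({vs. c vs \<noteq> \<zero>} \<times> {..n})"
    show "finite ?A" using finsuppD(2)[OF c'(1)] by simp
    fix ws assume "cone a c ws \<noteq> \<zero>"
    then obtain xs ys where "ws = xs @ a # ys" "c (xs @ ys) \<noteq> \<zero>"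
      unfolding cone_def by (rule cone_at_nonzero)
    then show "ws \<in> ?A" using c'(4)[of "xs @ ys"]
      by (intro rev_image_eqI[of "(xs @ ys, length xs)"]) auto
  qed
  show "alternating (cone a c)" using c' by (intro alternating_cone)
  fix ws assume "cone a c ws \<noteq> \<zero>"
  then obtain xs ys where ws: "ws = xs @ a # ys" "a \<notin> set xs" "a \<notin> set ys" "c (xs @ ys) \<noteq> \<zero>"
    unfolding cone_def by (rule cone_at_nonzero)
  show "length ws = Suc n" "distinct ws" "set ws \<in> E'"
    using c'(4)[OF ws(4)] c'(5)[OF ws(4)] E[OF ws(4)] ws by auto
qed

lemma chain_link:
  assumes c: "chain n E c"
  shows "chain (n - 1) UNIV (\<lambda>vs. c (v # vs))"
  unfolding chain_def
proof (intro conjI allI impI)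
  note c' = chainD[OF c]
  show "finsupp (\<lambda>vs. c (v # vs))"
  proof (rule finsuppI)
    show "finite (tl ` {vs. c vs \<noteq> \<zero>})" using finsuppD(2)[OF c'(1)] by simp
    show "c (v # vs) \<noteq> \<zero> \<Longrightarrow> vs \<in> tl ` {vs. c vs \<noteq> \<zero>}" for vs
      by (intro rev_image_eqI[of "v # vs"]) auto
  qed (rule c')
  show "alternating (\<lambda>vs. c (v # vs))" by (rule alternating_link) fact
  fix vs assume "c (v # vs) \<noteq> \<zero>"
  from c'(4)[OF this] c'(5)[OF this] show "length vs = n - 1" "distinct vs" by auto
qed simp

definition vertices :: "('v list \<Rightarrow> 'a) \<Rightarrow> 'v set" where
  "vertices c = (\<Union>vs\<in>{vs. c vs \<noteq> \<zero>}. set vs)"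

lemma finite_vertices: "chain n E c \<Longrightarrow> finite (vertices c)"
  unfolding vertices_def by (drule chainD(1), drule finsuppD(2)) simp

lemma in_vertices: "c vs \<noteq> \<zero> \<Longrightarrow> v \<in> set vs \<Longrightarrow> v \<in> vertices c"
  unfolding vertices_def by (rule UN_I[of vs]) simp_all

lemma cone_head:
  assumes "cone a c (v # ws) \<noteq> \<zero>"
  shows "v \<in> insert a (vertices c)"
proof -
  obtain xs ys where *: "v # ws = xs @ a # ys" "c (xs @ ys) \<noteq> \<zero>"
    using assms unfolding cone_def by (rule cone_at_nonzero)
  show ?thesis
  proof (cases xs)
    case (Cons x xs')
    then show ?thesis using in_vertices[of c "xs @ ys" v] * by simp
  qed (use *(1) in simp)
qed

text \<open>Both boundaries expand into sums over a finite set of vertices \<open>v\<close>, in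
  which the terms with \<open>v \<noteq> a\<close> agree. The term with \<open>v = a\<close>
  supplies \<open>c ws\<close> on the left if \<open>a\<close> is not in \<open>ws\<close>; if it
  is, that term cancels \<open>c ws\<close> on the right.\<close>

lemma bd_cone:
  assumes c: "chain n E c"
  shows "bd (cone a c) ws = c ws \<ominus> cone a (bd c) ws"
proof -
  note c' = chainD[OF c]
  define V where "V = insert a (vertices c)"
  have V: "finite V" "a \<in> V" using finite_vertices[OF c] by (auto simp: V_def)
  have cV: "v \<in> V" if "c (v # vs) \<noteq> \<zero>" for v vs
    unfolding V_def by (rule insertI2, rule in_vertices[of c, OF that]) simp
  have bdV: "bd c = (\<lambda>vs. \<Oplus>v\<in>V. c (v # vs))"
    using bd_superset[OF c V(1)] cV by blast
  have ch: "chain (Suc n) UNIV (cone a c)" by (rule chain_cone[OF c]) simp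
  have coneV: "cone a c (v # ws) \<noteq> \<zero> \<Longrightarrow> v \<in> V" for v
    unfolding V_def by (rule cone_head)
  let ?l = "\<lambda>v. cone_at a ws (\<lambda>vs. c (v # vs))"
  have l: "?l v \<in> carrier G" for v using c' by (intro cone_at_closed)
  have "bd (cone a c) ws = (\<Oplus>v\<in>V. cone a c (v # ws))"
    using bd_superset[OF ch V(1)] coneV by blast
  also have "\<dots> = cone a c (a # ws) \<oplus> (\<Oplus>v\<in>V - {a}. cone a c (v # ws))"
    using V finsum_insert[of "V - {a}" a "\<lambda>v. cone a c (v # ws)"] chainD(3)[OF ch]
    by (simp add: insert_absorb)
  also have "(\<Oplus>v\<in>V - {a}. cone a c (v # ws)) = (\<Oplus>v\<in>V - {a}. \<ominus> ?l v)"
    using l by (intro finsum_cong') (auto simp: cone_def)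
  also have "\<dots> = \<ominus> (\<Oplus>v\<in>V - {a}. ?l v)"
    using V l by (intro finsum_minus) auto
  finally have 1: "bd (cone a c) ws = cone a c (a # ws) \<ominus> (\<Oplus>v\<in>V - {a}. ?l v)"
    by (simp add: a_minus_def)
  have "cone a (bd c) ws = (\<Oplus>v\<in>V. ?l v)"
    unfolding cone_def bdV using V c' by (intro cone_at_finsum) auto
  also have "\<dots> = ?l a \<oplus> (\<Oplus>v\<in>V - {a}. ?l v)"
    using V finsum_insert[of "V - {a}" a ?l] l by (simp add: insert_absorb)
  finally have 2: "cone a (bd c) ws = ?l a \<oplus> (\<Oplus>v\<in>V - {a}. ?l v)" .
  have S: "(\<Oplus>v\<in>V - {a}. ?l v) \<in> carrier G" by (rule finsum_closed) (simp add: Pi_def l)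
  show ?thesis
  proof (cases "a \<in> set ws")
    case True
    \<comment> \<open>On a list with a repetition both sides vanish.\<close>
    have "?l a = c ws"
    proof (cases "distinct ws")
      case True
      then show ?thesis using c' \<open>a \<in> set ws\<close> by (intro cone_at_link)
    next
      case False
      have "?l a = \<zero>"
      proof (rule ccontr)
        assume "?l a \<noteq> \<zero>"
        then obtain xs ys where "ws = xs @ a # ys" "a \<notin> set xs" "a \<notin> set ys" "c (a # xs @ ys) \<noteq> \<zero>"
          by (rule cone_at_nonzero)
        then show False using False c'(5)[of "a # xs @ ys"] by auto
      qed
      then show ?thesis using False c'(5)[of ws] by (cases "c ws = \<zero>") simp_all
    qed
    then have "c ws \<ominus> cone a (bd c) ws = c ws \<ominus> (c ws \<oplus> (\<Oplus>v\<in>V - {a}. ?l v))"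
      using 2 by simp
    also have "\<dots> = \<ominus> (\<Oplus>v\<in>V - {a}. ?l v)"
      using S c'(3)[of ws] by (simp add: a_minus_def minus_add r_neg2)
    finally show ?thesis using 1 True S by (simp add: cone_def a_minus_def)
  next
    case False
    then show ?thesis using 1 2 S by (simp add: cone_def cone_at_notin)
  qed
qed

text \<open>Sorting the lists over \<open>w # ws\<close> by their first vertex turns a push of
  \<open>c\<close> into pushes of its links; this drives the induction in
  \<open>push_map_cone\<close>.\<close>

lemma push_map_Cons:
  assumes c: "chain n E c" and V: "finite V" "\<And>v vs. c (v # vs) \<noteq> \<zero> \<Longrightarrow> v \<in> V"
  shows "push (map f) c (w # ws) = (\<Oplus>v\<in>{v \<in> V. f v = w}. push (map f) (\<lambda>vs. c (v # vs)) ws)"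
proof -
  note c' = chainD[OF c]
  let ?A = "\<lambda>v. {vs. c (v # vs) \<noteq> \<zero> \<and> map f vs = ws}"
  have fin: "finite (?A v)" for v
  proof (rule rev_finite_subset)
    have "finsupp (\<lambda>vs. c (v # vs))" by (rule chainD(1)[OF chain_link[OF c]])
    then show "finite {vs. c (v # vs) \<noteq> \<zero>}" by (rule finsuppD(2))
  qed auto
  have eq: "{vs. c vs \<noteq> \<zero> \<and> map f vs = w # ws} = (\<Union>v\<in>{v \<in> V. f v = w}. (\<lambda>vs. v # vs) ` ?A v)"
    (is "?L = ?R")
  proof
    show "?L \<subseteq> ?R"
    proof
      fix us assume us: "us \<in> ?L"
      then have "c us \<noteq> \<zero>" "map f us = w # ws" by simp_all
      then obtain v vs where *: "us = v # vs" "f v = w" "map f vs = ws" by (cases us) simp_all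
      then have "c (v # vs) \<noteq> \<zero>" using \<open>c us \<noteq> \<zero>\<close> by simp
      then show "us \<in> ?R" using V(2)[of v vs] * by (intro UN_I[of v] image_eqI[of _ _ vs]) simp_all
    qed
    show "?R \<subseteq> ?L" by (intro UN_least image_subsetI) simp
  qed
  have "push (map f) c (w # ws) = (\<Oplus>v\<in>{v \<in> V. f v = w}. finsum G c ((\<lambda>vs. v # vs) ` ?A v))"
    unfolding push_def eq
  proof (rule finsum_fiberwise)
    show "finite {v \<in> V. f v = w}" using V(1) by simp
    show "finite ((\<lambda>vs. v # vs) ` ?A v)" for v using fin by simp
    show "i = j" if "x \<in> (\<lambda>vs. i # vs) ` ?A i" "x \<in> (\<lambda>vs. j # vs) ` ?A j" for i j x
      using that by (elim imageE) simp
  qed (rule c'(3))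
  also have "\<dots> = (\<Oplus>v\<in>{v \<in> V. f v = w}. push (map f) (\<lambda>vs. c (v # vs)) ws)"
  proof (intro finsum_cong')
    fix v
    have "finsum G c ((\<lambda>vs. v # vs) ` ?A v) = finsum G (\<lambda>vs. c (v # vs)) (?A v)"
      using c'(3) by (intro finsum_reindex) (auto simp: inj_on_def)
    then show "finsum G c ((\<lambda>vs. v # vs) ` ?A v) = push (map f) (\<lambda>vs. c (v # vs)) ws"
      by (simp add: push_def)
  qed (simp_all add: push_def c'(3) Pi_def)
  finally show ?thesis .
qed

text \<open>Induction on \<open>ws\<close>, with the links of the first vertices in place of
  \<open>c\<close>. The delicate point is that vertices other than \<open>a\<close> may also be
  mapped to \<open>f a\<close>.\<close>

lemma push_map_cone:
  assumes "chain n UNIV c" "\<And>vs. c vs \<noteq> \<zero> \<Longrightarrow> a \<notin> set vs"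
  shows "push (map f) (cone a c) ws = cone (f a) (push (map f) c) ws"
  using assms
proof (induction ws arbitrary: n c)
  case Nil
  have "push (map f) (cone a c) [] = \<zero>"
  proof (rule ccontr)
    assume "push (map f) (cone a c) [] \<noteq> \<zero>"
    then obtain vs where "cone a c vs \<noteq> \<zero>" "map f vs = []" by (rule push_nonzero)
    then show False by (simp add: cone_Nil)
  qed
  then show ?case by (simp add: cone_Nil)
next
  case (Cons w ws)
  note c' = chainD[OF Cons.prems(1)]
  have ch: "chain (Suc n) UNIV (cone a c)" by (rule chain_cone[OF Cons.prems(1)]) simp
  define V where "V = insert a (vertices c)"
  have V: "finite V" "a \<in> V" using finite_vertices[OF Cons.prems(1)] by (auto simp: V_def)
  have cV: "v \<in> V" if "c (v # vs) \<noteq> \<zero>" for v vs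
    unfolding V_def by (rule insertI2, rule in_vertices[of c, OF that]) simp
  have coneV: "cone a c (v # vs) \<noteq> \<zero> \<Longrightarrow> v \<in> V" for v vs
    unfolding V_def by (rule cone_head)
  let ?l = "\<lambda>v vs. c (v # vs)"
  let ?q = "\<lambda>v. push (map f) (?l v)"
  have link: "chain (n - 1) UNIV (?l v)" for v by (rule chain_link[OF Cons.prems(1)])
  have q: "?q v us \<in> carrier G" for v us
    by (rule finsuppD(1)[OF finsupp_push[OF chainD(1)[OF link]]])
  have cq: "cone_at b us (?q v) \<in> carrier G" for b us v using q by (intro cone_at_closed)
  have link_cone_a: "(\<lambda>vs. cone a c (a # vs)) = c"
  proof
    show "cone a c (a # vs) = c vs" for vs
      using Cons.prems(2)[of vs] by (cases "c vs = \<zero>") (simp_all add: cone_Cons)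
  qed
  have step: "push (map f) (\<lambda>vs. cone a c (v # vs)) ws = \<ominus> cone_at (f a) ws (?q v)" if "v \<noteq> a" for v
  proof -
    have "(\<lambda>vs. cone a c (v # vs)) = (\<lambda>vs. \<ominus> cone a (?l v) vs)"
      using that by (rule_tac ext) (simp add: cone_def)
    moreover have "finsupp (cone a (?l v))"
      by (rule chainD(1)[OF chain_cone[OF link, where E' = UNIV]]) simp
    ultimately have "push (map f) (\<lambda>vs. cone a c (v # vs)) ws = \<ominus> push (map f) (cone a (?l v)) ws"
      by (simp add: push_uminus)
    also have "push (map f) (cone a (?l v)) ws = cone (f a) (?q v) ws"
      by (rule Cons.IH[OF link]) (use Cons.prems(2)[of "v # _"] in simp)
    finally show ?thesis by (simp add: cone_def)
  qed
  have lhs: "push (map f) (cone a c) (w # ws) =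
      (\<Oplus>v\<in>{v \<in> V. f v = w}. push (map f) (\<lambda>vs. cone a c (v # vs)) ws)"
    by (rule push_map_Cons[OF ch V(1) coneV])
  show ?case
  proof (cases "w = f a")
    case False
    have "push (map f) (cone a c) (w # ws) = (\<Oplus>v\<in>{v \<in> V. f v = w}. \<ominus> cone_at (f a) ws (?q v))"
      unfolding lhs
    proof (intro finsum_cong' refl)
      fix v assume "v \<in> {v \<in> V. f v = w}"
      then have "v \<noteq> a" using False by auto
      then show "push (map f) (\<lambda>vs. cone a c (v # vs)) ws = \<ominus> cone_at (f a) ws (?q v)" by (rule step)
    qed (simp add: cq Pi_def)
    also have "\<dots> = \<ominus> (\<Oplus>v\<in>{v \<in> V. f v = w}. cone_at (f a) ws (?q v))"
      by (rule finsum_minus) (simp_all add: V cq)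
    also have "(\<Oplus>v\<in>{v \<in> V. f v = w}. cone_at (f a) ws (?q v)) =
        cone_at (f a) ws (\<lambda>us. \<Oplus>v\<in>{v \<in> V. f v = w}. ?q v us)"
      by (rule cone_at_finsum[symmetric]) (simp_all add: V q)
    also have "(\<lambda>us. \<Oplus>v\<in>{v \<in> V. f v = w}. ?q v us) = (\<lambda>us. push (map f) c (w # us))"
      by (rule ext, rule push_map_Cons[symmetric, OF Cons.prems(1) V(1)], erule cV)
    finally show ?thesis using False by (simp add: cone_Cons)
  next
    case True
    show ?thesis
    proof (cases "f a \<in> set ws")
      \<comment> \<open>The list \<open>w # ws\<close> repeats \<open>f a\<close>, and both sides
        are zero there.\<close>
      case mem: True
      have "chain (Suc n) UNIV (push (map f) (cone a c))" by (rule chain_push_map[OF ch]) simp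
      from chainD(5)[OF this, of "w # ws"] have "push (map f) (cone a c) (w # ws) = \<zero>"
        using mem True by (cases "push (map f) (cone a c) (w # ws) = \<zero>") simp_all
      then show ?thesis using mem True by (simp add: cone_Cons)
    next
      \<comment> \<open>Only \<open>v = a\<close> contributes: any other preimage of
        \<open>f a\<close> leaves a join with \<open>f a\<close>, evaluated on a list without
        \<open>f a\<close>.\<close>
      case nmem: False
      let ?V' = "{v \<in> V. f v = w} - {a}"
      have car: "push (map f) (\<lambda>vs. cone a c (v # vs)) ws \<in> carrier G" for v
        by (rule finsuppD(1)[OF finsupp_push[OF chainD(1)[OF chain_link[OF ch]]]])
      let ?h = "\<lambda>v. push (map f) (\<lambda>vs. cone a c (v # vs)) ws"
      have "{v \<in> V. f v = w} = insert a ?V'" using V(2) True by auto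
      then have "push (map f) (cone a c) (w # ws) = finsum G ?h (insert a ?V')"
        unfolding lhs by (rule arg_cong)
      also have "\<dots> = ?h a \<oplus> finsum G ?h ?V'"
        by (rule finsum_insert) (use V(1) car in auto)
      also have "(\<Oplus>v\<in>?V'. push (map f) (\<lambda>vs. cone a c (v # vs)) ws) = (\<Oplus>v\<in>?V'. \<zero>)"
      proof (intro finsum_cong' refl)
        fix v assume "v \<in> ?V'"
        then have "?h v = \<ominus> cone_at (f a) ws (?q v)" by (intro step) simp
        then show "?h v = \<zero>" by (simp only: cone_at_notin[OF nmem] a_inv_zero)
      qed simp
      also have "\<dots> = \<zero>" by simp
      finally have "push (map f) (cone a c) (w # ws) = push (map f) c ws \<oplus> \<zero>"
        unfolding link_cone_a .
      moreover have "push (map f) c ws \<in> carrier G"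
        by (rule finsuppD(1)[OF finsupp_push[OF c'(1)]])
      ultimately show ?thesis using True nmem by (simp add: cone_Cons)
    qed
  qed
qed

section \<open>Homology of contiguous maps\<close>

lemma add_diff_eq:
  assumes "x \<in> carrier G" "y \<in> carrier G"
  shows "y \<oplus> (x \<oplus> \<ominus> y) = x"
  using a_lcomm[of y x "\<ominus> y"] assms by (simp add: r_neg)

lemma diff_add_diff:
  assumes "x \<in> carrier G" "y \<in> carrier G" "w \<in> carrier G"
  shows "(x \<ominus> y) \<oplus> (w \<ominus> x) = w \<ominus> y"
proof -
  have "(x \<ominus> y) \<oplus> (w \<ominus> x) = (w \<ominus> y) \<oplus> (x \<oplus> \<ominus> x)"
    using assms by (simp add: a_minus_def a_ac)
  then show ?thesis using assms by (simp add: r_neg)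
qed

lemma chain_zero: "chain n E (\<lambda>_. \<zero>)"
  by (simp add: chain_def finsupp_def alternating_def a_inv_zero image_subset_iff)

lemma chain_add:
  assumes c: "chain n E c" and d: "chain n E d"
  shows "chain n E (\<lambda>vs. c vs \<oplus> d vs)"
  unfolding chain_def
proof (intro conjI allI impI)
  note c' = chainD[OF c] and d' = chainD[OF d]
  show "finsupp (\<lambda>vs. c vs \<oplus> d vs)" by (rule finsupp_add[OF c'(1) d'(1)])
  show "alternating (\<lambda>vs. c vs \<oplus> d vs)"
    unfolding alternating_def
  proof (intro allI)
    fix xs x y ys
    show "c (xs @ x # y # ys) \<oplus> d (xs @ x # y # ys) = \<ominus> (c (xs @ y # x # ys) \<oplus> d (xs @ y # x # ys))"
      using c'(3) d'(3) by (simp only: c'(7)[of xs x y ys] d'(7)[of xs x y ys] minus_add)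
  qed
  fix vs assume "c vs \<oplus> d vs \<noteq> \<zero>"
  then have "c vs \<noteq> \<zero> \<or> d vs \<noteq> \<zero>" by auto
  then show "length vs = n" "distinct vs" "set vs \<in> E"
    using c'(4-6)[of vs] d'(4-6)[of vs] by auto
qed

lemma bd_add:
  assumes c: "chain (Suc n) E c" and d: "chain (Suc n) E d"
  shows "bd (\<lambda>vs. c vs \<oplus> d vs) = (\<lambda>vs. bd c vs \<oplus> bd d vs)"
  unfolding bd_eq_push[OF c] bd_eq_push[OF d] bd_eq_push[OF chain_add[OF c d]]
  by (rule push_add[OF chainD(1)[OF c] chainD(1)[OF d]])

lemma bd_zero: "bd (\<lambda>_. \<zero>) = (\<lambda>_. \<zero>)"
  by (simp add: bd_def fun_eq_iff)

lemma push_zero: "push \<phi> (\<lambda>_. \<zero>) = (\<lambda>_. \<zero>)"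
  by (simp add: push_def fun_eq_iff)

lemma cone_zero: "cone a (\<lambda>_. \<zero>) ws = \<zero>"
  unfolding cone_def by (induction ws) (simp_all add: a_inv_zero)

text \<open>Exchanging the first two vertices shows that the boundary of the link at
  \<open>ws\<close> is minus \<open>bd z\<close> at \<open>u # ws\<close>. For \<open>n = 0\<close>
  the link lives on the empty list and has boundary zero.\<close>

lemma bd_link:
  assumes z: "chain (Suc n) E z" and cyc: "n = 0 \<or> bd z = (\<lambda>_. \<zero>)"
  shows "bd (\<lambda>vs. z (u # vs)) = (\<lambda>_. \<zero>)"
proof (cases "n = 0")
  case True
  have "chain 0 UNIV (\<lambda>vs. z (u # vs))" using chain_link[OF z, of u] True by simp
  then show ?thesis by (rule bd_chain_0)
next
  case False
  note z' = chainD[OF z]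
  show ?thesis
  proof
    fix ws
    define V where "V = vertices z"
    have V: "finite V" unfolding V_def by (rule finite_vertices[OF z])
    have memV: "v \<in> V" if "z vs \<noteq> \<zero>" "v \<in> set vs" for v vs
      unfolding V_def by (rule in_vertices[of z, OF that])
    have sw: "z (u # v # ws) = \<ominus> z (v # u # ws)" for v
      using z'(7)[of "[]" u v ws] by (simp only: append_Nil)
    have "bd (\<lambda>vs. z (u # vs)) ws = (\<Oplus>v\<in>V. z (u # v # ws))"
      by (rule bd_superset[OF chain_link[OF z] V], erule memV) simp
    also have "\<dots> = (\<Oplus>v\<in>V. \<ominus> z (v # u # ws))" by (simp only: sw)
    also have "\<dots> = \<ominus> (\<Oplus>v\<in>V. z (v # u # ws))"
      by (rule finsum_minus[OF V]) (rule z')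
    also have "(\<Oplus>v\<in>V. z (v # u # ws)) = bd z (u # ws)"
      by (rule bd_superset[symmetric, OF z V], erule memV) simp
    finally show "bd (\<lambda>vs. z (u # vs)) ws = \<zero>" using cyc False by (simp add: a_inv_zero)
  qed
qed

text \<open>If \<open>f\<close> and \<open>g\<close> differ only at \<open>u\<close> and \<open>L\<close> is the link of \<open>u\<close> in the cycle \<open>z\<close>, then the join
  of \<open>f u\<close>, \<open>g u\<close> and the image of \<open>L\<close> bounds the difference of the two images of \<open>z\<close>.\<close>

lemma homologous_update_vertex:
  fixes f g :: "'v \<Rightarrow> 'w"
  assumes z: "chain (Suc n) E z" and cyc: "n = 0 \<or> bd z = (\<lambda>_. \<zero>)"
    and fg: "\<And>v. v \<noteq> u \<Longrightarrow> f v = g v"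
    and E: "\<And>vs. z vs \<noteq> \<zero> \<Longrightarrow> f ` set vs \<union> g ` set vs \<in> E'"
  shows "\<exists>B. chain (Suc (Suc n)) E' B \<and>
    (\<forall>ws. bd B ws = push (map g) z ws \<ominus> push (map f) z ws)"
proof -
  note z' = chainD[OF z]
  define L where "L = (\<lambda>vs. z (u # vs))"
  have L: "chain n UNIV L" using chain_link[OF z, of u] by (simp add: L_def)
  have uL: "u \<notin> set vs" if "L vs \<noteq> \<zero>" for vs
    using z'(5)[of "u # vs"] that by (simp add: L_def)
  have bdL: "bd L = (\<lambda>_. \<zero>)" unfolding L_def by (rule bd_link[OF z cyc])
  define p where "p = push (map f) L"
  have mapL: "map f vs = map g vs" if "L vs \<noteq> \<zero>" for vs
  proof (rule map_cong[OF refl])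
    fix v assume "v \<in> set vs"
    with uL[OF that] have "v \<noteq> u" by auto
    then show "f v = g v" by (rule fg)
  qed
  have pg: "p = push (map g) L" unfolding p_def by (rule push_cong) (rule mapL)
  have p: "chain n UNIV p" unfolding p_def by (rule chain_push_map[OF L]) simp
  have bdp: "bd p = (\<lambda>_. \<zero>)" unfolding p_def bd_push_map[OF L] bdL by (rule push_zero)
  \<comment> \<open>\<open>p\<close> is the common image of the link under \<open>f\<close> and
    \<open>g\<close> and is a cycle, so its join with \<open>g u\<close> has boundary
    \<open>p\<close>.\<close>
  define C where "C = cone (g u) p"
  have C: "chain (Suc n) UNIV C" unfolding C_def by (rule chain_cone[OF p]) simp
  have bdC: "bd C = p"
  proof
    show "bd C ws = p ws" for ws
      unfolding C_def bd_cone[OF p] bdp cone_zero using chainD(3)[OF p] by (simp add: a_minus_def a_inv_zero)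
  qed
  \<comment> \<open>The star of \<open>u\<close> in \<open>z\<close>; its images under
    \<open>f\<close> and \<open>g\<close> are the joins of \<open>p\<close> with \<open>f u\<close>
    and \<open>g u\<close>.\<close>
  define D where "D = cone u L"
  have D: "chain (Suc n) UNIV D" unfolding D_def by (rule chain_cone[OF L]) simp
  note D' = chainD[OF D]
  have CD: "C ws = push (map g) D ws" for ws
    unfolding C_def D_def pg by (rule push_map_cone[symmetric, OF L uL])
  have FD: "cone (f u) p ws = push (map f) D ws" for ws
    unfolding D_def p_def by (rule push_map_cone[symmetric, OF L uL])
  have B: "chain (Suc (Suc n)) E' (cone (f u) C)"
  proof (rule chain_cone[OF C])
    \<comment> \<open>The vertices of a new simplex are \<open>f u\<close>, \<open>g u\<close> and
      the image of a simplex \<open>us\<close> of the link: the union of the two images of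
      \<open>u # us\<close>.\<close>
    fix vs assume "C vs \<noteq> \<zero>"
    then obtain xs ys where vs: "vs = xs @ g u # ys" "p (xs @ ys) \<noteq> \<zero>"
      unfolding C_def cone_def by (rule cone_at_nonzero)
    then obtain us where us: "L us \<noteq> \<zero>" "map f us = xs @ ys" unfolding p_def by (elim push_nonzero)
    have "f ` set (u # us) \<union> g ` set (u # us) \<in> E'" by (rule E) (use us(1) in \<open>simp add: L_def\<close>)
    moreover have "f ` set us = set xs \<union> set ys" "g ` set us = set xs \<union> set ys"
      using arg_cong[OF us(2), of set] mapL[OF us(1)] us(2) by (simp_all flip: set_map)
    ultimately show "insert (f u) (set vs) \<in> E'" using vs(1) by (simp add: insert_commute)
  qed
  have "bd (cone (f u) C) ws = push (map g) z ws \<ominus> push (map f) z ws" for ws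
  proof -
    \<comment> \<open>The part of \<open>z\<close> away from \<open>u\<close>. There
      \<open>f\<close> and \<open>g\<close> agree, so it drops out of the difference.\<close>
    define z2 where "z2 = (\<lambda>vs. z vs \<oplus> \<ominus> D vs)"
    have fin2: "finsupp (\<lambda>vs. \<ominus> D vs)" by (rule finsupp_uminus[OF D'(1)])
    have z2: "finsupp z2" unfolding z2_def by (rule finsupp_add[OF z'(1) fin2])
    have zD: "z = (\<lambda>vs. D vs \<oplus> z2 vs)"
    proof
      show "z vs = D vs \<oplus> z2 vs" for vs
        unfolding z2_def by (rule add_diff_eq[symmetric, OF z'(3) D'(3)])
    qed
    have u2: "u \<notin> set vs" if "z2 vs \<noteq> \<zero>" for vs
    proof
      assume u: "u \<in> set vs"
      have "D vs = z vs"
      proof (cases "distinct vs")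
        case True
        show ?thesis
          unfolding D_def L_def cone_def by (rule cone_at_link[OF z'(2) z'(3) True u])
      next
        case False
        then have "z vs = \<zero>" "D vs = \<zero>" using z'(5) D'(5) by metis+
        then show ?thesis by simp
      qed
      then have "z2 vs = \<zero>" unfolding z2_def using z'(3)[of vs] by (simp add: r_neg)
      with that show False by simp
    qed
    have "push (map f) z2 = push (map g) z2"
    proof (rule push_cong)
      fix vs assume "z2 vs \<noteq> \<zero>"
      note u = u2[OF this]
      show "map f vs = map g vs"
      proof (rule map_cong[OF refl])
        fix v assume "v \<in> set vs"
        with u have "v \<noteq> u" by auto
        then show "f v = g v" by (rule fg)
      qed
    qed
    then obtain q where q: "push (map f) z2 = q" "push (map g) z2 = q" by blast
    have cq: "q ws \<in> carrier G" unfolding q(1)[symmetric] by (rule finsuppD(1)[OF finsupp_push[OF z2]])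
    have cD: "push \<phi> D ws \<in> carrier G" for \<phi> by (rule finsuppD(1)[OF finsupp_push[OF D'(1)]])
    have "push (map g) z ws = push (map g) D ws \<oplus> q ws" "push (map f) z ws = push (map f) D ws \<oplus> q ws"
      unfolding zD push_add[OF D'(1) z2] q by (rule refl)+
    then have "push (map g) z ws \<ominus> push (map f) z ws = push (map g) D ws \<ominus> push (map f) D ws"
      using cq cD[of "map f"] cD[of "map g"]
      by (simp add: a_minus_def minus_add a_assoc) (simp add: a_lcomm[of "q ws"] r_neg)
    also have "\<dots> = bd (cone (f u) C) ws"
      unfolding bd_cone[OF C] bdC CD FD by (rule refl)
    finally show ?thesis by (rule sym)
  qed
  with B show ?thesis by blast
qed

text \<open>\<open>f\<close> is turned into \<open>g\<close> at one vertex of \<open>z\<close> after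
  another. The maps \<open>h U\<close> in between take their values in the union of the two images
  of a simplex, so every step stays within its faces.\<close>

lemma homologous_contiguous:
  fixes f g :: "'v \<Rightarrow> 'w"
  assumes z: "chain (Suc n) E z" and cyc: "n = 0 \<or> bd z = (\<lambda>_. \<zero>)"
    and E: "\<And>vs. z vs \<noteq> \<zero> \<Longrightarrow> f ` set vs \<union> g ` set vs \<in> E'"
    and E': "\<And>\<sigma> \<tau>. \<sigma> \<in> E' \<Longrightarrow> \<tau> \<noteq> {} \<Longrightarrow> \<tau> \<subseteq> \<sigma> \<Longrightarrow> \<tau> \<in> E'"
  shows "\<exists>B. chain (Suc (Suc n)) E' B \<and>
    (\<forall>ws. bd B ws = push (map g) z ws \<ominus> push (map f) z ws)"
proof -
  note z' = chainD[OF z]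
  define h where "h U x = (if x \<in> U then g x else f x)" for U x
  have cp: "push \<phi> z ws \<in> carrier G" for \<phi> :: "'v list \<Rightarrow> 'w list" and ws
    by (rule finsuppD(1)[OF finsupp_push[OF z'(1)]])
  have step: "\<exists>B. chain (Suc (Suc n)) E' B \<and>
      (\<forall>ws. bd B ws = push (map (h U)) z ws \<ominus> push (map f) z ws)" if "finite U" for U
    using that
  proof (induction U rule: finite_induct)
    case empty
    have "h {} = f" by (simp add: h_def fun_eq_iff)
    then have "bd (\<lambda>_. \<zero>) ws = push (map (h {})) z ws \<ominus> push (map f) z ws" for ws
      unfolding bd_zero using cp by (simp add: a_minus_def r_neg)
    then show ?case using chain_zero by blast
  next
    case (insert u U)
    then obtain B where B: "chain (Suc (Suc n)) E' B"
      "\<And>ws. bd B ws = push (map (h U)) z ws \<ominus> push (map f) z ws" by blast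
    have "\<exists>B. chain (Suc (Suc n)) E' B \<and>
      (\<forall>ws. bd B ws = push (map (h (insert u U))) z ws \<ominus> push (map (h U)) z ws)"
    proof (rule homologous_update_vertex[OF z cyc])
      show "h U v = h (insert u U) v" if "v \<noteq> u" for v using that by (simp add: h_def)
      fix vs assume vs: "z vs \<noteq> \<zero>"
      have "vs \<noteq> []" using z'(4)[OF vs] by auto
      show "h U ` set vs \<union> h (insert u U) ` set vs \<in> E'"
      proof (rule E'[OF E[OF vs]])
        show "h U ` set vs \<union> h (insert u U) ` set vs \<noteq> {}" using \<open>vs \<noteq> []\<close> by simp
        show "h U ` set vs \<union> h (insert u U) ` set vs \<subseteq> f ` set vs \<union> g ` set vs"
          by (auto simp: h_def)
      qed
    qed
    then obtain B' where B': "chain (Suc (Suc n)) E' B'"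
      "\<And>ws. bd B' ws = push (map (h (insert u U))) z ws \<ominus> push (map (h U)) z ws" by blast
    have "bd (\<lambda>vs. B vs \<oplus> B' vs) ws = push (map (h (insert u U))) z ws \<ominus> push (map f) z ws" for ws
      unfolding bd_add[OF B(1) B'(1)] B(2) B'(2)
      by (rule diff_add_diff) (rule cp)+
    then show ?case using chain_add[OF B(1) B'(1)] by blast
  qed
  define U where "U = vertices z"
  have "push (map (h U)) z = push (map g) z"
  proof (rule push_cong)
    fix vs assume "z vs \<noteq> \<zero>"
    then have "set vs \<subseteq> U" unfolding U_def by (auto intro: in_vertices)
    then show "map (h U) vs = map g vs" by (intro map_cong) (auto simp: h_def)
  qed
  with step[of U] finite_vertices[OF z] show ?thesis unfolding U_def by (simp only:)
qed

end

section \<open>Homology modules and induced maps\<close>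

lemma submodule_abelian_subgroup:
  assumes M: "Module.module R M" and N: "LinearCombinations.submodule R N M"
  shows "abelian_subgroup N M"
proof -
  interpret M: Module.module R M by (rule M)
  interpret N: LinearCombinations.submodule R N M by (rule N)
  have "\<ominus>\<^bsub>M\<^esub> v \<in> N" if "v \<in> N" for v
  proof -
    have "v \<in> carrier M" using that N.subset by auto
    then have "\<ominus>\<^bsub>M\<^esub> v = (\<ominus>\<^bsub>R\<^esub> \<one>\<^bsub>R\<^esub>) \<odot>\<^bsub>M\<^esub> v" by (simp only: M.smult_minus_1)
    then show ?thesis using that by simp
  qed
  then have "subgroup N (add_monoid M)"
    using N.subset by (intro M.add.subgroupI) (auto intro: N.zero_closed)
  then show ?thesis
    by (intro abelian_subgroupI3 additive_subgroup.intro M.abelian_group_axioms)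
qed

locale submodule_quotient = M: Module.module R M
  for R :: "('r, 'x) ring_scheme" (structure) and M :: "('r, 'm) module" +
  fixes N
  assumes N: "LinearCombinations.submodule R N M"
begin

sublocale N: LinearCombinations.submodule R N M by (rule N)
sublocale N: abelian_subgroup N M by (rule submodule_abelian_subgroup[OF M.module_axioms N])

abbreviation coset where "coset x \<equiv> N +>\<^bsub>M\<^esub> x"

lemma coset_eqI:
  assumes "x \<in> carrier M" "y \<in> carrier M" "y \<oplus>\<^bsub>M\<^esub> \<ominus>\<^bsub>M\<^esub> x \<in> N"
  shows "coset x = coset y"
  using assms by (intro N.a_repr_independence' N.a_rcos_module_rev)

lemma coset_cases:
  assumes "A \<in> carrier (quotient_module M N)"
  obtains x where "x \<in> carrier M" "A = coset x"
  using assms by (auto simp: quotient_module_def A_RCOSETS_def')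

lemma coset_closed: "x \<in> carrier M \<Longrightarrow> coset x \<in> carrier (quotient_module M N)"
  by (auto simp: quotient_module_def A_RCOSETS_def')

lemma coset_add:
  "x \<in> carrier M \<Longrightarrow> y \<in> carrier M \<Longrightarrow> coset x \<oplus>\<^bsub>quotient_module M N\<^esub> coset y = coset (x \<oplus>\<^bsub>M\<^esub> y)"
  by (simp add: quotient_module_def N.a_rcos_sum)

lemma coset_zero: "\<zero>\<^bsub>quotient_module M N\<^esub> = coset \<zero>\<^bsub>M\<^esub>"
  by (simp add: quotient_module_def N.a_rcos_const)

lemma in_coset:
  assumes "x \<in> carrier M" "x' \<in> coset x"
  obtains n where "n \<in> N" "x' = n \<oplus>\<^bsub>M\<^esub> x" "x' \<in> carrier M"
  using assms N.subset by (auto simp: a_r_coset_def')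

text \<open>Scalar multiplication in \<open>quotient_module\<close> and the map
  \<open>homology_map\<close> are unions over all representatives; such a union is a single coset
  once its members agree.\<close>

lemma UN_coset:
  assumes x: "x \<in> carrier M" and h: "\<And>x'. x' \<in> coset x \<Longrightarrow> h x' = h x"
  shows "(\<Union>x'\<in>coset x. h x') = h x"
proof -
  have "(\<Union>x'\<in>coset x. h x') = (\<Union>x'\<in>coset x. h x)" by (rule SUP_cong[OF refl]) (rule h)
  also have "\<dots> = h x" using N.a_rcos_self[OF x] by blast
  finally show ?thesis .
qed

lemma coset_smult:
  assumes r: "r \<in> carrier R" and x: "x \<in> carrier M"
  shows "r \<odot>\<^bsub>quotient_module M N\<^esub> coset x = coset (r \<odot>\<^bsub>M\<^esub> x)"
proof -
  have "(\<Union>x'\<in>coset x. coset (r \<odot>\<^bsub>M\<^esub> x')) = coset (r \<odot>\<^bsub>M\<^esub> x)"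
  proof (rule UN_coset[OF x])
    fix x' assume "x' \<in> coset x"
    then obtain n where n: "n \<in> N" "x' = n \<oplus>\<^bsub>M\<^esub> x" "x' \<in> carrier M" using in_coset[OF x] by metis
    then have "n \<in> carrier M" using N.subset by auto
    then have "r \<odot>\<^bsub>M\<^esub> x' = r \<odot>\<^bsub>M\<^esub> n \<oplus>\<^bsub>M\<^esub> r \<odot>\<^bsub>M\<^esub> x" using r x n by (simp add: M.smult_r_distr)
    then have "r \<odot>\<^bsub>M\<^esub> x' \<oplus>\<^bsub>M\<^esub> \<ominus>\<^bsub>M\<^esub> (r \<odot>\<^bsub>M\<^esub> x) = r \<odot>\<^bsub>M\<^esub> n"
      using \<open>n \<in> carrier M\<close> r x by (simp add: M.a_assoc M.r_neg)
    then show "coset (r \<odot>\<^bsub>M\<^esub> x') = coset (r \<odot>\<^bsub>M\<^esub> x)"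
      using r x n by (intro coset_eqI[symmetric]) auto
  qed
  then show ?thesis by (simp add: quotient_module_def)
qed

lemma module_quotient_module: "Module.module R (quotient_module M N)"
proof (rule module_criteria)
  let ?Q = "quotient_module M N"
  show "cring R" by (rule M.R.cring_axioms)
  show "\<zero>\<^bsub>?Q\<^esub> \<in> carrier ?Q" unfolding coset_zero by (rule coset_closed) simp
  show "\<forall>v w. v \<in> carrier ?Q \<and> w \<in> carrier ?Q \<longrightarrow> v \<oplus>\<^bsub>?Q\<^esub> w \<in> carrier ?Q"
    by (auto elim!: coset_cases simp: coset_add coset_closed)
  show "\<forall>v\<in>carrier ?Q. \<exists>neg_v\<in>carrier ?Q. v \<oplus>\<^bsub>?Q\<^esub> neg_v = \<zero>\<^bsub>?Q\<^esub>"
  proof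
    fix v assume "v \<in> carrier ?Q"
    then obtain x where x: "x \<in> carrier M" "v = coset x" by (rule coset_cases)
    then have "v \<oplus>\<^bsub>?Q\<^esub> coset (\<ominus>\<^bsub>M\<^esub> x) = \<zero>\<^bsub>?Q\<^esub>" by (simp add: coset_add coset_zero M.r_neg)
    then show "\<exists>neg_v\<in>carrier ?Q. v \<oplus>\<^bsub>?Q\<^esub> neg_v = \<zero>\<^bsub>?Q\<^esub>"
      using x by (intro bexI[of _ "coset (\<ominus>\<^bsub>M\<^esub> x)"] coset_closed) auto
  qed
  show "\<forall>c v. c \<in> carrier R \<and> v \<in> carrier ?Q \<longrightarrow> c \<odot>\<^bsub>?Q\<^esub> v \<in> carrier ?Q"
    by (auto elim!: coset_cases simp: coset_smult coset_closed)
  show "\<forall>v w. v \<in> carrier ?Q \<and> w \<in> carrier ?Q \<longrightarrow> v \<oplus>\<^bsub>?Q\<^esub> w = w \<oplus>\<^bsub>?Q\<^esub> v"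
    by (auto elim!: coset_cases simp: coset_add M.a_comm)
  show "\<forall>v w x. v \<in> carrier ?Q \<and> w \<in> carrier ?Q \<and> x \<in> carrier ?Q \<longrightarrow>
      v \<oplus>\<^bsub>?Q\<^esub> w \<oplus>\<^bsub>?Q\<^esub> x = v \<oplus>\<^bsub>?Q\<^esub> (w \<oplus>\<^bsub>?Q\<^esub> x)"
    by (auto elim!: coset_cases simp: coset_add M.a_assoc)
  show "\<forall>v\<in>carrier ?Q. v \<oplus>\<^bsub>?Q\<^esub> \<zero>\<^bsub>?Q\<^esub> = v"
    unfolding coset_zero by (auto elim!: coset_cases simp: coset_add)
  show "\<forall>a b v. a \<in> carrier R \<and> b \<in> carrier R \<and> v \<in> carrier ?Q \<longrightarrow>
      (a \<otimes>\<^bsub>R\<^esub> b) \<odot>\<^bsub>?Q\<^esub> v = a \<odot>\<^bsub>?Q\<^esub> (b \<odot>\<^bsub>?Q\<^esub> v)"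
    by (auto elim!: coset_cases simp: coset_smult M.smult_assoc1)
  show "\<forall>v\<in>carrier ?Q. \<one>\<^bsub>R\<^esub> \<odot>\<^bsub>?Q\<^esub> v = v"
    by (auto elim!: coset_cases simp: coset_smult)
  show "\<forall>a b v. a \<in> carrier R \<and> b \<in> carrier R \<and> v \<in> carrier ?Q \<longrightarrow>
      (a \<oplus>\<^bsub>R\<^esub> b) \<odot>\<^bsub>?Q\<^esub> v = a \<odot>\<^bsub>?Q\<^esub> v \<oplus>\<^bsub>?Q\<^esub> b \<odot>\<^bsub>?Q\<^esub> v"
    by (auto elim!: coset_cases simp: coset_smult coset_add M.smult_l_distr)
  show "\<forall>a v w. a \<in> carrier R \<and> v \<in> carrier ?Q \<and> w \<in> carrier ?Q \<longrightarrow>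
      a \<odot>\<^bsub>?Q\<^esub> (v \<oplus>\<^bsub>?Q\<^esub> w) = a \<odot>\<^bsub>?Q\<^esub> v \<oplus>\<^bsub>?Q\<^esub> a \<odot>\<^bsub>?Q\<^esub> w"
    by (auto elim!: coset_cases simp: coset_smult coset_add M.smult_r_distr)
qed

end

section \<open>Chains, cycles and boundaries with coefficients in a module\<close>

locale coefficients = Module.module R G
  for R :: "('r, 'x) ring_scheme" and G :: "('r, 'g) module" (structure)
begin

lemma chains_simps:
  "\<zero>\<^bsub>chains j E G\<^esub> = (\<lambda>_. \<zero>)"
  "c \<oplus>\<^bsub>chains j E G\<^esub> d = (\<lambda>vs. c vs \<oplus> d vs)"
  "r \<odot>\<^bsub>chains j E G\<^esub> c = (\<lambda>vs. r \<odot> c vs)"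
  by (simp_all add: chains_def)

lemma chains_iff: "c \<in> carrier (chains j E G) \<longleftrightarrow> M.chain (Suc j) E c"
proof -
  have "M.alternating c \<longleftrightarrow> (\<forall>vs p. p permutes {..<length vs} \<longrightarrow>
           c (permute_list p vs) = (if evenperm p then c vs else \<ominus> c vs))"
    if "range c \<subseteq> carrier G"
    by (rule M.alternating_permute_iff) (use that in auto)
  then show ?thesis
    unfolding chains_def M.chain_def M.finsupp_def by auto
qed

lemma boundary_eq: "boundary j G c = (if j = 0 then (\<lambda>_. \<zero>) else M.bd c)"
  by (simp add: fun_eq_iff boundary_def M.bd_def)

text \<open>\<open>chain_push\<close> is set to zero on lists with repetitions; for
  \<open>push\<close> this is the cancellation behind \<open>chain_push_map\<close>.\<close>

lemma chain_push_eq: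
  assumes c: "M.chain n E c"
  shows "chain_push G f c = M.push (map f) c"
proof
  fix ws
  have "M.chain n UNIV (M.push (map f) c)" by (rule M.chain_push_map[OF c]) simp
  then have "M.push (map f) c ws = \<zero>" if "\<not> distinct ws"
    using that M.chainD(5) by metis
  then show "chain_push G f c ws = M.push (map f) c ws"
    by (cases "distinct ws") (simp_all add: chain_push_def M.push_def)
qed

lemma finsupp_smult:
  assumes r: "r \<in> carrier R" and c: "M.finsupp c"
  shows "M.finsupp (\<lambda>x. r \<odot> c x)"
proof (rule M.finsuppI)
  show "finite {x. c x \<noteq> \<zero>}" by (rule M.finsuppD(2)[OF c])
  show "r \<odot> c x \<in> carrier G" for x using r M.finsuppD(1)[OF c] by simp
  show "r \<odot> c x \<noteq> \<zero> \<Longrightarrow> x \<in> {x. c x \<noteq> \<zero>}" for x using r by auto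
qed

lemma push_smult:
  assumes r: "r \<in> carrier R" and c: "M.finsupp c"
  shows "M.push \<phi> (\<lambda>x. r \<odot> c x) = (\<lambda>y. r \<odot> M.push \<phi> c y)"
proof
  fix y
  let ?A = "{x. c x \<noteq> \<zero>}"
  have A: "finite ?A" by (rule M.finsuppD(2)[OF c])
  have sub: "{x. r \<odot> c x \<noteq> \<zero>} \<subseteq> ?A" using r by auto
  show "M.push \<phi> (\<lambda>x. r \<odot> c x) y = r \<odot> M.push \<phi> c y"
    unfolding M.push_eq[OF finsupp_smult[OF r c] A sub] M.push_eq[OF c A subset_refl]
    by (rule finsum_smult[symmetric, OF r]) (simp add: Pi_def M.finsuppD(1)[OF c])
qed

lemma chain_smult:
  assumes r: "r \<in> carrier R" and c: "M.chain n E c"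
  shows "M.chain n E (\<lambda>vs. r \<odot> c vs)"
  unfolding M.chain_def
proof (intro conjI allI impI)
  note c' = M.chainD[OF c]
  show "M.finsupp (\<lambda>vs. r \<odot> c vs)" by (rule finsupp_smult[OF r c'(1)])
  show "M.alternating (\<lambda>vs. r \<odot> c vs)"
    unfolding M.alternating_def
  proof (intro allI)
    fix xs x y ys
    show "r \<odot> c (xs @ x # y # ys) = \<ominus> (r \<odot> c (xs @ y # x # ys))"
      unfolding c'(7)[of xs x y ys] by (rule smult_r_minus[OF r c'(3)])
  qed
  fix vs assume "r \<odot> c vs \<noteq> \<zero>"
  then have "c vs \<noteq> \<zero>" using r by auto
  then show "length vs = n" "distinct vs" "set vs \<in> E" using c'(4-6) by auto
qed

lemma bd_smult:
  assumes r: "r \<in> carrier R" and c: "M.chain (Suc n) E c"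
  shows "M.bd (\<lambda>vs. r \<odot> c vs) = (\<lambda>vs. r \<odot> M.bd c vs)"
  unfolding M.bd_eq_push[OF c] M.bd_eq_push[OF chain_smult[OF r c]]
  by (rule push_smult[OF r M.chainD(1)[OF c]])

abbreviation "Z j E \<equiv> (chains j E G)\<lparr>carrier := cycles j E G\<rparr>"

lemma cycles_iff: "c \<in> cycles j E G \<longleftrightarrow> M.chain (Suc j) E c \<and> (j = 0 \<or> M.bd c = (\<lambda>_. \<zero>))"
  by (simp add: cycles_def chains_iff boundary_eq)

lemma boundaries_iff: "b \<in> boundaries j E G \<longleftrightarrow> (\<exists>c. M.chain (Suc (Suc j)) E c \<and> b = M.bd c)"
  by (auto simp: boundaries_def chains_iff boundary_eq image_iff Bex_def)

lemma cycles_closed: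
  assumes "c \<in> cycles j E G"
  shows "d \<in> cycles j E G \<Longrightarrow> (\<lambda>vs. c vs \<oplus> d vs) \<in> cycles j E G"
    and "r \<in> carrier R \<Longrightarrow> (\<lambda>vs. r \<odot> c vs) \<in> cycles j E G"
proof -
  have c: "M.chain (Suc j) E c" "j = 0 \<or> M.bd c = (\<lambda>_. \<zero>)" using assms cycles_iff by auto
  show "(\<lambda>vs. c vs \<oplus> d vs) \<in> cycles j E G" if "d \<in> cycles j E G"
  proof -
    have d: "M.chain (Suc j) E d" "j = 0 \<or> M.bd d = (\<lambda>_. \<zero>)" using that cycles_iff by auto
    show ?thesis
      unfolding cycles_iff M.bd_add[OF c(1) d(1)] using M.chain_add[OF c(1) d(1)] c(2) d(2) by auto
  qed
  show "(\<lambda>vs. r \<odot> c vs) \<in> cycles j E G" if r: "r \<in> carrier R"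
    unfolding cycles_iff bd_smult[OF r c(1)] using chain_smult[OF r c(1)] c(2) r by auto
qed

lemma zero_in_cycles: "(\<lambda>_. \<zero>) \<in> cycles j E G"
  by (simp add: cycles_iff M.chain_zero M.bd_zero)

lemma module_cycles: "Module.module R (Z j E)"
proof -
  have car: "c vs \<in> carrier G" if "c \<in> cycles j E G" for c vs
    using that cycles_iff[of c j E] M.chainD(3)[of "Suc j" E c vs] by simp
  show ?thesis
  proof (rule module_criteria)
  show "cring R" by (rule R.cring_axioms)
  show "\<forall>v\<in>carrier (Z j E). \<exists>neg_v\<in>carrier (Z j E). v \<oplus>\<^bsub>Z j E\<^esub> neg_v = \<zero>\<^bsub>Z j E\<^esub>"
  proof
    fix c assume "c \<in> carrier (Z j E)"
    then have c: "c \<in> cycles j E G" by simp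
    have "(\<lambda>vs. (\<ominus>\<^bsub>R\<^esub> \<one>\<^bsub>R\<^esub>) \<odot> c vs) \<in> cycles j E G" by (rule cycles_closed(2)[OF c]) simp
    moreover have "c vs \<oplus> (\<ominus>\<^bsub>R\<^esub> \<one>\<^bsub>R\<^esub>) \<odot> c vs = \<zero>" for vs
      using car[OF c, of vs] by (simp add: smult_minus_1 M.r_neg)
    ultimately show "\<exists>neg_v\<in>carrier (Z j E). c \<oplus>\<^bsub>Z j E\<^esub> neg_v = \<zero>\<^bsub>Z j E\<^esub>"
      by (intro bexI[of _ "\<lambda>vs. (\<ominus>\<^bsub>R\<^esub> \<one>\<^bsub>R\<^esub>) \<odot> c vs"]) (simp_all add: chains_simps)
  qed
qed (simp_all add: zero_in_cycles cycles_closed chains_simps car M.a_comm M.a_assoc M.a_lcomm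
      smult_assoc1 smult_l_distr smult_r_distr)
qed

end

definition face_closed :: "'v set set \<Rightarrow> bool" where
  "face_closed E \<longleftrightarrow> (\<forall>\<sigma>\<in>E. \<forall>\<tau>. \<tau> \<noteq> {} \<longrightarrow> \<tau> \<subseteq> \<sigma> \<longrightarrow> \<tau> \<in> E)"

lemma face_closedD: "face_closed E \<Longrightarrow> \<sigma> \<in> E \<Longrightarrow> \<tau> \<noteq> {} \<Longrightarrow> \<tau> \<subseteq> \<sigma> \<Longrightarrow> \<tau> \<in> E"
  by (simp add: face_closed_def)

lemma (in submodule_quotient) coset_add_left:
  assumes "n \<in> N" "x \<in> carrier M"
  shows "coset (n \<oplus>\<^bsub>M\<^esub> x) = coset x"
proof -
  have n: "n \<in> carrier M" using assms(1) N.subset by auto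
  have "n \<oplus>\<^bsub>M\<^esub> x \<oplus>\<^bsub>M\<^esub> \<ominus>\<^bsub>M\<^esub> x = n" using n assms(2) by (simp add: M.a_assoc M.r_neg)
  then show ?thesis using n assms by (intro coset_eqI[symmetric]) auto
qed

context coefficients
begin

lemma cyclesD:
  assumes "c \<in> cycles j E G"
  shows "M.chain (Suc j) E c" "j = 0 \<or> M.bd c = (\<lambda>_. \<zero>)"
  using assms by (simp_all only: cycles_iff)

lemma boundariesE:
  assumes "b \<in> boundaries j E G"
  obtains c where "M.chain (Suc (Suc j)) E c" "b = M.bd c"
  using assms[unfolded boundaries_iff] by (elim exE conjE)

lemma boundariesI: "M.chain (Suc (Suc j)) E c \<Longrightarrow> b = M.bd c \<Longrightarrow> b \<in> boundaries j E G"
  unfolding boundaries_iff by (intro exI conjI)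

text \<open>The inverse in \<open>Z j E\<close> refers to its carrier of cycles; multiplication by
  minus one identifies it with the pointwise inverse.\<close>

lemma uminus_cycles:
  assumes c: "c \<in> cycles j E G"
  shows "\<ominus>\<^bsub>Z j E\<^esub> c = (\<lambda>vs. \<ominus> c vs)"
proof -
  interpret Z: Module.module R "Z j E" by (rule module_cycles)
  have ch: "M.chain (Suc j) E c" by (rule cyclesD[OF c])
  have "\<ominus>\<^bsub>Z j E\<^esub> c = (\<ominus>\<^bsub>R\<^esub> \<one>\<^bsub>R\<^esub>) \<odot>\<^bsub>Z j E\<^esub> c"
    by (rule Z.smult_minus_1[symmetric]) (simp add: c)
  also have "\<dots> = (\<lambda>vs. (\<ominus>\<^bsub>R\<^esub> \<one>\<^bsub>R\<^esub>) \<odot> c vs)"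
    by (simp add: chains_simps)
  also have "\<dots> = (\<lambda>vs. \<ominus> c vs)"
    by (rule ext) (rule smult_minus_1[OF M.chainD(3)[OF ch]])
  finally show ?thesis .
qed

lemma submodule_boundaries:
  assumes E: "face_closed E"
  shows "LinearCombinations.submodule R (boundaries j E G) (Z j E)"
proof (rule LinearCombinations.submodule.intro)
  show "Module.module R (Z j E)" by (rule module_cycles)
  show "boundaries j E G \<subseteq> carrier (Z j E)"
  proof
    fix b assume "b \<in> boundaries j E G"
    then obtain c where c: "M.chain (Suc (Suc j)) E c" "b = M.bd c" by (rule boundariesE)
    have "M.chain (Suc j) E (M.bd c)"
    proof (rule M.chain_bd[OF c(1)])
      fix v ws assume "c (v # ws) \<noteq> \<zero>"
      \<comment> \<open>Lists of length \<open>Suc (Suc j)\<close> leave \<open>ws\<close> nonempty,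
        so it is a face.\<close>
      from M.chainD(4)[OF c(1) this] M.chainD(6)[OF c(1) this] show "set ws \<in> E"
        by (rule_tac face_closedD[OF E, of "set (v # ws)"]) auto
    qed
    then show "b \<in> carrier (Z j E)" using M.bd_bd[OF c(1)] by (simp add: cycles_iff c(2))
  qed
  show "\<zero>\<^bsub>Z j E\<^esub> \<in> boundaries j E G"
    by (rule boundariesI[of j E "\<lambda>_. \<zero>"]) (simp_all add: chains_simps M.chain_zero M.bd_zero)
  fix b assume "b \<in> boundaries j E G"
  then obtain c where c: "M.chain (Suc (Suc j)) E c" "b = M.bd c" by (rule boundariesE)
  show "r \<odot>\<^bsub>Z j E\<^esub> b \<in> boundaries j E G" if r: "r \<in> carrier R" for r
    by (rule boundariesI[OF chain_smult[OF r c(1)]]) (simp add: chains_simps c(2) bd_smult[OF r c(1)])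
  fix b' assume "b' \<in> boundaries j E G"
  then obtain c' where c': "M.chain (Suc (Suc j)) E c'" "b' = M.bd c'" by (rule boundariesE)
  show "b \<oplus>\<^bsub>Z j E\<^esub> b' \<in> boundaries j E G"
    by (rule boundariesI[OF M.chain_add[OF c(1) c'(1)]])
      (simp add: chains_simps c(2) c'(2) M.bd_add[OF c(1) c'(1)])
qed

lemma submodule_quotient_homology:
  assumes E: "face_closed E"
  shows "submodule_quotient R (Z j E) (boundaries j E G)"
  by (intro submodule_quotient.intro submodule_quotient_axioms.intro module_cycles submodule_boundaries[OF E])

lemma module_homology:
  assumes E: "face_closed E"
  shows "Module.module R (homology j E G)"
  unfolding homology_def
  by (rule submodule_quotient.module_quotient_module[OF submodule_quotient_homology[OF E]])

section \<open>Homology classes and induced maps\<close>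

definition homology_class :: "nat \<Rightarrow> 'v set set \<Rightarrow> ('v list \<Rightarrow> 'g) \<Rightarrow> ('v list \<Rightarrow> 'g) set" where
  "homology_class j E z = boundaries j E G +>\<^bsub>chains j E G\<^esub> z"

text \<open>A coset depends on the addition only, so it may be formed in the chains or in the
  cycles.\<close>

lemma homology_class_eq: "homology_class j E z = boundaries j E G +>\<^bsub>Z j E\<^esub> z"
  by (simp add: homology_class_def a_r_coset_def')

lemma homology_cases:
  assumes "A \<in> carrier (homology j E G)"
  obtains z where "z \<in> cycles j E G" "A = homology_class j E z"
  using assms by (auto simp: homology_def quotient_module_def A_RCOSETS_def' homology_class_def a_r_coset_def')

lemma push_cycles:
  assumes z: "z \<in> cycles j E G" and f: "\<And>\<sigma>. \<sigma> \<in> E \<Longrightarrow> f ` \<sigma> \<in> E'"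
  shows "M.push (map f) z \<in> cycles j E' G"
proof -
  have ch: "M.chain (Suc j) E z" and cyc: "j = 0 \<or> M.bd z = (\<lambda>_. \<zero>)" by (rule cyclesD[OF z])+
  have "M.chain (Suc j) E' (M.push (map f) z)"
    by (rule M.chain_push_map[OF ch]) (rule f, rule M.chainD(6)[OF ch])
  then show ?thesis
    unfolding cycles_iff M.bd_push_map[OF ch] using cyc by (auto simp: M.push_zero)
qed

text \<open>Changing \<open>z\<close> by \<open>bd d\<close> changes its push by the boundary of the
  push of \<open>d\<close>, so all representatives give the same class.\<close>

lemma homology_map_class:
  assumes E: "face_closed E" and E': "face_closed E'" and f: "\<And>\<sigma>. \<sigma> \<in> E \<Longrightarrow> f ` \<sigma> \<in> E'"
    and z: "z \<in> cycles j E G"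
  shows "homology_map j E' G f (homology_class j E z) = homology_class j E' (M.push (map f) z)"
proof -
  interpret Q: submodule_quotient R "Z j E" "boundaries j E G" by (rule submodule_quotient_homology[OF E])
  interpret Q': submodule_quotient R "Z j E'" "boundaries j E' G" by (rule submodule_quotient_homology[OF E'])
  have zch: "M.chain (Suc j) E z" by (rule cyclesD[OF z])
  have zZ: "z \<in> carrier (Z j E)" using z by simp
  have "homology_map j E' G f (homology_class j E z) =
      (\<Union>c\<in>homology_class j E z. homology_class j E' (chain_push G f c))"
    by (simp add: homology_map_def homology_class_def)
  also have "\<dots> = homology_class j E' (chain_push G f z)"
    unfolding homology_class_eq
  proof (rule Q.UN_coset[OF zZ])
    fix c assume "c \<in> boundaries j E G +>\<^bsub>Z j E\<^esub> z"
    then obtain b where b: "b \<in> boundaries j E G" "c = b \<oplus>\<^bsub>Z j E\<^esub> z" "c \<in> carrier (Z j E)"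
      using Q.in_coset[OF zZ] by metis
    obtain d where d: "M.chain (Suc (Suc j)) E d" "b = M.bd d" using b(1) by (rule boundariesE)
    have bZ: "b \<in> cycles j E G" using b(1) Q.N.subset by auto
    have bch: "M.chain (Suc j) E b" and cch: "M.chain (Suc j) E c" using bZ b(3) cyclesD(1) by simp_all
    have "M.chain (Suc (Suc j)) E' (M.push (map f) d)"
      by (rule M.chain_push_map[OF d(1)]) (rule f, rule M.chainD(6)[OF d(1)])
    then have pb: "M.push (map f) b \<in> boundaries j E' G"
      by (rule boundariesI) (simp add: d(2) M.bd_push_map[OF d(1)])
    have "M.push (map f) c = M.push (map f) b \<oplus>\<^bsub>Z j E'\<^esub> M.push (map f) z"
      using M.push_add[OF M.chainD(1)[OF bch] M.chainD(1)[OF zch], of "map f"]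
      by (simp add: b(2) chains_simps)
    moreover have "M.push (map f) b \<in> carrier (Z j E')" "M.push (map f) z \<in> carrier (Z j E')"
      using push_cycles[of _ j E f E', OF _ f] bZ z by auto
    ultimately have "boundaries j E' G +>\<^bsub>Z j E'\<^esub> M.push (map f) c =
        boundaries j E' G +>\<^bsub>Z j E'\<^esub> M.push (map f) z"
      using Q'.coset_add_left[OF pb] by metis
    then show "boundaries j E' G +>\<^bsub>Z j E'\<^esub> chain_push G f c =
        boundaries j E' G +>\<^bsub>Z j E'\<^esub> chain_push G f z"
      unfolding chain_push_eq[OF cch] chain_push_eq[OF zch] .
  qed
  also have "chain_push G f z = M.push (map f) z" by (rule chain_push_eq[OF zch])
  finally show ?thesis .
qed

lemma homology_map_hom:
  assumes E: "face_closed E" and E': "face_closed E'" and f: "\<And>\<sigma>. \<sigma> \<in> E \<Longrightarrow> f ` \<sigma> \<in> E'"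
  shows "homology_map j E' G f \<in> LinearCombinations.module_hom R (homology j E G) (homology j E' G)"
proof -
  interpret Q: submodule_quotient R "Z j E" "boundaries j E G" by (rule submodule_quotient_homology[OF E])
  interpret Q': submodule_quotient R "Z j E'" "boundaries j E' G" by (rule submodule_quotient_homology[OF E'])
  have map: "homology_map j E' G f (homology_class j E z) = homology_class j E' (M.push (map f) z)"
    if "z \<in> cycles j E G" for z
    by (rule homology_map_class[OF E E' _ that]) (rule f)
  note closed = Q'.coset_closed[folded homology_class_eq homology_def]
  note add = Q.coset_add[folded homology_class_eq homology_def]
    and add' = Q'.coset_add[folded homology_class_eq homology_def]
  note smult = Q.coset_smult[folded homology_class_eq homology_def]
    and smult' = Q'.coset_smult[folded homology_class_eq homology_def]
  have fin: "M.finsupp z" if "z \<in> cycles j E G" for z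
    by (rule M.chainD(1)[OF cyclesD(1)[OF that]])
  have push: "M.push (map f) z \<in> carrier (Z j E')" if "z \<in> cycles j E G" for z
    using push_cycles[OF that f] by simp
  show ?thesis
    unfolding LinearCombinations.module_hom_def
  proof (intro CollectI conjI allI impI)
    show "homology_map j E' G f \<in> carrier (homology j E G) \<rightarrow> carrier (homology j E' G)"
    proof
      fix A assume "A \<in> carrier (homology j E G)"
      then obtain z where z: "z \<in> cycles j E G" "A = homology_class j E z" by (rule homology_cases)
      show "homology_map j E' G f A \<in> carrier (homology j E' G)"
        unfolding z(2) map[OF z(1)] by (rule closed[OF push[OF z(1)]])
    qed
    fix A B assume "A \<in> carrier (homology j E G) \<and> B \<in> carrier (homology j E G)"
    then obtain z w where z: "z \<in> cycles j E G" "A = homology_class j E z"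
      and w: "w \<in> cycles j E G" "B = homology_class j E w" by (metis homology_cases)
    have zw: "(\<lambda>vs. z vs \<oplus> w vs) \<in> cycles j E G" by (rule cycles_closed(1)[OF z(1) w(1)])
    show "homology_map j E' G f (A \<oplus>\<^bsub>homology j E G\<^esub> B) =
        homology_map j E' G f A \<oplus>\<^bsub>homology j E' G\<^esub> homology_map j E' G f B"
      using add[of z w] add'[OF push[OF z(1)] push[OF w(1)]] z w map[OF z(1)] map[OF w(1)] map[OF zw]
        M.push_add[OF fin[OF z(1)] fin[OF w(1)], of "map f"]
      by (simp add: chains_simps)
  next
    fix r A assume rA: "r \<in> carrier R \<and> A \<in> carrier (homology j E G)"
    then obtain z where z: "z \<in> cycles j E G" "A = homology_class j E z" by (metis homology_cases)
    have r: "r \<in> carrier R" using rA by simp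
    show "homology_map j E' G f (r \<odot>\<^bsub>homology j E G\<^esub> A) = r \<odot>\<^bsub>homology j E' G\<^esub> homology_map j E' G f A"
      using smult[OF r, of z] smult'[OF r push[OF z(1)]] z map[OF z(1)] map[OF cycles_closed(2)[OF z(1) r]]
        push_smult[OF r fin[OF z(1)], of "map f"]
      by (simp add: chains_simps)
  qed
qed

lemma homology_map_comp:
  assumes E: "face_closed E" and E': "face_closed E'" and E'': "face_closed E''"
    and f: "\<And>\<sigma>. \<sigma> \<in> E \<Longrightarrow> f ` \<sigma> \<in> E'" and g: "\<And>\<sigma>. \<sigma> \<in> E' \<Longrightarrow> g ` \<sigma> \<in> E''"
    and A: "A \<in> carrier (homology j E G)"
  shows "homology_map j E'' G g (homology_map j E' G f A) = homology_map j E'' G (g \<circ> f) A"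
proof -
  obtain z where z: "z \<in> cycles j E G" "A = homology_class j E z" using A by (rule homology_cases)
  have fin: "M.finsupp z" by (rule M.chainD(1)[OF cyclesD(1)[OF z(1)]])
  have gf: "(g \<circ> f) ` \<sigma> \<in> E''" if "\<sigma> \<in> E" for \<sigma>
    using g[OF f[OF that]] by (simp only: image_comp)
  have pz: "M.push (map f) z \<in> cycles j E' G" by (rule push_cycles[OF z(1)]) (rule f)
  have "homology_map j E' G f A = homology_class j E' (M.push (map f) z)"
    unfolding z(2) by (rule homology_map_class[OF E E' _ z(1)]) (rule f)
  moreover have "homology_map j E'' G g (homology_class j E' (M.push (map f) z)) =
      homology_class j E'' (M.push (map g) (M.push (map f) z))"
    by (rule homology_map_class[OF E' E'' _ pz]) (rule g)
  moreover have "homology_map j E'' G (g \<circ> f) A = homology_class j E'' (M.push (map (g \<circ> f)) z)"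
    unfolding z(2) by (rule homology_map_class[OF E E'' _ z(1)]) (rule gf)
  moreover have "M.push (map g) (M.push (map f) z) = M.push (map (g \<circ> f)) z"
    unfolding M.push_push[OF fin] by (simp add: comp_def)
  ultimately show ?thesis by simp
qed

lemma homology_map_contiguous:
  assumes E: "face_closed E" and E': "face_closed E'"
    and fg: "\<And>\<sigma>. \<sigma> \<in> E \<Longrightarrow> f ` \<sigma> \<union> g ` \<sigma> \<in> E'" and ne: "{} \<notin> E"
    and A: "A \<in> carrier (homology j E G)"
  shows "homology_map j E' G f A = homology_map j E' G g A"
proof -
  have f: "f ` \<sigma> \<in> E'" and g: "g ` \<sigma> \<in> E'" if "\<sigma> \<in> E" for \<sigma>
  proof -
    have "\<sigma> \<noteq> {}" using that ne by auto
    then show "f ` \<sigma> \<in> E'" "g ` \<sigma> \<in> E'" by (auto intro!: face_closedD[OF E' fg[OF that]])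
  qed
  interpret Q': submodule_quotient R "Z j E'" "boundaries j E' G" by (rule submodule_quotient_homology[OF E'])
  obtain z where z: "z \<in> cycles j E G" "A = homology_class j E z" using A by (rule homology_cases)
  have ch: "M.chain (Suc j) E z" and cyc: "j = 0 \<or> M.bd z = (\<lambda>_. \<zero>)" by (rule cyclesD[OF z(1)])+
  have pf: "M.push (map f) z \<in> cycles j E' G" and pg: "M.push (map g) z \<in> cycles j E' G"
    by (rule push_cycles[OF z(1)], erule f, rule push_cycles[OF z(1)], erule g)
  have "\<exists>B. M.chain (Suc (Suc j)) E' B \<and>
      (\<forall>ws. M.bd B ws = M.push (map g) z ws \<ominus> M.push (map f) z ws)"
    by (rule M.homologous_contiguous[OF ch cyc]) (rule fg, erule M.chainD(6)[OF ch], erule (2) face_closedD[OF E'])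
  then obtain B where B: "M.chain (Suc (Suc j)) E' B"
    "\<And>ws. M.bd B ws = M.push (map g) z ws \<ominus> M.push (map f) z ws" by (elim exE conjE) auto
  have "M.push (map g) z \<oplus>\<^bsub>Z j E'\<^esub> \<ominus>\<^bsub>Z j E'\<^esub> M.push (map f) z = M.bd B"
    unfolding uminus_cycles[OF pf] using B(2) by (simp add: chains_simps fun_eq_iff a_minus_def)
  then have "M.push (map g) z \<oplus>\<^bsub>Z j E'\<^esub> \<ominus>\<^bsub>Z j E'\<^esub> M.push (map f) z \<in> boundaries j E' G"
    by (simp only: boundariesI[OF B(1) refl])
  then have 1: "homology_class j E' (M.push (map f) z) = homology_class j E' (M.push (map g) z)"
    unfolding homology_class_eq using pf pg by (intro Q'.coset_eqI) simp_all
  have 2: "homology_map j E' G f A = homology_class j E' (M.push (map f) z)"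
    unfolding z(2) by (rule homology_map_class[OF E E' _ z(1)]) (rule f)
  have 3: "homology_map j E' G g A = homology_class j E' (M.push (map g) z)"
    unfolding z(2) by (rule homology_map_class[OF E E' _ z(1)]) (rule g)
  show ?thesis by (rule trans[OF 2 trans[OF 1 3[symmetric]]])
qed

end

section \<open>From correspondences to interleavings\<close>

lemma face_closed_complex_of:
  assumes "closure_space X c"
  shows "face_closed (complex_of S X c)"
proof -
  have "simplicial_complex X (complex_of S X c)" by (rule simplicial_complex_complex_of[OF assms])
  then show ?thesis unfolding simplicial_complex_def face_closed_def by (elim conjE)
qed

lemma empty_notin_complex_of: "{} \<notin> complex_of S X c"
  by (cases S) (auto simp: VR_complex_def Cech_complex_def CechT_complex_def)

lemma complex_of_alexandroff: "complex_of S X (alexandroff c) = complex_of S X c"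
  by (cases S) (simp_all add: VR_complex_def Cech_complex_def CechT_complex_def alexandroff_def)

lemma persistent_homology_alexandroff:
  "persistent_homology j S G (alexandroff_filtration X) = persistent_homology j S G X"
  by (simp add: persistent_homology_def alexandroff_filtration_def complex_of_alexandroff)

text \<open>A simplex with apex \<open>x\<close> goes to one with apex \<open>f x\<close>. For
  \<open>VR\<close> every vertex is an apex, whether of the form \<open>f x\<close> or
  \<open>g x\<close>, which is why all four relations are assumed.\<close>

lemma complex_of_contiguous:
  assumes f: "\<And>x. x \<in> X \<Longrightarrow> f x \<in> Y" and g: "\<And>x. x \<in> X \<Longrightarrow> g x \<in> Y"
    and fg: "\<And>x x'. x \<in> X \<Longrightarrow> x' \<in> X \<Longrightarrow> x' \<in> c {x} \<Longrightarrow>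
      f x' \<in> d {f x} \<and> g x' \<in> d {f x} \<and> f x' \<in> d {g x} \<and> g x' \<in> d {g x}"
    and \<sigma>: "\<sigma> \<in> complex_of S X c"
  shows "f ` \<sigma> \<union> g ` \<sigma> \<in> complex_of S Y d"
proof -
  have *: "\<sigma> \<noteq> {}" "finite \<sigma>" "\<sigma> \<subseteq> X"
    using \<sigma> by (cases S; simp add: VR_complex_def Cech_complex_def CechT_complex_def)+
  have Y: "f ` \<sigma> \<union> g ` \<sigma> \<noteq> {}" "finite (f ` \<sigma> \<union> g ` \<sigma>)" "f ` \<sigma> \<union> g ` \<sigma> \<subseteq> Y"
    using * f g by auto
  show ?thesis
  proof (cases S)
    case VR
    then have "\<forall>x\<in>\<sigma>. \<sigma> \<subseteq> c {x}" using \<sigma> by (simp add: VR_complex_def)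
    then have "\<forall>z\<in>f ` \<sigma> \<union> g ` \<sigma>. f ` \<sigma> \<union> g ` \<sigma> \<subseteq> d {z}"
      using fg *(3) by (auto simp: subset_iff)
    then show ?thesis using VR Y by (simp add: VR_complex_def)
  next
    case Cech
    then obtain x where "x \<in> X" "\<sigma> \<subseteq> c {x}" using \<sigma> by (auto simp: Cech_complex_def)
    then have "f x \<in> Y" "f ` \<sigma> \<union> g ` \<sigma> \<subseteq> d {f x}"
      using f fg *(3) by (auto simp: subset_iff)
    then show ?thesis using Cech Y by (auto simp: Cech_complex_def)
  next
    case CechT
    then obtain x where "x \<in> X" "\<forall>y\<in>\<sigma>. x \<in> c {y}" using \<sigma> by (auto simp: CechT_complex_def)
    then have "f x \<in> Y" "\<forall>y\<in>f ` \<sigma> \<union> g ` \<sigma>. f x \<in> d {y}"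
      using f fg *(3) by (auto simp: subset_iff)
    then show ?thesis using CechT Y by (auto simp: CechT_complex_def)
  qed
qed

lemma complex_of_image:
  assumes "\<And>x. x \<in> X \<Longrightarrow> f x \<in> Y"
    and "\<And>x x'. x \<in> X \<Longrightarrow> x' \<in> X \<Longrightarrow> x' \<in> c {x} \<Longrightarrow> f x' \<in> d {f x}"
    and "\<sigma> \<in> complex_of S X c"
  shows "f ` \<sigma> \<in> complex_of S Y d"
  using complex_of_contiguous[of X f Y f c d \<sigma> S] assms by simp

lemma complex_of_subset: "\<sigma> \<in> complex_of S X c \<Longrightarrow> \<sigma> \<subseteq> X"
  by (cases S) (auto simp: VR_complex_def Cech_complex_def CechT_complex_def)

lemma filtrationD:
  assumes "filtration X"
  shows "closure_space (fspace X t) (fclos X t)"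
    and "s \<le> t \<Longrightarrow> x \<in> fspace X s \<Longrightarrow> fmap X s t x \<in> fspace X t"
    and "s \<le> t \<Longrightarrow> x \<in> fspace X s \<Longrightarrow> x' \<in> fclos X s {x} \<Longrightarrow> fmap X s t x' \<in> fclos X t {fmap X s t x}"
    and "s \<le> t \<Longrightarrow> t \<le> u \<Longrightarrow> x \<in> fspace X s \<Longrightarrow> fmap X t u (fmap X s t x) = fmap X s u x"
proof -
  show "closure_space (fspace X t) (fclos X t)" using assms by (simp add: filtration_def)
  have cc: "closure_continuous (fspace X s) (fclos X s) (fspace X t) (fclos X t) (fmap X s t)" if "s \<le> t"
    using assms that by (simp add: filtration_def)
  show "fmap X s t x \<in> fspace X t" if "s \<le> t" "x \<in> fspace X s"
    using cc[OF that(1)] that(2) by (auto simp: closure_continuous_def)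
  show "fmap X s t x' \<in> fclos X t {fmap X s t x}" if "s \<le> t" "x \<in> fspace X s" "x' \<in> fclos X s {x}"
  proof -
    have "fmap X s t ` fclos X s {x} \<subseteq> fclos X t (fmap X s t ` {x})"
      using cc[OF that(1)] that(2) unfolding closure_continuous_def by blast
    then show ?thesis using that(3) by auto
  qed
  show "fmap X t u (fmap X s t x) = fmap X s u x" if "s \<le> t" "t \<le> u" "x \<in> fspace X s"
    using assms that unfolding filtration_def by blast
qed

text \<open>A morphism of degree \<open>e\<close> between filtrations, continuous on the closures of
  points; this makes it simplicial for all three complexes.\<close>

definition vertex_map :: "real \<Rightarrow> 'v cl_filtration \<Rightarrow> 'w cl_filtration \<Rightarrow> (real \<Rightarrow> 'v \<Rightarrow> 'w) \<Rightarrow> bool" where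
  "vertex_map e X Y F \<longleftrightarrow>
     (\<forall>t. \<forall>x\<in>fspace X t. F t x \<in> fspace Y (t + e)) \<and>
     (\<forall>t. \<forall>x\<in>fspace X t. \<forall>x'\<in>fclos X t {x}. F t x' \<in> fclos Y (t + e) {F t x}) \<and>
     (\<forall>s t. s \<le> t \<longrightarrow> (\<forall>x\<in>fspace X s. F t (fmap X s t x) = fmap Y (s + e) (t + e) (F s x)))"

lemma vertex_mapD:
  assumes "vertex_map e X Y F"
  shows "x \<in> fspace X t \<Longrightarrow> F t x \<in> fspace Y (t + e)"
    and "x \<in> fspace X t \<Longrightarrow> x' \<in> fclos X t {x} \<Longrightarrow> F t x' \<in> fclos Y (t + e) {F t x}"
    and "s \<le> t \<Longrightarrow> x \<in> fspace X s \<Longrightarrow> F t (fmap X s t x) = fmap Y (s + e) (t + e) (F s x)"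
  using assms unfolding vertex_map_def by blast+

text \<open>The relations that \<open>complex_of_contiguous\<close> asks of the structure map and
  the composite of \<open>F\<close> and \<open>H\<close>. The time \<open>t + e + e\<close> is
  written as it arises from \<open>F\<close> at \<open>t\<close> and \<open>H\<close> at
  \<open>t + e\<close>.\<close>

definition round_trip ::
    "real \<Rightarrow> 'v cl_filtration \<Rightarrow> (real \<Rightarrow> 'v \<Rightarrow> 'w) \<Rightarrow> (real \<Rightarrow> 'w \<Rightarrow> 'v) \<Rightarrow> bool" where
  "round_trip e X F H \<longleftrightarrow> (\<forall>t. \<forall>x\<in>fspace X t. \<forall>x'\<in>fclos X t {x}.
     {fmap X t (t + e + e) x', H (t + e) (F t x')} \<subseteq>
       fclos X (t + e + e) {fmap X t (t + e + e) x} \<inter> fclos X (t + e + e) {H (t + e) (F t x)})"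

context coefficients
begin

text \<open>Maps that agree on the vertices of every simplex are contiguous.\<close>

lemma homology_map_cong:
  assumes E: "face_closed E" "face_closed E'" "{} \<notin> E"
    and f: "\<And>\<sigma>. \<sigma> \<in> E \<Longrightarrow> f ` \<sigma> \<in> E'" and fg: "\<And>\<sigma> v. \<sigma> \<in> E \<Longrightarrow> v \<in> \<sigma> \<Longrightarrow> f v = g v"
    and A: "A \<in> carrier (homology j E G)"
  shows "homology_map j E' G f A = homology_map j E' G g A"
proof (rule homology_map_contiguous[OF E(1,2) _ E(3) A])
  fix \<sigma> assume \<sigma>: "\<sigma> \<in> E"
  have "g ` \<sigma> = f ` \<sigma>" using fg[OF \<sigma>] by (intro image_cong) simp_all
  then show "f ` \<sigma> \<union> g ` \<sigma> \<in> E'" using f[OF \<sigma>] by simp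
qed

end

section \<open>Interleavings induced by vertex maps\<close>

locale filtration_homology = coefficients R G for R :: "'r ring" and G :: "('r, 'g) module" +
  fixes S :: complex_functor and j :: nat
begin

abbreviation "cpx X t \<equiv> complex_of S (fspace X t) (fclos X t)"
abbreviation "PH X \<equiv> persistent_homology j S G X"

lemma PH_simps:
  "pobj (PH X) t = homology j (cpx X t) G"
  "pmap (PH X) s t = homology_map j (cpx X t) G (fmap X s t)"
  by (simp_all add: persistent_homology_def)

lemma fmap_cpx:
  assumes "filtration X" "s \<le> t" "\<sigma> \<in> cpx X s"
  shows "fmap X s t ` \<sigma> \<in> cpx X t"
  by (rule complex_of_image[OF _ _ assms(3)])
    (erule filtrationD(2)[OF assms(1,2)], erule (1) filtrationD(3)[OF assms(1,2)])

lemma face_closed_cpx: "filtration X \<Longrightarrow> face_closed (cpx X t)"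
  by (rule face_closed_complex_of[OF filtrationD(1)])

lemma persistence_module_PH:
  assumes X: "filtration X"
  shows "persistence_module R (PH X)"
  unfolding persistence_module_def PH_simps
proof (intro conjI allI impI ballI)
  note fc = face_closed_cpx[OF X]
  show "Module.module R (homology j (cpx X t) G)" for t by (rule module_homology[OF fc])
  show "homology_map j (cpx X t) G (fmap X s t) \<in>
      LinearCombinations.module_hom R (homology j (cpx X s) G) (homology j (cpx X t) G)"
    if "s \<le> t" for s t
    by (rule homology_map_hom[OF fc fc fmap_cpx[OF X that]])
  fix s t u A assume st: "s \<le> t" and tu: "t \<le> u" and A: "A \<in> carrier (homology j (cpx X s) G)"
  have "homology_map j (cpx X u) G (fmap X t u) (homology_map j (cpx X t) G (fmap X s t) A) =
      homology_map j (cpx X u) G (fmap X t u \<circ> fmap X s t) A"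
    by (rule homology_map_comp[OF fc fc fc fmap_cpx[OF X st] fmap_cpx[OF X tu] A])
  also have "\<dots> = homology_map j (cpx X u) G (fmap X s u) A"
  proof (rule homology_map_cong[OF fc fc empty_notin_complex_of _ _ A])
    fix \<sigma> assume \<sigma>: "\<sigma> \<in> cpx X s"
    show "(fmap X t u \<circ> fmap X s t) ` \<sigma> \<in> cpx X u"
      using fmap_cpx[OF X tu fmap_cpx[OF X st \<sigma>]] by (simp only: image_comp)
    show "(fmap X t u \<circ> fmap X s t) v = fmap X s u v" if "v \<in> \<sigma>" for v
      using filtrationD(4)[OF X st tu, of v] complex_of_subset[OF \<sigma>] that by auto
  qed
  finally show "homology_map j (cpx X u) G (fmap X t u) (homology_map j (cpx X t) G (fmap X s t) A) =
      homology_map j (cpx X u) G (fmap X s u) A" .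
qed

lemma vertex_map_cpx:
  assumes F: "vertex_map e X Y F" and \<sigma>: "\<sigma> \<in> cpx X t"
  shows "F t ` \<sigma> \<in> cpx Y (t + e)"
  by (rule complex_of_image[OF _ _ \<sigma>]) (erule vertex_mapD(1)[OF F], erule (1) vertex_mapD(2)[OF F])

lemma shifted_morphism_vertex_map:
  assumes X: "filtration X" and Y: "filtration Y" and F: "vertex_map e X Y F"
  shows "shifted_morphism R e (PH X) (PH Y) (\<lambda>t. homology_map j (cpx Y (t + e)) G (F t))"
  unfolding shifted_morphism_def PH_simps
proof (intro conjI allI impI ballI)
  note fX = face_closed_cpx[OF X] and fY = face_closed_cpx[OF Y]
  show "homology_map j (cpx Y (p + e)) G (F p) \<in>
      LinearCombinations.module_hom R (homology j (cpx X p) G) (homology j (cpx Y (p + e)) G)" for p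
    by (rule homology_map_hom[OF fX fY vertex_map_cpx[OF F]])
  fix p q :: real and A assume pq: "p \<le> q" and A: "A \<in> carrier (homology j (cpx X p) G)"
  have pq': "p + e \<le> q + e" using pq by simp
  have "homology_map j (cpx Y (q + e)) G (F q) (homology_map j (cpx X q) G (fmap X p q) A) =
      homology_map j (cpx Y (q + e)) G (F q \<circ> fmap X p q) A"
    by (rule homology_map_comp[OF fX fX fY fmap_cpx[OF X pq] vertex_map_cpx[OF F] A])
  also have "\<dots> = homology_map j (cpx Y (q + e)) G (fmap Y (p + e) (q + e) \<circ> F p) A"
  proof (rule homology_map_cong[OF fX fY empty_notin_complex_of _ _ A])
    fix \<sigma> assume \<sigma>: "\<sigma> \<in> cpx X p"
    show "(F q \<circ> fmap X p q) ` \<sigma> \<in> cpx Y (q + e)"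
      using vertex_map_cpx[OF F fmap_cpx[OF X pq \<sigma>]] by (simp only: image_comp)
    show "(F q \<circ> fmap X p q) v = (fmap Y (p + e) (q + e) \<circ> F p) v" if "v \<in> \<sigma>" for v
      unfolding comp_apply using complex_of_subset[OF \<sigma>] that by (intro vertex_mapD(3)[OF F pq]) auto
  qed
  also have "\<dots> = homology_map j (cpx Y (q + e)) G (fmap Y (p + e) (q + e))
      (homology_map j (cpx Y (p + e)) G (F p) A)"
    by (rule homology_map_comp[symmetric, OF fX fY fY vertex_map_cpx[OF F] fmap_cpx[OF Y pq'] A])
  finally show "homology_map j (cpx Y (q + e)) G (F q) (homology_map j (cpx X q) G (fmap X p q) A) =
      homology_map j (cpx Y (q + e)) G (fmap Y (p + e) (q + e))
      (homology_map j (cpx Y (p + e)) G (F p) A)" .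
qed

lemma homology_round_trip:
  assumes X: "filtration X" and Y: "filtration Y" and F: "vertex_map e X Y F" and H: "vertex_map e Y X H"
    and FH: "round_trip e X F H" and e: "0 \<le> e" and A: "A \<in> carrier (pobj (PH X) p)"
  shows "homology_map j (cpx X (p + e + e)) G (H (p + e)) (homology_map j (cpx Y (p + e)) G (F p) A) =
    pmap (PH X) p (p + 2 * e) A"
proof -
  note fX = face_closed_cpx[OF X] and fY = face_closed_cpx[OF Y]
  have A': "A \<in> carrier (homology j (cpx X p) G)" using A by (simp add: PH_simps)
  have pe: "p + e + e = p + 2 * e" by simp
  have "homology_map j (cpx X (p + e + e)) G (H (p + e)) (homology_map j (cpx Y (p + e)) G (F p) A) =
      homology_map j (cpx X (p + e + e)) G (H (p + e) \<circ> F p) A"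
    by (rule homology_map_comp[OF fX fY fX vertex_map_cpx[OF F] vertex_map_cpx[OF H] A'])
  also have "\<dots> = homology_map j (cpx X (p + e + e)) G (fmap X p (p + e + e)) A"
  proof (rule homology_map_contiguous[OF fX fX _ empty_notin_complex_of A'])
    fix \<sigma> assume \<sigma>: "\<sigma> \<in> cpx X p"
    show "(H (p + e) \<circ> F p) ` \<sigma> \<union> fmap X p (p + e + e) ` \<sigma> \<in> cpx X (p + e + e)"
    proof (rule complex_of_contiguous[OF _ _ _ \<sigma>])
      fix x assume x: "x \<in> fspace X p"
      show "(H (p + e) \<circ> F p) x \<in> fspace X (p + e + e)"
        unfolding comp_apply by (rule vertex_mapD(1)[OF H vertex_mapD(1)[OF F x]])
      show "fmap X p (p + e + e) x \<in> fspace X (p + e + e)" using filtrationD(2)[OF X] x e by simp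
      fix x' assume "x' \<in> fclos X p {x}"
      then show "(H (p + e) \<circ> F p) x' \<in> fclos X (p + e + e) {(H (p + e) \<circ> F p) x} \<and>
          fmap X p (p + e + e) x' \<in> fclos X (p + e + e) {(H (p + e) \<circ> F p) x} \<and>
          (H (p + e) \<circ> F p) x' \<in> fclos X (p + e + e) {fmap X p (p + e + e) x} \<and>
          fmap X p (p + e + e) x' \<in> fclos X (p + e + e) {fmap X p (p + e + e) x}"
        using FH x unfolding round_trip_def comp_apply by blast
    qed
  qed
  finally show ?thesis unfolding PH_simps pe .
qed

lemma interleaved_vertex_maps:
  assumes X: "filtration X" and Y: "filtration Y" and e: "0 \<le> e"
    and F: "vertex_map e X Y F" and H: "vertex_map e Y X H"
    and FH: "round_trip e X F H" and HF: "round_trip e Y H F"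
  shows "interleaved R e (PH X) (PH Y)"
  unfolding interleaved_def
proof (intro exI conjI allI ballI)
  show "shifted_morphism R e (PH X) (PH Y) (\<lambda>t. homology_map j (cpx Y (t + e)) G (F t))"
    by (rule shifted_morphism_vertex_map[OF X Y F])
  show "shifted_morphism R e (PH Y) (PH X) (\<lambda>t. homology_map j (cpx X (t + e)) G (H t))"
    by (rule shifted_morphism_vertex_map[OF Y X H])
qed (use homology_round_trip[OF X Y F H FH e] homology_round_trip[OF Y X H F HF e] in blast)+

end

section \<open>Selections of a correspondence\<close>

lemma eps_correspondence_swap:
  "eps_correspondence e X Y C \<Longrightarrow> eps_correspondence e Y X (C\<inverse>)"
  by (auto simp: eps_correspondence_def correspondence_def multivalued_map_def)

lemma colim_inj_total: "x \<in> fspace X t \<Longrightarrow> colim_inj X t x \<in> total_space (filtered_image X)"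
  by (auto simp: total_space_def filtered_image_def)

text \<open>For the second part, any selection may be altered at \<open>x\<close> so as to take the
  given value \<open>y\<close> there.\<close>

lemma eps_multivalued_mapD:
  assumes C: "eps_multivalued_map e X Y C"
  shows "x \<in> fspace X t \<Longrightarrow> (x, y) \<in> C \<Longrightarrow> y \<in> fspace Y (t + e)"
    and "x \<in> fspace X t \<Longrightarrow> (x, y) \<in> C \<Longrightarrow> C `` fclos X t {x} \<subseteq> fclos Y (t + e) {y}"
proof -
  show "x \<in> fspace X t \<Longrightarrow> (x, y) \<in> C \<Longrightarrow> y \<in> fspace Y (t + e)"
    using C unfolding eps_multivalued_map_def by blast
  assume x: "x \<in> fspace X t" and xy: "(x, y) \<in> C"
  have "\<forall>z\<in>total_space X. \<exists>w. (z, w) \<in> C"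
    using C unfolding eps_multivalued_map_def multivalued_map_def by blast
  then obtain f where f: "\<forall>z\<in>total_space X. (z, f z) \<in> C" by metis
  have "subordinate (total_space X) C (f(x := y))" using f xy by (simp add: subordinate_def)
  then have "C `` fclos X t {x} \<subseteq> fclos Y (t + e) ((f(x := y)) ` {x})"
    using C x unfolding eps_multivalued_map_def by blast
  then show "C `` fclos X t {x} \<subseteq> fclos Y (t + e) {y}" by simp
qed

lemma fclos_filtered_image_iff:
  assumes X: "filtration X" and x: "x \<in> fspace X t" "x' \<in> fspace X t"
  shows "colim_inj X t x' \<in> fclos (filtered_image X) t {colim_inj X t x} \<longleftrightarrow> x' \<in> fclos X t {x}"
proof -
  have "fclos X t {x} \<subseteq> fspace X t"
    using filtrationD(1)[OF X, of t] x(1) by (simp add: closure_space_def)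
  then show ?thesis
    using fclos_filtered_image[OF X, of "{x}" t] x inj_on_colim_inj[OF X, of t]
    by (auto simp: inj_on_image_mem_iff)
qed

lemma vertex_map_of_correspondence:
  assumes X: "filtration X" and Y: "filtration Y"
    and C: "eps_multivalued_map e (filtered_image X) (filtered_image Y) C"
  obtains F where "vertex_map e X Y F"
    "\<And>t x. x \<in> fspace X t \<Longrightarrow> (colim_inj X t x, colim_inj Y (t + e) (F t x)) \<in> C"
proof -
  let ?X = "filtered_image X" and ?Y = "filtered_image Y"
  note CD = eps_multivalued_mapD[OF C]
  have "\<forall>z\<in>total_space ?X. \<exists>w. (z, w) \<in> C"
    using C unfolding eps_multivalued_map_def multivalued_map_def by blast
  \<comment> \<open>One selection on the whole colimit serves all parameters, which makes
    \<open>F\<close> natural.\<close>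
  then obtain f where f: "\<forall>z\<in>total_space ?X. (z, f z) \<in> C" by metis
  have iX: "colim_inj X t x \<in> fspace ?X t" if "x \<in> fspace X t" for x t
    using that by (simp add: filtered_image_def)
  have fC: "(colim_inj X t x, f (colim_inj X t x)) \<in> C" if "x \<in> fspace X t" for x t
    using f colim_inj_total[OF that] by blast
  \<comment> \<open>The selected point is pulled back to the space at \<open>t + e\<close>, where
    \<open>colim_inj\<close> is injective.\<close>
  define F where "F t x = (SOME y. y \<in> fspace Y (t + e) \<and> colim_inj Y (t + e) y = f (colim_inj X t x))" for t x
  have F: "F t x \<in> fspace Y (t + e)" "colim_inj Y (t + e) (F t x) = f (colim_inj X t x)"
    if "x \<in> fspace X t" for t x
  proof -
    have "\<exists>y. y \<in> fspace Y (t + e) \<and> colim_inj Y (t + e) y = f (colim_inj X t x)"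
      using CD(1)[OF iX[OF that] fC[OF that]] by (auto simp: filtered_image_def)
    from someI_ex[OF this] show "F t x \<in> fspace Y (t + e)" "colim_inj Y (t + e) (F t x) = f (colim_inj X t x)"
      by (simp_all add: F_def)
  qed
  have FC: "(colim_inj X t x, colim_inj Y (t + e) (F t x)) \<in> C" if "x \<in> fspace X t" for t x
    using fC[OF that] F(2)[OF that] by simp
  have "vertex_map e X Y F"
    unfolding vertex_map_def
  proof (intro conjI allI ballI impI)
    show "F t x \<in> fspace Y (t + e)" if "x \<in> fspace X t" for t x by (rule F(1)[OF that])
    show "F t x' \<in> fclos Y (t + e) {F t x}" if x: "x \<in> fspace X t" "x' \<in> fclos X t {x}" for t x x'
    proof -
      have x': "x' \<in> fspace X t"
        using filtrationD(1)[OF X, of t] x by (auto simp: closure_space_def)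
      have "colim_inj X t x' \<in> fclos ?X t {colim_inj X t x}"
        using fclos_filtered_image_iff[OF X x(1) x'] x(2) by simp
      then have "colim_inj Y (t + e) (F t x') \<in> fclos ?Y (t + e) {colim_inj Y (t + e) (F t x)}"
        using CD(2)[OF iX[OF x(1)] FC[OF x(1)]] FC[OF x'] by blast
      then show ?thesis using fclos_filtered_image_iff[OF Y F(1)[OF x(1)] F(1)[OF x']] by simp
    qed
    fix s t x assume st: "s \<le> t" and x: "x \<in> fspace X s"
    have st': "s + e \<le> t + e" using st by simp
    have xt: "fmap X s t x \<in> fspace X t" by (rule filtrationD(2)[OF X st x])
    have "colim_inj Y (t + e) (F t (fmap X s t x)) = colim_inj Y (s + e) (F s x)"
      by (simp add: F(2)[OF xt] F(2)[OF x] colim_inj_fmap[OF X st x])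
    also have "\<dots> = colim_inj Y (t + e) (fmap Y (s + e) (t + e) (F s x))"
      by (rule colim_inj_fmap[symmetric, OF Y st' F(1)[OF x]])
    finally show "F t (fmap X s t x) = fmap Y (s + e) (t + e) (F s x)"
      by (rule inj_onD[OF inj_on_colim_inj[OF Y]]) (rule F(1)[OF xt], rule filtrationD(2)[OF Y st' F(1)[OF x]])
  qed
  with FC show ?thesis using that by blast
qed

text \<open>In the colimit, both \<open>fmap X t (t + e + e) x\<close> and
  \<open>H (t + e) (F t x)\<close> are related by \<open>C\<close> to \<open>F t x\<close>, and
  likewise for \<open>x'\<close>. The value of a selection of the transpose may be prescribed at
  \<open>F t x\<close>, so each of the first two has both points over \<open>x'\<close> in its
  closure.\<close>

lemma round_trip_of_correspondence:
  assumes X: "filtration X" and Y: "filtration Y" and e: "0 \<le> e"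
    and C: "eps_correspondence e (filtered_image X) (filtered_image Y) C"
    and F: "vertex_map e X Y F" and H: "vertex_map e Y X H"
    and FC: "\<And>t x. x \<in> fspace X t \<Longrightarrow> (colim_inj X t x, colim_inj Y (t + e) (F t x)) \<in> C"
    and HC: "\<And>t y. y \<in> fspace Y t \<Longrightarrow> (colim_inj X (t + e) (H t y), colim_inj Y t y) \<in> C"
  shows "round_trip e X F H"
  unfolding round_trip_def
proof (intro allI ballI)
  let ?X = "filtered_image X" and ?Y = "filtered_image Y"
  fix t x x' assume x: "x \<in> fspace X t" and x'x: "x' \<in> fclos X t {x}"
  have x': "x' \<in> fspace X t"
    using filtrationD(1)[OF X, of t] x x'x by (auto simp: closure_space_def)
  have mem: "F t z \<in> fspace Y (t + e)" "H (t + e) (F t z) \<in> fspace X (t + e + e)"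
    "fmap X t (t + e + e) z \<in> fspace X (t + e + e)" if "z \<in> fspace X t" for z
  proof -
    show "F t z \<in> fspace Y (t + e)" by (rule vertex_mapD(1)[OF F that])
    then show "H (t + e) (F t z) \<in> fspace X (t + e + e)" by (rule vertex_mapD(1)[OF H])
    show "fmap X t (t + e + e) z \<in> fspace X (t + e + e)" using e by (intro filtrationD(2)[OF X _ that]) simp
  qed
  have C': "eps_multivalued_map e ?Y ?X (C\<inverse>)" using C by (simp add: eps_correspondence_def)
  let ?i = "colim_inj X (t + e + e)" and ?m = "fmap X t (t + e + e)"
  have inC: "(?i w, colim_inj Y (t + e) (F t z)) \<in> C"
    if z: "z \<in> fspace X t" and w: "w \<in> {?m z, H (t + e) (F t z)}" for z w
  proof -
    have "?i (?m z) = colim_inj X t z" using e by (intro colim_inj_fmap[OF X _ z]) simp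
    then have "(?i (?m z), colim_inj Y (t + e) (F t z)) \<in> C" using FC[OF z] by simp
    then show ?thesis using w HC[OF mem(1)[OF z]] by blast
  qed
  have "F t x' \<in> fclos Y (t + e) {F t x}"
    by (rule vertex_mapD(2)[OF F x x'x])
  then have cl: "colim_inj Y (t + e) (F t x') \<in> fclos ?Y (t + e) {colim_inj Y (t + e) (F t x)}"
    using fclos_filtered_image_iff[OF Y mem(1)[OF x] mem(1)[OF x']] by simp
  have sp: "colim_inj Y (t + e) (F t x) \<in> fspace ?Y (t + e)"
    using mem(1)[OF x] by (simp add: filtered_image_def)
  have "w' \<in> fclos X (t + e + e) {w}"
    if w: "w \<in> {?m x, H (t + e) (F t x)}" and w': "w' \<in> {?m x', H (t + e) (F t x')}" for w w'
  proof -
    have "(colim_inj Y (t + e) (F t x), ?i w) \<in> C\<inverse>" using inC[OF x w] by simp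
    from eps_multivalued_mapD(2)[OF C' sp this] inC[OF x' w'] cl
    have "?i w' \<in> fclos ?X (t + e + e) {?i w}" by blast
    moreover have "w \<in> fspace X (t + e + e)" "w' \<in> fspace X (t + e + e)"
      using w w' mem[OF x] mem[OF x'] by auto
    ultimately show ?thesis using fclos_filtered_image_iff[OF X] by blast
  qed
  then show "{?m x', H (t + e) (F t x')} \<subseteq>
      fclos X (t + e + e) {?m x} \<inter> fclos X (t + e + e) {H (t + e) (F t x)}"
    by blast
qed

lemma (in filtration_homology) interleaved_of_correspondence:
  assumes X: "filtration X" and Y: "filtration Y" and e: "0 \<le> e"
    and C: "eps_correspondence e (filtered_image X) (filtered_image Y) C"
  shows "interleaved R e (PH X) (PH Y)"
proof -
  note C' = eps_correspondence_swap[OF C]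
  obtain F where F: "vertex_map e X Y F"
    "\<And>t x. x \<in> fspace X t \<Longrightarrow> (colim_inj X t x, colim_inj Y (t + e) (F t x)) \<in> C"
    using vertex_map_of_correspondence[OF X Y] C unfolding eps_correspondence_def by blast
  obtain H where H: "vertex_map e Y X H"
    "\<And>t y. y \<in> fspace Y t \<Longrightarrow> (colim_inj Y t y, colim_inj X (t + e) (H t y)) \<in> C\<inverse>"
    using vertex_map_of_correspondence[OF Y X] C unfolding eps_correspondence_def by blast
  have "round_trip e X F H"
    using F H by (intro round_trip_of_correspondence[OF X Y e C]) auto
  moreover have "round_trip e Y H F"
    using F H by (intro round_trip_of_correspondence[OF Y X e C']) auto
  ultimately show ?thesis using interleaved_vertex_maps[OF X Y e F(1) H(1)] by blast
qed

section \<open>The Alexandroff modification and the distance\<close>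

lemma fclos_filtered_image_alexandroff:
  assumes X: "filtration X" and B: "B \<subseteq> fspace (filtered_image X) t"
  shows "fclos (filtered_image (alexandroff_filtration X)) t B = (\<Union>b\<in>B. fclos (filtered_image X) t {b})"
proof -
  have inj: "colim_inj (alexandroff_filtration X) = colim_inj X"
    by (simp add: fun_eq_iff colim_inj_def colim_rel_def alexandroff_filtration_def)
  obtain A where A: "A \<subseteq> fspace X t" "B = colim_inj X t ` A"
    using B by (metis (no_types, lifting) cl_filtration.select_convs(1) filtered_image_def subset_imageE)
  have "fclos (filtered_image (alexandroff_filtration X)) t B =
      colim_inj X t ` (\<Union>a\<in>A. fclos X t {a})"
    using fclos_filtered_image[OF filtration_alexandroff[OF X], of A t] A
    unfolding inj by (simp add: alexandroff_filtration_def alexandroff_def)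
  also have "\<dots> = (\<Union>a\<in>A. fclos (filtered_image X) t {colim_inj X t a})"
    unfolding image_UN
  proof (rule SUP_cong[OF refl])
    fix a assume "a \<in> A"
    then show "colim_inj X t ` fclos X t {a} = fclos (filtered_image X) t {colim_inj X t a}"
      using fclos_filtered_image[OF X, of "{a}" t] A(1) by (simp add: subset_iff)
  qed
  finally show ?thesis using A(2) by simp
qed

lemma filtered_image_alexandroff_space:
  "fspace (filtered_image (alexandroff_filtration X)) = fspace (filtered_image X)"
  by (simp add: fun_eq_iff filtered_image_def colim_inj_def colim_rel_def alexandroff_filtration_def)

lemma total_space_filtered_image_alexandroff:
  "total_space (filtered_image (alexandroff_filtration X)) = total_space (filtered_image X)"
  by (simp add: total_space_def filtered_image_alexandroff_space)

text \<open>The closures of points are unchanged, and for a point the closure condition holds with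
  any related value. Taking the union over the points of \<open>A\<close> gives it for
  \<open>A\<close>.\<close>

lemma eps_multivalued_map_alexandroff:
  assumes X: "filtration X" and Y: "filtration Y"
    and C: "eps_multivalued_map e (filtered_image X) (filtered_image Y) C"
  shows "eps_multivalued_map e (filtered_image (alexandroff_filtration X))
    (filtered_image (alexandroff_filtration Y)) C"
  unfolding eps_multivalued_map_def total_space_filtered_image_alexandroff filtered_image_alexandroff_space
proof (intro conjI allI impI)
  note CD = eps_multivalued_mapD[OF C]
  show "multivalued_map (total_space (filtered_image X)) (total_space (filtered_image Y)) C"
    using C by (simp add: eps_multivalued_map_def)
  fix t
  show "y \<in> fspace (filtered_image Y) (t + e)" if "x \<in> fspace (filtered_image X) t" "(x, y) \<in> C" for x y
    using CD(1) that .
  fix A f assume A: "A \<subseteq> fspace (filtered_image X) t"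
    and f: "subordinate (total_space (filtered_image X)) C f"
  have fC: "(a, f a) \<in> C" if "a \<in> A" for a
    using f A that by (auto simp: subordinate_def total_space_def)
  have fA: "f ` A \<subseteq> fspace (filtered_image Y) (t + e)"
    using CD(1)[OF _ fC] A by blast
  have "C `` (\<Union>b\<in>A. fclos (filtered_image X) t {b}) \<subseteq> (\<Union>b\<in>f ` A. fclos (filtered_image Y) (t + e) {b})"
    using CD(2)[OF _ fC] A by fast
  then show "C `` fclos (filtered_image (alexandroff_filtration X)) t A \<subseteq>
      fclos (filtered_image (alexandroff_filtration Y)) (t + e) (f ` A)"
    unfolding fclos_filtered_image_alexandroff[OF X A] fclos_filtered_image_alexandroff[OF Y fA] .
qed

lemma eps_correspondence_alexandroff:
  assumes "filtration X" and "filtration Y"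
    and "eps_correspondence e (filtered_image X) (filtered_image Y) C"
  shows "eps_correspondence e (filtered_image (alexandroff_filtration X))
    (filtered_image (alexandroff_filtration Y)) C"
  using assms unfolding eps_correspondence_def total_space_filtered_image_alexandroff
  by (auto intro: eps_multivalued_map_alexandroff)

text \<open>An \<open>\<epsilon>\<close>-correspondence is in particular a correspondence, so the
  two nested infima merge into one; the factor 2 cancels the half in \<open>d_GH_filtered\<close>,
  at infinity as well.\<close>

lemma two_times_d_GH:
  "2 * d_GH X Y = Inf {ereal e | e. e \<ge> 0 \<and> (\<exists>C. eps_correspondence e (filtered_image X) (filtered_image Y) C)}"
  (is "_ = Inf ?S")
proof -
  let ?X = "filtered_image X" and ?Y = "filtered_image Y"
  have "2 * (x / 2) = x" for x :: ereal by (cases x) auto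
  then have "2 * d_GH X Y = (INF C\<in>{C. correspondence (total_space ?X) (total_space ?Y) C}. distortion ?X ?Y C)"
    by (simp add: d_GH_def d_GH_filtered_def)
  also have "\<dots> = Inf ?S"
  proof (rule antisym)
    show "(INF C\<in>{C. correspondence (total_space ?X) (total_space ?Y) C}. distortion ?X ?Y C) \<le> Inf ?S"
    proof (rule Inf_greatest)
      fix x assume "x \<in> ?S"
      then obtain e C where *: "x = ereal e" "e \<ge> 0" "eps_correspondence e ?X ?Y C" by blast
      have "distortion ?X ?Y C \<le> x" unfolding distortion_def using * by (intro Inf_lower) blast
      moreover have "correspondence (total_space ?X) (total_space ?Y) C"
        using *(3) by (simp add: eps_correspondence_def)
      ultimately show "(INF C\<in>{C. correspondence (total_space ?X) (total_space ?Y) C}. distortion ?X ?Y C) \<le> x"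
        by (intro INF_lower2) auto
    qed
    show "Inf ?S \<le> (INF C\<in>{C. correspondence (total_space ?X) (total_space ?Y) C}. distortion ?X ?Y C)"
      unfolding distortion_def by (intro INF_greatest Inf_superset_mono) blast
  qed
  finally show ?thesis .
qed

lemma module_regular_module:
  assumes "field K"
  shows "Module.module K (regular_module K)"
proof -
  interpret field K by fact
  show ?thesis
    by (rule module_criteria) (auto simp: regular_module_def cring_axioms a_ac m_assoc l_distr r_distr
        intro!: bexI[of _ "\<ominus>\<^bsub>K\<^esub> _"] r_neg)
qed

lemma interleaved_of_alexandroff_correspondence:
  assumes "Module.module R G" and X: "filtration X" and Y: "filtration Y" and e: "0 \<le> e"
    and C: "eps_correspondence e (filtered_image (alexandroff_filtration X))
      (filtered_image (alexandroff_filtration Y)) C"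
  shows "interleaved R e (persistent_homology j S G X) (persistent_homology j S G Y)"
proof -
  interpret filtration_homology R G S j
    using assms(1) by (simp add: filtration_homology_def coefficients_def)
  show ?thesis
    using interleaved_of_correspondence[OF filtration_alexandroff[OF X] filtration_alexandroff[OF Y] e C]
    by (simp only: persistent_homology_alexandroff)
qed

theorem theorem8p35:
  fixes X :: "'a cl_filtration" and Y :: "'b cl_filtration"
    and S :: complex_functor and j :: nat
    and R :: "'r ring" and G :: "('r, 'g) module"
    and K :: "'k ring"
  assumes "filtration X" and "filtration Y" and "Module.module R G"
  shows
    "d_I R (persistent_homology j S G X) (persistent_homology j S G Y) =
       d_I R (persistent_homology j S G (alexandroff_filtration X))
             (persistent_homology j S G (alexandroff_filtration Y)) \<and>
     d_I R (persistent_homology j S G (alexandroff_filtration X))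
           (persistent_homology j S G (alexandroff_filtration Y))
       \<le> 2 * d_GH (alexandroff_filtration X) (alexandroff_filtration Y) \<and>
     2 * d_GH (alexandroff_filtration X) (alexandroff_filtration Y) \<le> 2 * d_GH X Y \<and>
     (field K \<longrightarrow>
      q_tame K (persistent_homology j S (regular_module K) X) \<longrightarrow>
      q_tame K (persistent_homology j S (regular_module K) Y) \<longrightarrow>
      d_B (pers_diagram K (persistent_homology j S (regular_module K) X))
          (pers_diagram K (persistent_homology j S (regular_module K) Y))
        \<le> 2 * d_GH (alexandroff_filtration X) (alexandroff_filtration Y))"
proof (intro conjI impI)
  note X = assms(1) and Y = assms(2)
  let ?AX = "alexandroff_filtration X" and ?AY = "alexandroff_filtration Y"
  note inter = interleaved_of_alexandroff_correspondence[OF _ X Y]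
  show "d_I R (persistent_homology j S G X) (persistent_homology j S G Y) =
      d_I R (persistent_homology j S G ?AX) (persistent_homology j S G ?AY)"
    by (simp only: persistent_homology_alexandroff)
  \<comment> \<open>Here and below, an inequality between infima is an inclusion of the sets of
    admissible \<open>\<epsilon>\<close>.\<close>
  show "d_I R (persistent_homology j S G ?AX) (persistent_homology j S G ?AY) \<le> 2 * d_GH ?AX ?AY"
    unfolding d_I_def two_times_d_GH persistent_homology_alexandroff
    using inter[OF assms(3)] by (intro Inf_superset_mono) blast
  show "2 * d_GH ?AX ?AY \<le> 2 * d_GH X Y"
    unfolding two_times_d_GH using eps_correspondence_alexandroff[OF X Y]
    by (intro Inf_superset_mono) blast
  assume K: "field K" and qX: "q_tame K (persistent_homology j S (regular_module K) X)"
    and qY: "q_tame K (persistent_homology j S (regular_module K) Y)"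
  interpret filtration_homology K "regular_module K" S j
    using module_regular_module[OF K] by (simp add: filtration_homology_def coefficients_def)
  show "d_B (pers_diagram K (PH X)) (pers_diagram K (PH Y)) \<le> 2 * d_GH ?AX ?AY"
    unfolding d_B_def two_times_d_GH
    using bottleneck_stability[OF K persistence_module_PH[OF X] persistence_module_PH[OF Y] qX qY]
      inter[OF module_regular_module[OF K]]
    by (intro Inf_superset_mono) blast
qed

end
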